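(* For every $\lambda>1$ there exists $c>0$ such that for all integers $m,n\ge1$ the mixing time of the Glauber dynamics with parameter $\lambda$ on the set $\Omega_{m,n}$ of triangulations of $\Lambda^0_{m,n}$, in the absence of constraints, satisfies $$T_{\mathrm{mix}}\ge \exp\bigl(c(m+n)\bigr).$$
   Context: Triangulations. $\Lambda^0_{m,n}=\{0,1,\dots,m\}\times\{0,1,\dots,n\}\subset\mathbb{Z}^2$. An edge is a straight segment joining two points of $\Lambda^0_{m,n}$ and passing through no other integer point. Two edges cross if they are distinct and meet at a point that is not a common endpoint. A (full) triangulation of $\Lambda^0_{m,n}$ is a maximal set of pairwise noncrossing edges; $\Omega_{m,n}$ is the set of all of them. In every triangulation the set of midpoints of the edges is exactly $\Lambda=\Lambda_{m,n}=\bigl(\{0,\frac12,1,\dots,m\}\times\{0,\frac12,1,\dots,n\}\bigr)\setminus\Lambda^0_{m,n}$, each midpoint occurring once; so a triangulation is written $\sigma=\{\sigma_x\}_{x\in\Lambda}$, where $\sigma_x$ is the edge with midpoint $x$. Gibbs distribution. $|\sigma_x|$ is the $\ell_1$ length of $\sigma_x$, $|\sigma|=\sum_x|\sigma_x|$, and $\mu(\sigma)=\lambda^{|\sigma|}/\sum_{\tau\in\Omega_{m,n}}\lambda^{|\tau|}$. Glauber dynamics. An edge $\sigma_x$ lying in two triangles of $\sigma$ is flippable if the two triangles form a convex quadrilateral (then necessarily a parallelogram); the flip replaces $\sigma_x$ by the other diagonal $\sigma_x'$ (also with midpoint $x$). One step from $\sigma$: pick $x\in\Lambda$ uniformly at random;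 if $\sigma_x$ is flippable to $\sigma'_x$, flip it with probability $\lambda^{|\sigma'_x|}/(\lambda^{|\sigma'_x|}+\lambda^{|\sigma_x|})$; otherwise do nothing. Mixing time. $T_{\mathrm{mix}}=\inf\{t\in\mathbb{N}:\max_{\sigma}\|p^t(\sigma,\cdot)-\mu\|\le 1/4\}$, where $p^t(\sigma,\cdot)$ is the law after $t$ steps started at $\sigma$ and $\|\cdot\|$ is total variation distance. *)

theory Defs
  imports "HOL-Probability.Probability"
begin

type_synonym point = "real \<times> real"
type_synonym segment = "point set"

definition lattice_rect :: "nat \<Rightarrow> nat \<Rightarrow> point set" where
  "lattice_rect m n = {(real i, real j) | i j. i \<le> m \<and> j \<le> n}"

definition lattice_edges :: "nat \<Rightarrow> nat \<Rightarrow> segment set" where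
  "lattice_edges m n = {closed_segment a b | a b.
     a \<in> lattice_rect m n \<and> b \<in> lattice_rect m n \<and> a \<noteq> b \<and>
     closed_segment a b \<inter> (\<int> \<times> \<int>) = {a, b}}"

text \<open>The endpoints of a segment are its extreme points.\<close>

definition endpoints :: "segment \<Rightarrow> point set" where
  "endpoints e = {p. p extreme_point_of e}"

definition edges_cross :: "segment \<Rightarrow> segment \<Rightarrow> bool" where
  "edges_cross e f \<longleftrightarrow> e \<noteq> f \<and> (\<exists>p \<in> e \<inter> f. p \<notin> endpoints e \<inter> endpoints f)"

definition noncrossing :: "segment set \<Rightarrow> bool" where
  "noncrossing S \<longleftrightarrow> (\<forall>e \<in> S. \<forall>f \<in> S. \<not> edges_cross e f)"

definition triangulations :: "nat \<Rightarrow> nat \<Rightarrow> segment set set" where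
  "triangulations m n = {\<sigma>. \<sigma> \<subseteq> lattice_edges m n \<and> noncrossing \<sigma> \<and>
     (\<forall>\<tau>. \<tau> \<subseteq> lattice_edges m n \<and> noncrossing \<tau> \<and> \<sigma> \<subseteq> \<tau> \<longrightarrow> \<tau> = \<sigma>)}"

definition midpoint_set :: "nat \<Rightarrow> nat \<Rightarrow> point set" where
  "midpoint_set m n =
     {(real i / 2, real j / 2) | i j. i \<le> 2 * m \<and> j \<le> 2 * n} - lattice_rect m n"

definition edge_midpoint :: "segment \<Rightarrow> point" where
  "edge_midpoint e = (THE x. \<exists>a b. e = closed_segment a b \<and> x = midpoint a b)"

definition edge_at :: "segment set \<Rightarrow> point \<Rightarrow> segment" where
  "edge_at \<sigma> x = (THE e. e \<in> \<sigma> \<and> edge_midpoint e = x)"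

definition edge_length :: "segment \<Rightarrow> real" where
  "edge_length e =
     (THE l. \<exists>a b. e = closed_segment a b \<and> l = \<bar>fst a - fst b\<bar> + \<bar>snd a - snd b\<bar>)"

definition total_length :: "nat \<Rightarrow> nat \<Rightarrow> segment set \<Rightarrow> real" where
  "total_length m n \<sigma> = (\<Sum>x \<in> midpoint_set m n. edge_length (edge_at \<sigma> x))"

definition gibbs :: "real \<Rightarrow> nat \<Rightarrow> nat \<Rightarrow> segment set pmf" where
  "gibbs lam m n = embed_pmf (\<lambda>\<sigma>.
     if \<sigma> \<in> triangulations m n
     then lam powr total_length m n \<sigma> / (\<Sum>\<tau> \<in> triangulations m n. lam powr total_length m n \<tau>)
     else 0)"

text \<open>
  Three edges of a triangulation may bound a region that is subdivided further, for instance
  the triangle with vertices (0,0), (1,2), (2,1), which contains the lattice point (1,1).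
  The interior condition excludes this, so that the triangles of a triangulation are its
  bounded faces.
\<close>

definition triangle_in :: "segment set \<Rightarrow> point \<Rightarrow> point \<Rightarrow> point \<Rightarrow> bool" where
  "triangle_in \<sigma> a b c \<longleftrightarrow> \<not> collinear {a, b, c} \<and>
     closed_segment a b \<in> \<sigma> \<and> closed_segment b c \<in> \<sigma> \<and> closed_segment a c \<in> \<sigma> \<and>
     interior (convex hull {a, b, c}) \<inter> \<Union>\<sigma> = {}"

text \<open>
  Convexity of the union is not enough for a convex quadrilateral: the union degenerates to a
  triangle when an endpoint of the common edge lies on the segment between the two apexes.
  Hence all four points are required to be vertices of the union.
\<close>

definition is_flip :: "segment set \<Rightarrow> segment \<Rightarrow> segment \<Rightarrow> bool" where
  "is_flip \<sigma> e e' \<longleftrightarrow> (\<exists>a b c d. c \<noteq> d \<and>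
     e = closed_segment a b \<and> e' = closed_segment c d \<and>
     triangle_in \<sigma> a b c \<and> triangle_in \<sigma> a b d \<and>
     (let Q = convex hull {a, b, c} \<union> convex hull {a, b, d}
      in convex Q \<and> {p. p extreme_point_of Q} = {a, b, c, d}))"

definition flippable :: "segment set \<Rightarrow> segment \<Rightarrow> bool" where
  "flippable \<sigma> e \<longleftrightarrow> (\<exists>e'. is_flip \<sigma> e e')"

definition flipped_edge :: "segment set \<Rightarrow> segment \<Rightarrow> segment" where
  "flipped_edge \<sigma> e = (THE e'. is_flip \<sigma> e e')"

definition glauber_step :: "real \<Rightarrow> nat \<Rightarrow> nat \<Rightarrow> segment set \<Rightarrow> segment set pmf" where
  "glauber_step lam m n \<sigma> =
     bind_pmf (pmf_of_set (midpoint_set m n)) (\<lambda>x.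
       let e = edge_at \<sigma> x; e' = flipped_edge \<sigma> e in
       if flippable \<sigma> e
       then map_pmf (\<lambda>accept. if accept then insert e' (\<sigma> - {e}) else \<sigma>)
              (bernoulli_pmf (lam powr edge_length e' /
                 (lam powr edge_length e' + lam powr edge_length e)))
       else return_pmf \<sigma>)"

primrec glauber_law :: "real \<Rightarrow> nat \<Rightarrow> nat \<Rightarrow> nat \<Rightarrow> segment set \<Rightarrow> segment set pmf" where
  "glauber_law lam m n 0 \<sigma> = return_pmf \<sigma>"
| "glauber_law lam m n (Suc t) \<sigma> = bind_pmf (glauber_law lam m n t \<sigma>) (glauber_step lam m n)"

definition tv_dist :: "'a pmf \<Rightarrow> 'a pmf \<Rightarrow> real" where
  "tv_dist p q = (SUP A. \<bar>measure_pmf.prob p A - measure_pmf.prob q A\<bar>)"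

text \<open>The infimum is taken in \<^typ>\<open>enat\<close>, so that the infimum of the empty set is infinite.\<close>

definition mixing_time :: "real \<Rightarrow> nat \<Rightarrow> nat \<Rightarrow> enat" where
  "mixing_time lam m n = Inf {enat t | t.
     (MAX \<sigma> \<in> triangulations m n. tv_dist (glauber_law lam m n t \<sigma>) (gibbs lam m n)) \<le> 1 / 4}"

end

theory Submission
  imports Defs
begin

text \<open>
  Since \<open>\<lambda> > 1\<close>, long edges are favoured, and a triangulation in which all edges of a horizontal
  strip lean far to the right must pass through much shorter ones before they can lean to the left.
  The proof turns this into an explicit trap and starts the chain inside it.

  A triangulation containing every unit horizontal edge splits into \<open>n\<close> independent strips of height
  one. The edges crossing one strip, listed by their midpoints \<open>(k/2, j + 1/2)\<close>, form a lattice path: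
  between consecutive edges exactly one of the two endpoints moves one unit to the right. A flip of
  such an edge exchanges two adjacent steps of the path. The only other flips are those of the
  horizontal edges between two neighbouring strips, and they would destroy the strip structure.

  They are excluded by a zigzag. Strips lean alternately to the right and to the left, and in each
  strip the first and the last \<open>\<lceil>m/2\<rceil>\<close> steps of the path are those of the extreme, longest path.
  The triangles above and below a horizontal edge then have their apexes near the same end of the
  strips, and the segment between the apexes misses the midpoint of the edge, so that the two
  triangles never form a parallelogram (\<open>turn_rows_rigid\<close>). Within this set of
  triangulations, the trap, the dynamics is just the exchange of adjacent steps in \<open>n\<close> separate paths,
  and it leaves the trap only by disturbing the last step of a frozen beginning or the first step of
  a frozen end.

  Such an exit needs the free middle part of a path, with \<open>p = \<lfloor>m/2\<rfloor>\<close> steps of either kind, to begin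
  or to end with the wrong step. Moving this step to the other end of the middle part is injective,
  stays in the trap and increases the total length by \<open>2 p\<close> (\<open>delay_rise_excess\<close>,
  \<open>advance_flat_excess\<close>). Hence the flow out of the trap is at most \<open>\<lambda> powr (- 2 p) / 4\<close> times its
  weight (\<open>exit_flow\<close>; the factor \<open>1/4\<close> is there because a given midpoint is rarely selected).
  Detailed balance inside the trap implies that the chain started from a suitable trapped
  triangulation is still trapped after \<open>\<lambda> powr (2 p)\<close> steps with probability above \<open>3/4\<close>
  (\<open>reversible_trap\<close>, \<open>trap_survival\<close>). The zigzag with all directions reversed is a
  disjoint trap, so one of the two has equilibrium probability at most \<open>1/2\<close>, and from that one the
  chain is still at distance more than \<open>1/4\<close> from equilibrium.

  This gives \<open>T_mix > \<lambda> powr (2 \<lfloor>m/2\<rfloor>)\<close> for all \<open>m, n \<ge> 1\<close>. Exchanging the coordinates gives the same bound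
  with \<open>n\<close> in place of \<open>m\<close>, and the larger of the two is exponential in \<open>m + n\<close>.
\<close>

section \<open>Survival of a reversible chain in a trap\<close>

lemma integrable_pmf_bounded:
  fixes h :: "'a \<Rightarrow> real"
  assumes "\<And>x. \<bar>h x\<bar> \<le> 1" shows "integrable (measure_pmf p) h"
  using assms by (intro measure_pmf.integrable_const_bound[where B = 1]) auto

lemma prob_bind_pmf:
  "measure_pmf.prob (bind_pmf p f) A = (\<integral>x. measure_pmf.prob (f x) A \<partial>measure_pmf p)"
proof -
  let ?g = "\<lambda>b. measure_pmf.prob (f b) A"
  have "ennreal (measure_pmf.prob (bind_pmf p f) A) = (\<integral>\<^sup>+x. ennreal (?g x) \<partial>p)"
    using emeasure_bind_pmf[of p f A] by (simp add: measure_pmf.emeasure_eq_measure)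
  also have "\<dots> = ennreal (\<integral>x. ?g x \<partial>p)"
    by (intro nn_integral_eq_integral integrable_pmf_bounded) auto
  finally show ?thesis by (subst (asm) ennreal_inj) (auto intro!: integral_nonneg_AE)
qed

lemma prob_bind_pmf_ge:
  assumes "finite B"
  shows "(\<Sum>b\<in>B. pmf p b * measure_pmf.prob (f b) A) \<le> measure_pmf.prob (bind_pmf p f) A"
proof -
  let ?g = "\<lambda>b. measure_pmf.prob (f b) A"
  have "(\<Sum>b\<in>B. pmf p b * ?g b) = (\<integral>x. indicator B x * ?g x \<partial>p)"
    by (subst integral_measure_pmf_real[OF assms]) (auto simp: indicator_def mult.commute split: if_splits)
  also have "\<dots> \<le> (\<integral>x. ?g x \<partial>p)"
    by (intro integral_mono integrable_pmf_bounded) (auto simp: indicator_def)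
  finally show ?thesis by (simp add: prob_bind_pmf)
qed

text \<open>
  The law of the chain is defined by appending steps at its end, whereas survival in a trap is
  estimated by splitting off the first step.
\<close>

lemma law_first_step:
  assumes "\<And>\<sigma>. L 0 \<sigma> = return_pmf \<sigma>"
    and "\<And>t \<sigma>. L (Suc t) \<sigma> = bind_pmf (L t \<sigma>) K"
  shows "L (Suc t) \<sigma> = bind_pmf (K \<sigma>) (L t)"
proof (induction t arbitrary: \<sigma>)
  case 0
  have "L 0 = return_pmf" using assms(1) by (rule ext)
  then show ?case using assms(2)[of 0 \<sigma>] by (simp add: bind_return_pmf bind_return_pmf')
next
  case (Suc t)
  have "L (Suc (Suc t)) \<sigma> = bind_pmf (bind_pmf (K \<sigma>) (L t)) K"
    using assms(2)[of "Suc t" \<sigma>] Suc.IH[of \<sigma>] by simp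
  also have "\<dots> = bind_pmf (K \<sigma>) (\<lambda>\<tau>. bind_pmf (L t \<tau>) K)" by (rule bind_assoc_pmf)
  also have "\<dots> = bind_pmf (K \<sigma>) (L (Suc t))" using assms(2)[of t] by presburger
  finally show ?case .
qed

text \<open>
  With respect to the weights \<open>W\<close> the transition matrix restricted to the trap \<open>A\<close> is symmetric. Summed
  against \<open>W\<close>, a row of it may therefore be replaced by a column, whose sum is the probability to
  remain in \<open>A\<close>. So one more step costs the total surviving weight at most the weighted one-step
  outflow, and \<open>t\<close> steps cost at most \<open>t\<close> times as much.
\<close>

lemma reversible_trap:
  fixes K :: "'a \<Rightarrow> 'a pmf" and W :: "'a \<Rightarrow> real"
  assumes L: "\<And>\<sigma>. L 0 \<sigma> = return_pmf \<sigma>" "\<And>t \<sigma>. L (Suc t) \<sigma> = bind_pmf (L t \<sigma>) K"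
    and fin: "finite A" and W: "\<And>\<sigma>. \<sigma> \<in> A \<Longrightarrow> 0 \<le> W \<sigma>"
    and rev: "\<And>\<sigma> \<tau>. \<sigma> \<in> A \<Longrightarrow> \<tau> \<in> A \<Longrightarrow> W \<sigma> * pmf (K \<sigma>) \<tau> = W \<tau> * pmf (K \<tau>) \<sigma>"
  shows "(\<Sum>\<sigma>\<in>A. W \<sigma>) - real t * (\<Sum>\<sigma>\<in>A. W \<sigma> * measure_pmf.prob (K \<sigma>) (- A))
           \<le> (\<Sum>\<sigma>\<in>A. W \<sigma> * measure_pmf.prob (L t \<sigma>) A)"
proof (induction t)
  case 0
  have "measure_pmf.prob (L 0 \<sigma>) A = 1" if "\<sigma> \<in> A" for \<sigma>
    using that L(1) by simp
  then show ?case by simp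
next
  case (Suc t)
  let ?H = "\<lambda>\<sigma>. measure_pmf.prob (L t \<sigma>) A"
  let ?F = "\<Sum>\<sigma>\<in>A. W \<sigma> * measure_pmf.prob (K \<sigma>) (- A)"
  have stay: "(\<Sum>\<sigma>\<in>A. pmf (K \<tau>) \<sigma>) = 1 - measure_pmf.prob (K \<tau>) (- A)" for \<tau>
    using measure_pmf.prob_compl[of A "K \<tau>"] measure_measure_pmf_finite[OF fin, of "K \<tau>"]
    by (simp add: Compl_eq_Diff_UNIV)
  have "(\<Sum>\<sigma>\<in>A. W \<sigma>) - real (Suc t) * ?F \<le> (\<Sum>\<tau>\<in>A. W \<tau> * ?H \<tau>) - ?F"
    using Suc.IH by (simp add: algebra_simps)
  also have "\<dots> = (\<Sum>\<tau>\<in>A. W \<tau> * ?H \<tau> - W \<tau> * measure_pmf.prob (K \<tau>) (- A))"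
    by (simp add: sum_subtractf)
  also have "\<dots> \<le> (\<Sum>\<tau>\<in>A. W \<tau> * ?H \<tau> * (\<Sum>\<sigma>\<in>A. pmf (K \<tau>) \<sigma>))"
  proof (rule sum_mono)
    fix \<tau> assume "\<tau> \<in> A"
    have "W \<tau> * measure_pmf.prob (K \<tau>) (- A) * ?H \<tau> \<le> W \<tau> * measure_pmf.prob (K \<tau>) (- A) * 1"
      using W[OF \<open>\<tau> \<in> A\<close>] by (intro mult_left_mono) auto
    then show "W \<tau> * ?H \<tau> - W \<tau> * measure_pmf.prob (K \<tau>) (- A) \<le> W \<tau> * ?H \<tau> * (\<Sum>\<sigma>\<in>A. pmf (K \<tau>) \<sigma>)"
      unfolding stay by (simp add: algebra_simps)
  qed
  \<comment> \<open>Detailed balance turns the exit probability of the target into transitions of the source.\<close>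
  also have "\<dots> = (\<Sum>\<tau>\<in>A. \<Sum>\<sigma>\<in>A. W \<sigma> * pmf (K \<sigma>) \<tau> * ?H \<tau>)"
    unfolding sum_distrib_left by (intro sum.cong refl) (simp add: rev mult_ac)
  also have "\<dots> = (\<Sum>\<sigma>\<in>A. W \<sigma> * (\<Sum>\<tau>\<in>A. pmf (K \<sigma>) \<tau> * ?H \<tau>))"
    by (subst sum.swap) (simp add: sum_distrib_left mult.assoc)
  also have "\<dots> \<le> (\<Sum>\<sigma>\<in>A. W \<sigma> * measure_pmf.prob (L (Suc t) \<sigma>) A)"
  proof (intro sum_mono mult_left_mono W)
    fix \<sigma>
    show "(\<Sum>\<tau>\<in>A. pmf (K \<sigma>) \<tau> * ?H \<tau>) \<le> measure_pmf.prob (L (Suc t) \<sigma>) A"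
      unfolding law_first_step[of L K, OF L] by (rule prob_bind_pmf_ge[OF fin])
  qed
  finally show ?case .
qed

section \<open>Lattice edges\<close>

lemma endpoints_segment [simp]: "endpoints (closed_segment a b) = {a, b}"
  by (auto simp: endpoints_def extreme_point_of_segment)

lemma edge_midpoint_segment [simp]: "edge_midpoint (closed_segment a b) = midpoint a b"
  unfolding edge_midpoint_def
proof (rule the_equality)
  show "\<exists>c d. closed_segment a b = closed_segment c d \<and> midpoint a b = midpoint c d" by (rule exI[of _ a], rule exI[of _ b]) simp
qed (auto simp: doubleton_eq_iff midpoint_sym)

lemma edge_length_segment [simp]:
  "edge_length (closed_segment a b) = \<bar>fst a - fst b\<bar> + \<bar>snd a - snd b\<bar>"
  unfolding edge_length_def
proof (rule the_equality)
  show "\<exists>c d. closed_segment a b = closed_segment c d \<and>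
    \<bar>fst a - fst b\<bar> + \<bar>snd a - snd b\<bar> = \<bar>fst c - fst d\<bar> + \<bar>snd c - snd d\<bar>" by (rule exI[of _ a], rule exI[of _ b]) simp
qed (auto simp: doubleton_eq_iff abs_minus_commute)

lemma finite_lattice_rect: "finite (lattice_rect m n)"
proof -
  have "lattice_rect m n = (\<lambda>(i, j). (real i, real j)) ` ({..m} \<times> {..n})"
    by (auto simp: lattice_rect_def)
  then show ?thesis by simp
qed

lemma finite_lattice_edges: "finite (lattice_edges m n)"
proof -
  have "lattice_edges m n \<subseteq> (\<lambda>(a, b). closed_segment a b) ` (lattice_rect m n \<times> lattice_rect m n)"
    by (auto simp: lattice_edges_def)
  then show ?thesis by (rule finite_subset) (simp add: finite_lattice_rect)
qed

lemma finite_triangulations: "finite (triangulations m n)"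
proof -
  have "triangulations m n \<subseteq> Pow (lattice_edges m n)" by (auto simp: triangulations_def)
  then show ?thesis by (rule finite_subset) (simp add: finite_lattice_edges)
qed

lemma midpoint_not_endpoint: "a \<noteq> b \<Longrightarrow> midpoint a b \<noteq> a \<and> midpoint a b \<noteq> (b::point)"
  by (simp add: midpoint_eq_endpoint)

text \<open>
  Two distinct edges with the same midpoint cross there. This is why \<^const>\<open>edge_at\<close> is determined
  by membership alone (\<open>edge_at_eq\<close>).
\<close>

lemma noncrossing_midpoint_unique:
  assumes "noncrossing \<sigma>" "\<sigma> \<subseteq> lattice_edges m n" "e \<in> \<sigma>" "f \<in> \<sigma>" "edge_midpoint e = edge_midpoint f"
  shows "e = f"
proof (rule ccontr)
  assume "e \<noteq> f"
  obtain a b where e: "e = closed_segment a b" "a \<noteq> b" using assms(2,3) by (auto simp: lattice_edges_def)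
  obtain c d where f: "f = closed_segment c d" "c \<noteq> d" using assms(2,4) by (auto simp: lattice_edges_def)
  have "midpoint a b \<in> e" "midpoint a b \<in> f" "midpoint a b \<notin> endpoints e"
    using e f assms(5) midpoint_in_closed_segment[of a b] midpoint_in_closed_segment[of c d]
      midpoint_not_endpoint[of a b] by auto
  then have "edges_cross e f" using \<open>e \<noteq> f\<close> by (auto simp: edges_cross_def)
  then show False using assms by (auto simp: noncrossing_def)
qed

lemma edge_at_eq:
  assumes "noncrossing \<sigma>" "\<sigma> \<subseteq> lattice_edges m n" "e \<in> \<sigma>" "edge_midpoint e = x"
  shows "edge_at \<sigma> x = e"
  unfolding edge_at_def using assms noncrossing_midpoint_unique by (intro the_equality) blast+

section \<open>Strip triangulations\<close>

definition horizontal_edge :: "nat \<Rightarrow> nat \<Rightarrow> segment" where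
  "horizontal_edge i j = closed_segment (real i, real j) (real (Suc i), real j)"

definition slanted_edge :: "nat \<Rightarrow> nat \<Rightarrow> nat \<Rightarrow> segment" where
  "slanted_edge j u v = closed_segment (real u, real j) (real v, real (Suc j))"

text \<open>
  The edge of a strip whose midpoint has abscissa \<open>k/2\<close> joins the lower point \<open>a k\<close> to the upper point
  \<open>k - a k\<close>. Noncrossing edges with consecutive midpoints share an endpoint, so one of the two
  numbers increases by one at each step.
\<close>

definition strip_path :: "nat \<Rightarrow> (nat \<Rightarrow> nat) \<Rightarrow> bool" where
  "strip_path m a \<longleftrightarrow> a 0 = 0 \<and> a (2 * m) = m \<and> (\<forall>k < 2 * m. a (Suc k) = a k \<or> a (Suc k) = Suc (a k))"

definition strip_paths :: "nat \<Rightarrow> nat \<Rightarrow> (nat \<Rightarrow> nat \<Rightarrow> nat) \<Rightarrow> bool" where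
  "strip_paths m n a \<longleftrightarrow> (\<forall>j < n. strip_path m (a j))"

definition strips :: "nat \<Rightarrow> nat \<Rightarrow> (nat \<Rightarrow> nat \<Rightarrow> nat) \<Rightarrow> segment set" where
  "strips m n a = {horizontal_edge i j | i j. i < m \<and> j \<le> n} \<union> {slanted_edge j (a j k) (k - a j k) | j k. j < n \<and> k \<le> 2 * m}"

lemma strip_pathsD: "strip_paths m n a \<Longrightarrow> j < n \<Longrightarrow> strip_path m (a j)"
  by (simp add: strip_paths_def)

text \<open>
  Both endpoints move weakly to the right: the second inequality is monotonicity of \<open>k - a k\<close>,
  written without subtraction.
\<close>

lemma strip_path_step:
  assumes "strip_path m a" "k \<le> l" "l \<le> 2 * m"
  shows "a k \<le> a l \<and> a l + k \<le> a k + l"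
  using assms(2,3)
proof (induction l rule: dec_induct)
  case (step l)
  have "a (Suc l) = a l \<or> a (Suc l) = Suc (a l)" using assms(1) step by (auto simp: strip_path_def)
  then show ?case using step by auto
qed simp

lemma strip_path_bounds:
  assumes "strip_path m a" "k \<le> 2 * m"
  shows "a k \<le> k" "a k \<le> m" "k - a k \<le> m"
  using strip_path_step[OF assms(1), of 0 k] strip_path_step[OF assms(1), of k "2 * m"] assms
  by (auto simp: strip_path_def)

lemma in_horizontal_edge: "p \<in> horizontal_edge i j \<longleftrightarrow> snd p = real j \<and> real i \<le> fst p \<and> fst p \<le> real i + 1"
proof
  assume "p \<in> horizontal_edge i j"
  then show "snd p = real j \<and> real i \<le> fst p \<and> fst p \<le> real i + 1"
    by (auto simp: horizontal_edge_def in_segment algebra_simps)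
next
  assume "snd p = real j \<and> real i \<le> fst p \<and> fst p \<le> real i + 1"
  then show "p \<in> horizontal_edge i j"
    unfolding horizontal_edge_def in_segment
    by (intro exI[of _ "fst p - real i"]) (auto simp: prod_eq_iff algebra_simps)
qed

lemma in_slanted_edge:
  "p \<in> slanted_edge j u v \<longleftrightarrow> (\<exists>t. 0 \<le> t \<and> t \<le> 1 \<and> p = ((1 - t) * real u + t * real v, real j + t))"
  by (auto simp: slanted_edge_def in_segment algebra_simps)

lemma slanted_edge_integral_height:
  assumes "p \<in> slanted_edge j u v" "snd p \<in> \<int>"
  shows "p = (real u, real j) \<or> p = (real v, real (Suc j))"
proof -
  obtain t where t: "0 \<le> t" "t \<le> 1" "p = ((1 - t) * real u + t * real v, real j + t)"
    using assms(1) by (auto simp: in_slanted_edge)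
  have "t \<in> \<int>" using assms(2) t Ints_diff[of "real j + t" "real j"] by auto
  then have "t = 0 \<or> t = 1" using t(1,2) by (auto elim!: Ints_cases)
  then show ?thesis using t by auto
qed

lemma lattice_edgesI:
  assumes "a \<in> lattice_rect m n" "b \<in> lattice_rect m n" "a \<noteq> b" "closed_segment a b \<inter> (\<int> \<times> \<int>) = {a, b}"
  shows "closed_segment a b \<in> lattice_edges m n"
  unfolding lattice_edges_def using assms by blast

lemma horizontal_edge_lattice:
  assumes "i < m" "j \<le> n" shows "horizontal_edge i j \<in> lattice_edges m n"
proof -
  have ends: "x = real i \<or> x = 1 + real i" if x: "x \<in> \<int>" "real i \<le> x" "x \<le> real i + 1" for x :: real
  proof -
    obtain z where z: "x = real_of_int z" using x(1) by (rule Ints_cases)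
    have "int i \<le> z" "z \<le> int i + 1" using x(2,3) unfolding z by linarith+
    then have "z = int i \<or> z = int i + 1" by linarith
    then show ?thesis using z by auto
  qed
  have "horizontal_edge i j \<inter> (\<int> \<times> \<int>) = {(real i, real j), (real (Suc i), real j)}"
  proof
    show "horizontal_edge i j \<inter> (\<int> \<times> \<int>) \<subseteq> {(real i, real j), (real (Suc i), real j)}"
    proof
      fix p assume "p \<in> horizontal_edge i j \<inter> (\<int> \<times> \<int>)"
      then show "p \<in> {(real i, real j), (real (Suc i), real j)}"
        using ends[of "fst p"] by (auto simp: in_horizontal_edge mem_Times_iff prod_eq_iff)
    qed
  qed (auto simp: in_horizontal_edge)
  moreover have "(real i, real j) \<in> lattice_rect m n" "(real (Suc i), real j) \<in> lattice_rect m n"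
    using assms by (auto simp: lattice_rect_def intro: exI[of _ "Suc i"])
  ultimately show ?thesis unfolding horizontal_edge_def by (intro lattice_edgesI) auto
qed

lemma slanted_edge_lattice:
  assumes "u \<le> m" "v \<le> m" "j < n" shows "slanted_edge j u v \<in> lattice_edges m n"
proof -
  have "slanted_edge j u v \<inter> (\<int> \<times> \<int>) = {(real u, real j), (real v, real (Suc j))}"
  proof
    show "slanted_edge j u v \<inter> (\<int> \<times> \<int>) \<subseteq> {(real u, real j), (real v, real (Suc j))}"
    proof
      fix p assume "p \<in> slanted_edge j u v \<inter> (\<int> \<times> \<int>)"
      then show "p \<in> {(real u, real j), (real v, real (Suc j))}"
        using slanted_edge_integral_height[of p j u v] by (auto simp: mem_Times_iff)
    qed
  qed (auto simp: slanted_edge_def)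
  moreover have "(real u, real j) \<in> lattice_rect m n" "(real v, real (Suc j)) \<in> lattice_rect m n"
    using assms by (auto simp: lattice_rect_def intro: exI[of _ "Suc j"])
  ultimately show ?thesis unfolding slanted_edge_def by (intro lattice_edgesI) auto
qed

lemma slanted_edge_in_strips: "j < n \<Longrightarrow> k \<le> 2 * m \<Longrightarrow> slanted_edge j (a j k) (k - a j k) \<in> strips m n a"
  by (auto simp: strips_def)

lemma horizontal_edge_in_strips: "i < m \<Longrightarrow> j \<le> n \<Longrightarrow> horizontal_edge i j \<in> strips m n a"
  by (auto simp: strips_def)

lemma strips_lattice_edges:
  assumes "strip_paths m n a"
  shows "strips m n a \<subseteq> lattice_edges m n"
proof -
  have "slanted_edge j (a j k) (k - a j k) \<in> lattice_edges m n" if "j < n" "k \<le> 2 * m" for j k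
    using strip_path_bounds[OF strip_pathsD[OF assms that(1)] that(2)] that(1) by (intro slanted_edge_lattice)
  then show ?thesis by (auto simp: strips_def horizontal_edge_lattice)
qed

text \<open>
  A lattice edge contains no lattice points besides its endpoints, so edges that meet only in lattice
  points meet only in common endpoints.
\<close>

lemma noncrossingI:
  assumes "\<sigma> \<subseteq> lattice_edges m n"
    and "\<And>e f. e \<in> \<sigma> \<Longrightarrow> f \<in> \<sigma> \<Longrightarrow> e \<noteq> f \<Longrightarrow> e \<inter> f \<subseteq> \<int> \<times> \<int>"
  shows "noncrossing \<sigma>"
proof -
  have "p \<in> endpoints e" if e: "e \<in> \<sigma>" and p: "p \<in> e" "p \<in> \<int> \<times> \<int>" for e p
  proof -
    obtain u v where "e = closed_segment u v" "closed_segment u v \<inter> (\<int> \<times> \<int>) = {u, v}"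
      using assms(1) e by (auto simp: lattice_edges_def)
    then show ?thesis using p by (metis IntI endpoints_segment)
  qed
  then show ?thesis unfolding noncrossing_def edges_cross_def using assms(2) by blast
qed

lemma convex_comb_zero:
  fixes t x y :: real
  assumes "0 < t" "t < 1" "0 \<le> x" "0 \<le> y" "(1 - t) * x + t * y = 0"
  shows "x = 0 \<and> y = 0"
proof -
  have "0 \<le> (1 - t) * x" "0 \<le> t * y" using assms by auto
  then have "(1 - t) * x = 0" "t * y = 0" using assms(5) by linarith+
  then show ?thesis using assms by auto
qed

text \<open>
  At height \<open>t\<close> above the base the distance between the two edges is a convex combination of the
  distances of their lower and of their upper endpoints. It vanishes strictly inside the strip only
  if both do, that is, if the edges agree.
\<close>

lemma slanted_edge_crossing:
  assumes path: "strip_path m a" and kl: "k \<le> 2 * m" "l \<le> 2 * m" "k < l"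
    and p: "p \<in> slanted_edge j (a k) (k - a k)" "p \<in> slanted_edge j (a l) (l - a l)"
  shows "p \<in> \<int> \<times> \<int>"
proof -
  obtain t where t: "0 \<le> t" "t \<le> 1" "p = ((1 - t) * real (a k) + t * real (k - a k), real j + t)"
    using p(1) by (auto simp: in_slanted_edge)
  have eq: "(1 - t) * real (a k) + t * real (k - a k) = (1 - t) * real (a l) + t * real (l - a l)"
    using p(2) t(3) by (auto simp: in_slanted_edge)
  have b: "a k \<le> k" "a l \<le> l" using strip_path_bounds(1)[OF path] kl by auto
  have s: "a k \<le> a l" "a l + k \<le> a k + l" using strip_path_step[OF path, of k l] kl by auto
  have d: "0 \<le> real (a l) - real (a k)" "0 \<le> real (l - a l) - real (k - a k)" using s b by linarith+
  have z: "(1 - t) * (real (a l) - real (a k)) + t * (real (l - a l) - real (k - a k)) = 0"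
    using eq by (simp add: algebra_simps)
  have "t = 0 \<or> t = 1"
  proof (rule ccontr)
    assume "\<not> (t = 0 \<or> t = 1)"
    then have "0 < t" "t < 1" using t by auto
    from convex_comb_zero[OF this d z] have "real (a l) = real (a k)" "real (l - a l) = real (k - a k)" by auto
    then have "a l = a k" "l - a l = k - a k" by linarith+
    then show False using b kl by linarith
  qed
  then show ?thesis using t(3) by auto
qed

lemma strips_noncrossing:
  assumes path: "strip_paths m n a"
  shows "noncrossing (strips m n a)"
proof (rule noncrossingI[OF strips_lattice_edges[OF path]])
  have hh: "e \<inter> f \<subseteq> \<int> \<times> \<int>" if "e = horizontal_edge i j" "f = horizontal_edge i' j'" "e \<noteq> f" for e f i j i' j'
  proof
    fix p assume p: "p \<in> e \<inter> f"
    then have "j = j'" "real i \<le> fst p" "fst p \<le> real i + 1" "real i' \<le> fst p" "fst p \<le> real i' + 1"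
      "snd p = real j" using that by (auto simp: in_horizontal_edge)
    moreover have "i \<noteq> i'" using that \<open>j = j'\<close> by auto
    ultimately have "fst p = real i \<or> fst p = real i'" by linarith
    then show "p \<in> \<int> \<times> \<int>" using \<open>snd p = real j\<close> by (auto simp: mem_Times_iff)
  qed
  have hs: "horizontal_edge i j \<inter> slanted_edge j' u v \<subseteq> \<int> \<times> \<int>" for i j j' u v
  proof
    fix p assume p: "p \<in> horizontal_edge i j \<inter> slanted_edge j' u v"
    then have "snd p \<in> \<int>" by (auto simp: in_horizontal_edge)
    then show "p \<in> \<int> \<times> \<int>" using slanted_edge_integral_height[of p j' u v] p by auto
  qed
  have ss: "e \<inter> f \<subseteq> \<int> \<times> \<int>" if ef: "e = slanted_edge j (a j k) (k - a j k)" "f = slanted_edge j' (a j' k') (k' - a j' k')"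
    and lt: "j < n" "j' < n" "k \<le> 2 * m" "k' \<le> 2 * m" and ne: "e \<noteq> f" for e f j j' k k'
  proof
    fix p assume p: "p \<in> e \<inter> f"
    show "p \<in> \<int> \<times> \<int>"
    proof (cases "j = j'")
      case True
      then have "k < k' \<or> k' < k" using ef ne by auto
      then show ?thesis using slanted_edge_crossing[OF strip_pathsD[OF path, of j], of k k' p j] slanted_edge_crossing[OF strip_pathsD[OF path, of j], of k' k p j]
          True lt p ef by auto
    next
      case False
      have "\<exists>t. 0 \<le> t \<and> t \<le> 1 \<and> snd p = real j + t" using p ef(1) by (force simp: in_slanted_edge)
      then obtain t where t: "0 \<le> t" "t \<le> 1" "snd p = real j + t" by blast
      have "\<exists>t. 0 \<le> t \<and> t \<le> 1 \<and> snd p = real j' + t" using p ef(2) by (force simp: in_slanted_edge)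
      then obtain t' where t': "0 \<le> t'" "t' \<le> 1" "snd p = real j' + t'" by blast
      have "real j + 1 \<le> real j' \<or> real j' + 1 \<le> real j" using False by linarith
      then have "snd p = real j \<or> snd p = real j'" using t t' by linarith
      then have "snd p \<in> \<int>" by auto
      then show ?thesis using slanted_edge_integral_height[of p j "a j k" "k - a j k"] p ef by auto
    qed
  qed
  fix e f assume ef: "e \<in> strips m n a" "f \<in> strips m n a" "e \<noteq> f"
  have cases: "(\<exists>i j. g = horizontal_edge i j) \<or> (\<exists>j k. g = slanted_edge j (a j k) (k - a j k) \<and> j < n \<and> k \<le> 2 * m)"
    if "g \<in> strips m n a" for g using that by (auto simp: strips_def)
  show "e \<inter> f \<subseteq> \<int> \<times> \<int>"
    using cases[OF ef(1)] cases[OF ef(2)]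
  proof (elim disjE exE conjE)
    fix i j i' j' assume "e = horizontal_edge i j" "f = horizontal_edge i' j'"
    then show ?thesis using hh ef(3) by metis
  next
    fix i j j' k assume "e = horizontal_edge i j" "f = slanted_edge j' (a j' k) (k - a j' k)"
    then show ?thesis using hs by metis
  next
    fix i j j' k assume "f = horizontal_edge i j" "e = slanted_edge j' (a j' k) (k - a j' k)"
    then show ?thesis using hs by (metis Int_commute)
  next
    fix j k j' k'
    assume "e = slanted_edge j (a j k) (k - a j k)" "f = slanted_edge j' (a j' k') (k' - a j' k')"
      "j < n" "k \<le> 2 * m" "j' < n" "k' \<le> 2 * m"
    then show ?thesis using ss ef(3) by metis
  qed
qed

text \<open>
  Maximality of a strip triangulation. An edge spanning at least two strips passes a row
  of lattice points at a non-lattice point and crosses a unit edge of that row; an edge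
  spanning a single strip has the same midpoint as one of the edges of the path there.
\<close>

lemma lattice_edge_in_strips:
  assumes path: "strip_paths m n a"
    and g: "g \<in> lattice_edges m n"
    and nc: "\<And>e. e \<in> strips m n a \<Longrightarrow> \<not> edges_cross e g"
  shows "g \<in> strips m n a"
proof -
  obtain a0 b0 where g0: "g = closed_segment a0 b0" "a0 \<in> lattice_rect m n" "b0 \<in> lattice_rect m n" "a0 \<noteq> b0"
    "g \<inter> (\<int> \<times> \<int>) = {a0, b0}" using g by (auto simp: lattice_edges_def)
  obtain x y x' y' where "a0 = (real x, real y)" "b0 = (real x', real y')" "x \<le> m" "y \<le> n" "x' \<le> m" "y' \<le> n"
    using g0 by (auto simp: lattice_rect_def)
  then obtain x y x' y' where gg: "g = closed_segment (real x, real y) (real x', real y')"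
    "x \<le> m" "x' \<le> m" "y \<le> n" "y' \<le> n" "y < y' \<or> y = y' \<and> x < x'"
    and gl: "g \<inter> (\<int> \<times> \<int>) = {(real x, real y), (real x', real y')}"
  proof (cases "y < y' \<or> y = y' \<and> x < x'")
    case True then show ?thesis using that[of x y x' y'] g0 \<open>a0 = _\<close> \<open>b0 = _\<close> \<open>x \<le> m\<close> \<open>y \<le> n\<close> \<open>x' \<le> m\<close> \<open>y' \<le> n\<close> by auto
  next
    case False
    then have "y' < y \<or> y' = y \<and> x' < x" using g0(4) \<open>a0 = _\<close> \<open>b0 = _\<close> by auto
    then show ?thesis using that[of x' y' x y] g0 \<open>a0 = _\<close> \<open>b0 = _\<close> \<open>x \<le> m\<close> \<open>y \<le> n\<close> \<open>x' \<le> m\<close> \<open>y' \<le> n\<close>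
      by (auto simp: closed_segment_commute insert_commute)
  qed
  have pt: "((1 - t) * real x + t * real x', (1 - t) * real y + t * real y') \<in> g" if "0 \<le> t" "t \<le> 1" for t
    using that by (auto simp: gg(1) in_segment)
  consider "y = y'" "x < x'" | "y' = Suc y" | "Suc y < y'" using gg(6) by linarith
  then show ?thesis
  proof cases
    case 1
    define t where "t = 1 / (real x' - real x)"
    have t: "0 \<le> t" "t \<le> 1" "t * (real x' - real x) = 1" using 1 by (auto simp: t_def)
    have "(1 - t) * real x + t * real x' = real x + 1" "(1 - t) * real y + t * real y' = real y"
      using t(3) 1 by (auto simp: algebra_simps)
    then have "(real x + 1, real y) \<in> g" using pt[OF t(1,2)] by simp
    then have "(real x + 1, real y) \<in> {(real x, real y), (real x', real y')}"
      unfolding gl[symmetric] by auto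
    then have "x' = Suc x" by auto
    then show ?thesis using horizontal_edge_in_strips[of x m y n a] gg 1 by (auto simp: horizontal_edge_def)
  next
    case 2
    define k where "k = x + x'"
    have k: "k \<le> 2 * m" and y: "y < n" using gg 2 by (auto simp: k_def)
    define e where "e = slanted_edge y (a y k) (k - a y k)"
    have e: "e \<in> strips m n a" unfolding e_def using k y by (rule slanted_edge_in_strips[rotated])
    have "a y k \<le> k" using strip_path_bounds(1)[OF strip_pathsD[OF path y] k] .
    then have "real (k - a y k) = real x + real x' - real (a y k)" by (simp add: k_def)
    then have mid: "edge_midpoint e = edge_midpoint g" unfolding e_def slanted_edge_def gg(1) 2
      by (simp add: midpoint_def)
    have "edge_midpoint g \<notin> endpoints g"
      unfolding gg(1) using 2 by (auto simp: midpoint_def)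
    moreover have "edge_midpoint g \<in> g" unfolding gg(1) by simp
    moreover have "edge_midpoint e \<in> e" unfolding e_def slanted_edge_def by simp
    ultimately have "e = g" using nc[OF e] mid unfolding edges_cross_def by auto
    then show ?thesis using e by simp
  next
    case 3
    define t where "t = 1 / (real y' - real y)"
    have t: "0 < t" "t < 1" "t * (real y' - real y) = 1" using 3 by (auto simp: t_def)
    define p where "p = ((1 - t) * real x + t * real x', (1 - t) * real y + t * real y')"
    have pg: "p \<in> g" unfolding p_def using pt t by simp
    have sp: "snd p = real (Suc y)" unfolding p_def using t(3) by (simp add: algebra_simps)
    have np: "fst p \<notin> \<int>"
    proof
      assume "fst p \<in> \<int>"
      then have "p \<in> g \<inter> (\<int> \<times> \<int>)" using pg sp by (auto simp: mem_Times_iff)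
      then show False unfolding gl using sp 3 by auto
    qed
    have f0: "0 \<le> fst p" unfolding p_def using t by simp
    have fm: "fst p \<le> real m"
    proof -
      have "fst p \<le> (1 - t) * real m + t * real m" unfolding p_def fst_conv using t gg
        by (intro add_mono mult_left_mono) auto
      then show ?thesis by (simp add: algebra_simps)
    qed
    define i where "i = nat \<lfloor>fst p\<rfloor>"
    have i: "real i \<le> fst p" "fst p < real i + 1" unfolding i_def using f0 by linarith+
    have "fst p \<noteq> real m" using np by auto
    then have "i < m" using i fm by linarith
    moreover have "Suc y \<le> n" using 3 gg by linarith
    ultimately have h: "horizontal_edge i (Suc y) \<in> strips m n a" by (rule horizontal_edge_in_strips)
    have ph: "p \<in> horizontal_edge i (Suc y)" using i sp by (simp add: in_horizontal_edge)
    have pe: "p \<notin> endpoints (horizontal_edge i (Suc y))" unfolding horizontal_edge_def using np by auto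
    have "(real x, real y) \<in> g" using gg(1) by simp
    then have "horizontal_edge i (Suc y) \<noteq> g" by (auto simp: in_horizontal_edge)
    then have "edges_cross (horizontal_edge i (Suc y)) g" using ph pg pe by (auto simp: edges_cross_def)
    then show ?thesis using nc[OF h] by simp
  qed
qed

lemma strips_triangulation:
  assumes path: "strip_paths m n a"
  shows "strips m n a \<in> triangulations m n"
  unfolding triangulations_def
proof (intro CollectI conjI allI impI)
  show "strips m n a \<subseteq> lattice_edges m n" by (rule strips_lattice_edges[OF path])
  show "noncrossing (strips m n a)" by (rule strips_noncrossing[OF path])
  fix \<tau> assume \<tau>: "\<tau> \<subseteq> lattice_edges m n \<and> noncrossing \<tau> \<and> strips m n a \<subseteq> \<tau>"
  show "\<tau> = strips m n a"
  proof (rule equalityI[OF subsetI])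
    fix g assume g: "g \<in> \<tau>"
    show "g \<in> strips m n a"
      by (rule lattice_edge_in_strips[OF path]) (use \<tau> g in \<open>auto simp: noncrossing_def\<close>)
  qed (use \<tau> in auto)
qed

section \<open>Flips of strip triangulations\<close>

lemma convex_hull_3I:
  assumes "p = u *\<^sub>R a + v *\<^sub>R b + w *\<^sub>R c" "0 \<le> u" "0 \<le> v" "0 \<le> w" "u + v + w = 1"
  shows "p \<in> convex hull {a, b, c}"
  using assms unfolding convex_hull_3 by blast

text \<open>
  In a convex combination of the vertices of a parallelogram, equal amounts of \<open>c\<close> and \<open>d\<close> can be
  traded for equal amounts of \<open>a\<close> and \<open>b\<close> until one of \<open>c\<close>, \<open>d\<close> has disappeared. Hence the union of the
  two triangles over the diagonal \<open>a b\<close> is the whole parallelogram, and in particular convex.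
\<close>

lemma parallelogram_hull:
  fixes a b c d :: "'a::real_vector"
  assumes "c + d = a + b"
  shows "convex hull {a, b, c} \<union> convex hull {a, b, d} = convex hull {a, b, c, d}"
proof
  show "convex hull {a, b, c} \<union> convex hull {a, b, d} \<subseteq> convex hull {a, b, c, d}"
    by (intro Un_least hull_mono) auto
  show "convex hull {a, b, c, d} \<subseteq> convex hull {a, b, c} \<union> convex hull {a, b, d}"
  proof
    fix p assume "p \<in> convex hull {a, b, c, d}"
    then obtain \<alpha> q where q: "0 \<le> \<alpha>" "\<alpha> \<le> 1" "q \<in> convex hull {a, b, c}" "p = (1 - \<alpha>) *\<^sub>R d + \<alpha> *\<^sub>R q"
      using convex_hull_insert_segments[of d "{a, b, c}"] by (auto simp: insert_commute in_segment)
    obtain u v w where w: "0 \<le> u" "0 \<le> v" "0 \<le> w" "u + v + w = 1" "q = u *\<^sub>R a + v *\<^sub>R b + w *\<^sub>R c"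
      using q(3) by (auto simp: convex_hull_3)
    have cd: "c = a + b - d" "d = a + b - c" using assms by (auto simp: algebra_simps)
    show "p \<in> convex hull {a, b, c} \<union> convex hull {a, b, d}"
    proof (cases "1 - \<alpha> \<le> \<alpha> * w")
      case True
      have eq: "p = (\<alpha> * u + (1 - \<alpha>)) *\<^sub>R a + (\<alpha> * v + (1 - \<alpha>)) *\<^sub>R b + (\<alpha> * w - (1 - \<alpha>)) *\<^sub>R c"
        unfolding q(4) w(5) by (subst cd(2)) (simp add: algebra_simps)
      moreover have "\<alpha> * u + (1 - \<alpha>) + (\<alpha> * v + (1 - \<alpha>)) + (\<alpha> * w - (1 - \<alpha>)) = \<alpha> * (u + v + w) + (1 - \<alpha>)"
        by (simp add: algebra_simps)
      ultimately have "p \<in> convex hull {a, b, c}" using True q(1,2) w(1-4) by (intro convex_hull_3I[OF eq]) auto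
      then show ?thesis ..
    next
      case False
      have eq: "p = (\<alpha> * u + \<alpha> * w) *\<^sub>R a + (\<alpha> * v + \<alpha> * w) *\<^sub>R b + ((1 - \<alpha>) - \<alpha> * w) *\<^sub>R d"
        unfolding q(4) w(5) by (subst cd(1)) (simp add: algebra_simps)
      moreover have "\<alpha> * u + \<alpha> * w + (\<alpha> * v + \<alpha> * w) + ((1 - \<alpha>) - \<alpha> * w) = \<alpha> * (u + v + w) + (1 - \<alpha>)"
        by (simp add: algebra_simps)
      ultimately have "p \<in> convex hull {a, b, d}" using False q(1,2) w(1-4) by (intro convex_hull_3I[OF eq]) auto
      then show ?thesis ..
    qed
  qed
qed

lemma collinear_affine_comb:
  fixes a b c :: point
  assumes "w *\<^sub>R a = u *\<^sub>R b + v *\<^sub>R c" "u + v = w" "w \<noteq> 0"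
  shows "collinear {b, a, c}"
proof -
  have "a = (1 / w) *\<^sub>R (w *\<^sub>R a)" using assms(3) by simp
  also have "\<dots> = (u / w) *\<^sub>R b + (1 - u / w) *\<^sub>R c"
    unfolding assms(1) using assms(2,3) by (simp add: algebra_simps field_simps)
  finally show ?thesis unfolding collinear_3_expand by blast
qed

lemma parallelogram_extreme:
  fixes a b c d :: point
  assumes "c + d = a + b" "\<not> collinear {a, b, c}"
  shows "{p. p extreme_point_of convex hull {a, b, c, d}} = {a, b, c, d}"
proof -
  have cd: "d = a + b - c" using assms(1) by (simp add: algebra_simps)
  have nc: "\<not> collinear {b, a, c}" "\<not> collinear {a, c, b}" "\<not> collinear {b, c, a}" "\<not> collinear {a, b, c}"
    using assms(2) by (simp_all add: insert_commute)
  have bc: "b \<noteq> c" "a \<noteq> c" using assms(2) by (auto simp: insert_commute)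
  have "a \<notin> convex hull {b, c, d}"
  proof
    assume "a \<in> convex hull {b, c, d}"
    then obtain u v w where w: "0 \<le> u" "0 \<le> v" "0 \<le> w" "u + v + w = 1" "a = u *\<^sub>R b + v *\<^sub>R c + w *\<^sub>R d"
      by (auto simp: convex_hull_3)
    have e: "(1 - w) *\<^sub>R a = (u + w) *\<^sub>R b + (v - w) *\<^sub>R c"
      using w(5) unfolding cd by (simp add: algebra_simps)
    show False
    proof (cases "w = 1")
      case True
      then have "u = 0" "v = 0" using w by auto
      then show False using e True bc by simp
    next
      case False
      then show False using collinear_affine_comb[OF e] w(4) nc by auto
    qed
  qed
  moreover have "b \<notin> convex hull {a, c, d}"
  proof
    assume "b \<in> convex hull {a, c, d}"
    then obtain u v w where w: "0 \<le> u" "0 \<le> v" "0 \<le> w" "u + v + w = 1" "b = u *\<^sub>R a + v *\<^sub>R c + w *\<^sub>R d"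
      by (auto simp: convex_hull_3)
    have e: "(1 - w) *\<^sub>R b = (u + w) *\<^sub>R a + (v - w) *\<^sub>R c"
      using w(5) unfolding cd by (simp add: algebra_simps)
    show False
    proof (cases "w = 1")
      case True
      then have "u = 0" "v = 0" using w by auto
      then show False using e True bc by simp
    next
      case False
      then show False using collinear_affine_comb[OF e] w(4) nc by auto
    qed
  qed
  moreover have "c \<notin> convex hull {a, b, d}"
  proof
    assume "c \<in> convex hull {a, b, d}"
    then obtain u v w where w: "0 \<le> u" "0 \<le> v" "0 \<le> w" "u + v + w = 1" "c = u *\<^sub>R a + v *\<^sub>R b + w *\<^sub>R d"
      by (auto simp: convex_hull_3)
    have e: "(1 + w) *\<^sub>R c = (u + w) *\<^sub>R a + (v + w) *\<^sub>R b"
      using w(5) unfolding cd by (simp add: algebra_simps)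
    show False using collinear_affine_comb[OF e] w nc by auto
  qed
  moreover have "d \<notin> convex hull {a, b, c}"
  proof
    assume "d \<in> convex hull {a, b, c}"
    then obtain u v w where w: "0 \<le> u" "0 \<le> v" "0 \<le> w" "u + v + w = 1" "d = u *\<^sub>R a + v *\<^sub>R b + w *\<^sub>R c"
      by (auto simp: convex_hull_3)
    have e: "(1 + w) *\<^sub>R c = (1 - u) *\<^sub>R a + (1 - v) *\<^sub>R b"
      using w(5) unfolding cd by (simp add: algebra_simps)
    show False using collinear_affine_comb[OF e] w nc by auto
  qed
  moreover have "{a, b, c, d} = insert b {a, c, d}" "{a, b, c, d} = insert c {a, b, d}" "{a, b, c, d} = insert d {a, b, c}"
    by auto
  ultimately have "\<forall>p \<in> {a, b, c, d}. p extreme_point_of convex hull {a, b, c, d}"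
    using extreme_point_of_convex_hull_insert[of "{b, c, d}" a] extreme_point_of_convex_hull_insert[of "{a, c, d}" b]
      extreme_point_of_convex_hull_insert[of "{a, b, d}" c] extreme_point_of_convex_hull_insert[of "{a, b, c}" d]
    by auto
  then show ?thesis using extreme_point_of_convex_hull by blast
qed

lemma is_flip_parallelogram:
  assumes cd: "c + d = a + b" "c \<noteq> d" and t: "triangle_in \<sigma> a b c" "triangle_in \<sigma> a b d"
  shows "is_flip \<sigma> (closed_segment a b) (closed_segment c d)"
proof -
  have nc: "\<not> collinear {a, b, c}" using t(1) unfolding triangle_in_def by blast
  have "convex (convex hull {a, b, c} \<union> convex hull {a, b, d}) \<and>
    {p. p extreme_point_of convex hull {a, b, c} \<union> convex hull {a, b, d}} = {a, b, c, d}"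
    unfolding parallelogram_hull[OF cd(1)] using parallelogram_extreme[OF cd(1) nc] convex_convex_hull by blast
  then show ?thesis unfolding is_flip_def Let_def using cd t by blast
qed

lemma not_collinear_two_rows:
  fixes x x' z y y' :: real
  assumes "x \<noteq> x'" "y \<noteq> y'"
  shows "\<not> collinear {(x, y), (z, y'), (x', y)}"
proof
  assume "collinear {(x, y), (z, y'), (x', y)}"
  then obtain u where "(z, y') = u *\<^sub>R (x, y) + (1 - u) *\<^sub>R (x', y)"
    unfolding collinear_3_expand using assms by auto
  then have "y' = u * y + (1 - u) * y" by simp
  then have "y' = y" by (simp add: algebra_simps)
  then show False using assms by simp
qed

lemma strips_adjacent_iff:
  assumes path: "strip_paths m n a"
  shows "closed_segment (real x, real y) (real x', real y') \<in> strips m n a \<longleftrightarrow>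
    (y = y' \<and> y \<le> n \<and> (x' = Suc x \<and> x < m \<or> x = Suc x' \<and> x' < m)) \<or>
    (y' = Suc y \<and> y < n \<and> x + x' \<le> 2 * m \<and> a y (x + x') = x) \<or>
    (y = Suc y' \<and> y' < n \<and> x + x' \<le> 2 * m \<and> a y' (x + x') = x')" (is "?L = ?R")
proof
  assume ?L
  then consider i j where "i < m" "j \<le> n" "closed_segment (real x, real y) (real x', real y') = horizontal_edge i j"
    | j k where "j < n" "k \<le> 2 * m" "closed_segment (real x, real y) (real x', real y') = slanted_edge j (a j k) (k - a j k)"
    by (auto simp: strips_def)
  then show ?R
  proof cases
    case 1
    then show ?thesis by (auto simp: horizontal_edge_def doubleton_eq_iff)
  next
    case 2
    define u v where "u = a j k" and "v = k - a j k"
    have uv: "k = u + v" "a j (u + v) = u"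
      using strip_path_bounds(1)[OF strip_pathsD[OF path 2(1)] 2(2)] by (auto simp: u_def v_def)
    have "closed_segment (real x, real y) (real x', real y') = closed_segment (real u, real j) (real v, real (Suc j))"
      using 2(3) by (simp add: slanted_edge_def u_def v_def)
    then have "(x = u \<and> y = j \<and> x' = v \<and> y' = Suc j) \<or> (x = v \<and> y = Suc j \<and> x' = u \<and> y' = j)"
      unfolding closed_segment_eq doubleton_eq_iff prod.inject of_nat_eq_iff by blast
    then show ?thesis using 2(1,2) uv by (auto simp: add.commute)
  qed
next
  assume ?R
  then consider "y = y'" "y \<le> n" "x' = Suc x" "x < m" | "y = y'" "y \<le> n" "x = Suc x'" "x' < m"
    | "y' = Suc y" "y < n" "x + x' \<le> 2 * m" "a y (x + x') = x"
    | "y = Suc y'" "y' < n" "x + x' \<le> 2 * m" "a y' (x + x') = x'" by blast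
  then show ?L
  proof cases
    case 1 then show ?thesis using horizontal_edge_in_strips[of x m y n a] by (simp add: horizontal_edge_def)
  next
    case 2 then show ?thesis using horizontal_edge_in_strips[of x' m y n a] by (simp add: horizontal_edge_def closed_segment_commute)
  next
    case 3 then show ?thesis using slanted_edge_in_strips[of y n "x + x'" m a] by (simp add: slanted_edge_def)
  next
    case 4 then show ?thesis using slanted_edge_in_strips[of y' n "x + x'" m a] by (simp add: slanted_edge_def closed_segment_commute)
  qed
qed

lemma strips_horizontalI:
  "x < m \<Longrightarrow> y \<le> n \<Longrightarrow> closed_segment (real x, real y) (real (Suc x), real y) \<in> strips m n a"
  using horizontal_edge_in_strips[of x m y n a] by (simp only: horizontal_edge_def)

lemma strips_slantedI:
  assumes "y < n" "x + x' \<le> 2 * m" "a y (x + x') = x"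
  shows "closed_segment (real x, real y) (real x', real (Suc y)) \<in> strips m n a"
  using slanted_edge_in_strips[of y n "x + x'" m a] assms by (simp add: slanted_edge_def)

lemma strips_vertex:
  assumes "closed_segment p q \<in> strips m n a"
  obtains x y x' y' where "p = (real x, real y)" "q = (real x', real y')"
proof -
  have "\<exists>x y x' y'. p = (real x, real y) \<and> q = (real x', real y')"
    using assms by (auto simp: strips_def horizontal_edge_def slanted_edge_def doubleton_eq_iff) (metis of_nat_Suc)+
  then show ?thesis using that by blast
qed

lemma strip_edge_neighbours:
  assumes path: "strip_paths m n a"
    and c: "closed_segment (real x, real y) (real cx, real cy) \<in> strips m n a"
      "closed_segment (real x', real (Suc y)) (real cx, real cy) \<in> strips m n a"
  shows "(cx = Suc x' \<and> cy = Suc y \<and> Suc (x + x') \<le> 2 * m \<and> a y (Suc (x + x')) = x) \<or>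
         (cx = Suc x \<and> cy = y \<and> Suc (x + x') \<le> 2 * m \<and> a y (Suc (x + x')) = Suc x) \<or>
         (x' = Suc cx \<and> cy = Suc y \<and> a y (x + cx) = x) \<or>
         (x = Suc cx \<and> cy = y \<and> a y (cx + x') = cx)"
proof -
  from c(1) consider "cx = Suc x" "cy = y" | "x = Suc cx" "cy = y"
    | "cy = Suc y" "x + cx \<le> 2 * m" "a y (x + cx) = x" | "y = Suc cy"
    unfolding strips_adjacent_iff[OF path] by blast
  then show ?thesis
    using c(2)[unfolded strips_adjacent_iff[OF path]]
    by cases (auto simp: add.commute)
qed

text \<open>
  The vertices \<open>T\<close> of a triangle between consecutive edges of a path satisfy four linear
  inequalities: they lie in the strip, to the right of the first edge and to the left of the second.
  Interior points satisfy them strictly, whereas no point of an edge of the triangulation satisfies all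
  of the strict inequalities: the edges of the strip are ordered from left to right, so each of them
  lies weakly to the left of the first edge or weakly to the right of the second.
\<close>

lemma between_lines_empty:
  assumes path: "strip_paths m n a"
    and jk: "j < n" "k < 2 * m"
    and T: "T \<subseteq> {(real (a j k), real j), (real (k - a j k), real (Suc j)),
                 (real (a j (Suc k)), real j), (real (Suc k - a j (Suc k)), real (Suc j))}"
  shows "interior (convex hull T) \<inter> \<Union>(strips m n a) = {}"
proof -
  define x where "x = real (a j k)"
  define x' where "x' = real (k - a j k)"
  define z where "z = real (a j (Suc k))"
  define z' where "z' = real (Suc k - a j (Suc k))"
  have st: "a j k \<le> a j (Suc k)" "a j (Suc k) \<le> Suc (a j k)"
    using strip_path_step[OF strip_pathsD[OF path jk(1)], of k "Suc k"] jk by auto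
  have xz: "x \<le> z" "x' \<le> z'"
    using st by (auto simp: x_def x'_def z_def z'_def)
  have hs: "interior (convex hull T) \<subseteq> {p. v \<bullet> p > r}" if "v \<noteq> (0, 0)" "\<And>p. p \<in> T \<Longrightarrow> v \<bullet> p \<ge> r" for v :: point and r
  proof -
    have "convex hull T \<subseteq> {p. v \<bullet> p \<ge> r}" using that(2) by (intro hull_minimal convex_halfspace_ge) auto
    then have "interior (convex hull T) \<subseteq> interior {p. v \<bullet> p \<ge> r}" by (rule interior_mono)
    then show ?thesis using that(1) by (simp add: zero_prod_def)
  qed
  have T': "p = (x, real j) \<or> p = (x', real j + 1) \<or> p = (z, real j) \<or> p = (z', real j + 1)" if "p \<in> T" for p
    using T that by (auto simp: x_def x'_def z_def z'_def)
  have 1: "interior (convex hull T) \<subseteq> {p. (0, 1) \<bullet> p > real j}"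
    by (rule hs) (auto dest!: T')
  have 2: "interior (convex hull T) \<subseteq> {p. (0, -1) \<bullet> p > - real j - 1}"
    by (rule hs) (auto dest!: T')
  have 3: "interior (convex hull T) \<subseteq> {p. (1, x - x') \<bullet> p > x + (x - x') * real j}"
    by (rule hs) (use xz in \<open>auto dest!: T' simp: algebra_simps\<close>)
  have 4: "interior (convex hull T) \<subseteq> {p. (-1, z' - z) \<bullet> p > - z + (z' - z) * real j}"
    by (rule hs) (use xz in \<open>auto dest!: T' simp: algebra_simps\<close>)
  have False if p: "p \<in> interior (convex hull T)" "p \<in> g" "g \<in> strips m n a" for p g
  proof -
    obtain px py where pp: "p = (px, py)" by (cases p)
    have h: "real j < snd p" "snd p < real j + 1"
      using subsetD[OF 1 p(1)] subsetD[OF 2 p(1)] by (auto simp: pp)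
    have l: "fst p + (x - x') * snd p > x + (x - x') * real j" "- fst p + (z' - z) * snd p > - z + (z' - z) * real j"
      using subsetD[OF 3 p(1)] subsetD[OF 4 p(1)] by (auto simp: pp)
    from p(3) consider i j' where "g = horizontal_edge i j'" | j' k' where "j' < n" "k' \<le> 2 * m" "g = slanted_edge j' (a j' k') (k' - a j' k')"
      by (auto simp: strips_def)
    then show False
    proof cases
      case 1
      then show False using p(2) h by (auto simp: in_horizontal_edge)
    next
      case 2
      then obtain t where t: "0 \<le> t" "t \<le> 1" "p = ((1 - t) * real (a j' k') + t * real (k' - a j' k'), real j' + t)"
        using p(2) by (auto simp: in_slanted_edge)
      have "j' = j" using t h by auto
      have ht: "snd p = real j + t" "fst p = (1 - t) * real (a j k') + t * real (k' - a j k')" using t \<open>j' = j\<close> by auto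
      consider "k' \<le> k" | "Suc k \<le> k'" by linarith
      then show False
      proof cases
        case 1
        have "a j k' \<le> a j k" "a j k + k' \<le> a j k' + k"
          using strip_path_step[OF strip_pathsD[OF path jk(1)] 1] jk by auto
        then have "real (a j k') \<le> x" "real (k' - a j k') \<le> x'" using 1 unfolding x_def x'_def by linarith+
        then have "fst p \<le> (1 - t) * x + t * x'" unfolding ht using t by (intro add_mono mult_left_mono) auto
        then show False using l(1) unfolding ht(1) by (simp add: algebra_simps)
      next
        case 2
        have "a j (Suc k) \<le> a j k'" "a j k' + Suc k \<le> a j (Suc k) + k'"
          using strip_path_step[OF strip_pathsD[OF path jk(1)] 2] \<open>k' \<le> 2 * m\<close> by auto
        then have "z \<le> real (a j k')" "z' \<le> real (k' - a j k')" using 2 unfolding z_def z'_def by linarith+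
        then have "(1 - t) * z + t * z' \<le> fst p" unfolding ht using t by (intro add_mono mult_left_mono) auto
        then show False using l(2) unfolding ht(1) by (simp add: algebra_simps)
      qed
    qed
  qed
  then show ?thesis by blast
qed

text \<open>
  When the two endpoints move at consecutive steps, the edge in between is a diagonal of a unit
  parallelogram spanned by a horizontal edge and the neighbouring edge of the path.
\<close>

lemma strip_corner_flip:
  assumes path: "strip_paths m n a"
    and jk: "j < n" "Suc k < 2 * m" and corner: "a j (Suc (Suc k)) = Suc (a j k)"
  shows "is_flip (strips m n a) (slanted_edge j (a j (Suc k)) (Suc k - a j (Suc k)))
    (slanted_edge j (2 * a j k + 1 - a j (Suc k)) (Suc k - (2 * a j k + 1 - a j (Suc k))))"
proof -
  define x where "x = a j (Suc k)"
  define x' where "x' = Suc k - x"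
  have xx: "x + x' = Suc k" "x \<le> m" "x' \<le> m"
    using strip_path_bounds[OF strip_pathsD[OF path jk(1)], of "Suc k"] jk by (auto simp: x_def x'_def)
  have ak: "a j k \<le> k" "a j (Suc (Suc k)) \<le> Suc (Suc k)"
    using strip_path_bounds(1)[OF strip_pathsD[OF path jk(1)], of k] strip_path_bounds(1)[OF strip_pathsD[OF path jk(1)], of "Suc (Suc k)"] jk by auto
  have bk: "k - a j k \<le> m" "a j k \<le> m" "Suc (Suc k) - a j (Suc (Suc k)) \<le> m" "a j (Suc (Suc k)) \<le> m"
    using strip_path_bounds(2,3)[OF strip_pathsD[OF path jk(1)], of k] strip_path_bounds(2,3)[OF strip_pathsD[OF path jk(1)], of "Suc (Suc k)"] jk by auto
  let ?\<sigma> = "strips m n a" and ?A = "(real x, real j)" and ?B = "(real x', real (Suc j))"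
  have step: "a j (Suc k) = a j k \<or> a j (Suc k) = Suc (a j k)"
    using strip_pathsD[OF path jk(1)] jk by (auto simp: strip_path_def)
  then show ?thesis
  proof
    assume s: "a j (Suc k) = a j k"
    let ?c = "(real (k - x), real (Suc j))" and ?d = "(real (Suc x), real j)"
    have xk: "a j k = x" "x' = Suc (k - x)" "a j (Suc (Suc k)) = Suc x"
      using s corner ak by (auto simp: x_def x'_def)
    have "triangle_in ?\<sigma> ?A ?B ?c" unfolding triangle_in_def
    proof (intro conjI)
      show "\<not> collinear {?A, ?B, ?c}"
        using not_collinear_two_rows[of "real x'" "real (k - x)" "real (Suc j)" "real j" "real x"] xk
        by (simp add: insert_commute)
      show "interior (convex hull {?A, ?B, ?c}) \<inter> \<Union>?\<sigma> = {}"
        by (rule between_lines_empty[OF path jk(1), where k = k]) (use jk xk in \<open>auto simp: x_def x'_def\<close>)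
      show "closed_segment ?A ?B \<in> ?\<sigma>"
        by (rule strips_slantedI) (use jk xx x_def in auto)
      show "closed_segment ?B ?c \<in> ?\<sigma>"
        using strips_horizontalI[of "k - x" m "Suc j" n a] xk xx jk by (simp add: closed_segment_commute)
      show "closed_segment ?A ?c \<in> ?\<sigma>"
        by (rule strips_slantedI) (use jk xk ak in auto)
    qed
    moreover have "triangle_in ?\<sigma> ?A ?B ?d" unfolding triangle_in_def
    proof (intro conjI)
      show "\<not> collinear {?A, ?B, ?d}"
        using not_collinear_two_rows[of "real x" "real (Suc x)" "real j" "real (Suc j)" "real x'"] by simp
      show "interior (convex hull {?A, ?B, ?d}) \<inter> \<Union>?\<sigma> = {}"
        by (rule between_lines_empty[OF path jk(1), where k = "Suc k"]) (use jk xk in \<open>auto simp: x_def x'_def\<close>)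
      show "closed_segment ?A ?B \<in> ?\<sigma>"
        by (rule strips_slantedI) (use jk xx x_def in auto)
      show "closed_segment ?B ?d \<in> ?\<sigma>"
        using strips_slantedI[of j n "Suc x" x' m a] xk xx jk by (simp add: closed_segment_commute)
      show "closed_segment ?A ?d \<in> ?\<sigma>"
        by (rule strips_horizontalI) (use jk xk bk in auto)
    qed
    ultimately have "is_flip ?\<sigma> (closed_segment ?A ?B) (closed_segment ?c ?d)"
      by (intro is_flip_parallelogram) (use xk in auto)
    moreover have "2 * a j k + 1 - a j (Suc k) = Suc x" "Suc k - Suc x = k - x" using s xk by auto
    ultimately show ?thesis by (simp add: slanted_edge_def x_def[symmetric] x'_def[symmetric] closed_segment_commute)
  next
    assume s: "a j (Suc k) = Suc (a j k)"
    let ?c = "(real (a j k), real j)" and ?d = "(real (Suc x'), real (Suc j))"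
    have xk: "x = Suc (a j k)" "x' = k - a j k" "a j (Suc (Suc k)) = x"
      using s corner ak by (auto simp: x_def x'_def)
    have "triangle_in ?\<sigma> ?A ?B ?c" unfolding triangle_in_def
    proof (intro conjI)
      show "\<not> collinear {?A, ?B, ?c}"
        using not_collinear_two_rows[of "real x" "real (a j k)" "real j" "real (Suc j)" "real x'"] xk by simp
      show "interior (convex hull {?A, ?B, ?c}) \<inter> \<Union>?\<sigma> = {}"
        by (rule between_lines_empty[OF path jk(1), where k = k]) (use jk xk in \<open>auto simp: x_def x'_def\<close>)
      show "closed_segment ?A ?B \<in> ?\<sigma>"
        by (rule strips_slantedI) (use jk xx x_def in auto)
      show "closed_segment ?B ?c \<in> ?\<sigma>"
        using strips_slantedI[of j n "a j k" x' m a] xk xx jk ak by (simp add: closed_segment_commute)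
      show "closed_segment ?A ?c \<in> ?\<sigma>"
        using strips_horizontalI[of "a j k" m j n a] jk xk xx by (simp add: closed_segment_commute)
    qed
    moreover have "triangle_in ?\<sigma> ?A ?B ?d" unfolding triangle_in_def
    proof (intro conjI)
      show "\<not> collinear {?A, ?B, ?d}"
        using not_collinear_two_rows[of "real x'" "real (Suc x')" "real (Suc j)" "real j" "real x"]
        by (simp add: insert_commute)
      show "interior (convex hull {?A, ?B, ?d}) \<inter> \<Union>?\<sigma> = {}"
        by (rule between_lines_empty[OF path jk(1), where k = "Suc k"]) (use jk xk xx ak in \<open>auto simp: x_def x'_def\<close>)
      show "closed_segment ?A ?B \<in> ?\<sigma>"
        by (rule strips_slantedI) (use jk xx x_def in auto)
      show "closed_segment ?B ?d \<in> ?\<sigma>"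
        by (rule strips_horizontalI) (use jk xk xx bk in auto)
      show "closed_segment ?A ?d \<in> ?\<sigma>"
        by (rule strips_slantedI) (use jk xk xx ak in auto)
    qed
    ultimately have "is_flip ?\<sigma> (closed_segment ?A ?B) (closed_segment ?c ?d)"
      by (intro is_flip_parallelogram) (use xk xx in auto)
    moreover have "2 * a j k + 1 - a j (Suc k) = a j k" "Suc k - a j k = Suc x'" using s xk ak by auto
    ultimately show ?thesis by (simp add: slanted_edge_def x_def[symmetric] x'_def[symmetric])
  qed
qed

lemma triangle_in_commute: "triangle_in \<sigma> a b c \<longleftrightarrow> triangle_in \<sigma> b a c"
  by (auto simp: triangle_in_def insert_commute closed_segment_commute)

text \<open>
  This excludes the degenerate unions of two triangles that form a triangle: if the common edge ended on
  the segment \<open>c d\<close>, its endpoint would not be a vertex of the union.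
\<close>

lemma quadrilateral_midpoint:
  assumes "c \<noteq> d" "{p. p extreme_point_of Q} = {a, b, c, d}"
  shows "midpoint c d \<noteq> a" "midpoint c d \<noteq> b"
proof -
  have *: "a extreme_point_of Q" "b extreme_point_of Q" "c extreme_point_of Q" "d extreme_point_of Q"
    using assms(2) by blast+
  have "midpoint c d \<in> open_segment c d" using assms(1) by (simp add: midpoint_in_open_segment)
  then show "midpoint c d \<noteq> a" "midpoint c d \<noteq> b" using * unfolding extreme_point_of_def by blast+
qed

lemma triangle_base_row:
  fixes x x' u y y' :: real
  assumes "z \<in> convex hull {(x, y), (x', y), (u, y')}" "snd z = y" "y' \<noteq> y" "x \<le> x'"
  shows "x \<le> fst z \<and> fst z \<le> x'"
proof -
  obtain r s t where w: "0 \<le> r" "0 \<le> s" "0 \<le> t" "r + s + t = 1"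
    "z = r *\<^sub>R (x, y) + s *\<^sub>R (x', y) + t *\<^sub>R (u, y')"
    using assms(1) by (auto simp: convex_hull_3)
  have "(r + s) * y + t * y' = y" using assms(2) w(5) by (simp add: algebra_simps)
  moreover have "r + s = 1 - t" using w(4) by simp
  ultimately have "t * (y' - y) = 0" by (simp add: algebra_simps)
  then have t: "t = 0" using assms(3) by simp
  then have z: "fst z = r * x + s * x'" "s = 1 - r" using w(4,5) by auto
  have "r * x + s * x \<le> r * x + s * x'" "r * x + s * x' \<le> r * x' + s * x'"
    using w assms(4) by (auto intro: mult_left_mono)
  moreover have "r * x + s * x = x" "r * x' + s * x' = x'" unfolding z(2) by (simp_all add: algebra_simps)
  ultimately show ?thesis unfolding z(1) by linarith
qed

text \<open>
  The horizontal edge from \<open>i\<close> to \<open>i + 1\<close> above strip \<open>j\<close> has the apex \<open>v\<close> below and the apex \<open>u\<close> above it.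
  The two triangles form a parallelogram, which is when the edge can be flipped, exactly if the segment
  of the apexes passes through the midpoint of the edge, i.e. if \<open>u + v = 2 * i + 1\<close>.
\<close>

definition rows_rigid :: "nat \<Rightarrow> nat \<Rightarrow> (nat \<Rightarrow> nat \<Rightarrow> nat) \<Rightarrow> bool" where
  "rows_rigid m n a \<longleftrightarrow> (\<forall>j i u v. Suc j < n \<longrightarrow> i < m \<longrightarrow>
     Suc (v + i) \<le> 2 * m \<longrightarrow> a j (v + i) = v \<longrightarrow> a j (Suc (v + i)) = v \<longrightarrow>
     Suc (i + u) \<le> 2 * m \<longrightarrow> a (Suc j) (i + u) = i \<longrightarrow> a (Suc j) (Suc (i + u)) = Suc i \<longrightarrow>
     u + v \<noteq> 2 * i + 1)"

lemma horizontal_apex: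
  assumes path: "strip_paths m n a"
    and t: "triangle_in (strips m n a) (real x, real y) (real (Suc x), real y) (real cx, real cy)"
  shows "(cy = Suc y \<and> y < n \<and> Suc (x + cx) \<le> 2 * m \<and> a y (x + cx) = x \<and> a y (Suc (x + cx)) = Suc x) \<or>
         (y = Suc cy \<and> cy < n \<and> Suc (cx + x) \<le> 2 * m \<and> a cy (cx + x) = cx \<and> a cy (Suc (cx + x)) = cx)"
proof -
  have c: "closed_segment (real x, real y) (real cx, real cy) \<in> strips m n a"
    "closed_segment (real (Suc x), real y) (real cx, real cy) \<in> strips m n a"
    using t unfolding triangle_in_def by blast+
  from c(1) consider "cx = Suc x" "cy = y" | "x = Suc cx" "cy = y"
    | "cy = Suc y" "a y (x + cx) = x" | "y = Suc cy" "a cy (cx + x) = cx"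
    unfolding strips_adjacent_iff[OF path] by (metis add.commute)
  then show ?thesis
    using c(2)[unfolded strips_adjacent_iff[OF path]]
    by cases (auto simp: add.commute)
qed

text \<open>
  Monotonicity of the paths leaves room for only one apex on each side of a horizontal edge, so the
  apexes \<open>c\<close> and \<open>d\<close> are on different sides. By convexity their midpoint lies on the edge, and it is not
  one of its endpoints. Being half-integral, it is the midpoint of the edge, which rigidity forbids.
\<close>

lemma horizontal_not_flippable:
  assumes path: "strip_paths m n a" and nz: "rows_rigid m n a"
    and t: "triangle_in (strips m n a) (real x, real y) (real (Suc x), real y) c"
      "triangle_in (strips m n a) (real x, real y) (real (Suc x), real y) d"
    and cd: "c \<noteq> d"
    and Q: "Q = convex hull {(real x, real y), (real (Suc x), real y), c} \<union> convex hull {(real x, real y), (real (Suc x), real y), d}"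
      "convex Q" "{p. p extreme_point_of Q} = {(real x, real y), (real (Suc x), real y), c, d}"
  shows False
proof -
  have "closed_segment (real x, real y) c \<in> strips m n a" "closed_segment (real x, real y) d \<in> strips m n a"
    using t unfolding triangle_in_def by blast+
  then obtain cx cy dx dy where c: "c = (real cx, real cy)" and d: "d = (real dx, real dy)"
    by (metis strips_vertex)
  note C = horizontal_apex[OF path t(1)[unfolded c]] and D = horizontal_apex[OF path t(2)[unfolded d]]
  have "closed_segment (real x, real y) (real (Suc x), real y) \<in> strips m n a"
    using t unfolding triangle_in_def by blast
  then have xm: "x < m" unfolding strips_adjacent_iff[OF path] by auto
  have up: "cx' = dx'" if "y < n" "Suc (x + cx') \<le> 2 * m" "a y (x + cx') = x" "a y (Suc (x + cx')) = Suc x"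
    "Suc (x + dx') \<le> 2 * m" "a y (x + dx') = x" "a y (Suc (x + dx')) = Suc x" for cx' dx'
  proof (rule ccontr)
    assume "cx' \<noteq> dx'"
    then have "Suc (x + cx') \<le> x + dx' \<or> Suc (x + dx') \<le> x + cx'" by linarith
    then show False
      using strip_path_step[OF strip_pathsD[OF path that(1)], of "Suc (x + cx')" "x + dx'"]
        strip_path_step[OF strip_pathsD[OF path that(1)], of "Suc (x + dx')" "x + cx'"] that by auto
  qed
  have down: "cx' = dx'" if "w < n" "Suc (cx' + x) \<le> 2 * m" "a w (cx' + x) = cx'" "a w (Suc (cx' + x)) = cx'"
    "Suc (dx' + x) \<le> 2 * m" "a w (dx' + x) = dx'" "a w (Suc (dx' + x)) = dx'" for cx' dx' w
  proof (rule ccontr)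
    assume "cx' \<noteq> dx'"
    then have "Suc (cx' + x) \<le> dx' + x \<or> Suc (dx' + x) \<le> cx' + x" by linarith
    then show False
      using strip_path_step[OF strip_pathsD[OF path that(1)], of "Suc (cx' + x)" "dx' + x"]
        strip_path_step[OF strip_pathsD[OF path that(1)], of "Suc (dx' + x)" "cx' + x"] that by auto
  qed
  have "midpoint c d \<in> Q"
  proof -
    have "c \<in> Q" "d \<in> Q" unfolding Q(1) by (auto intro: hull_inc)
    then have "closed_segment c d \<subseteq> Q" using Q(2) by (simp add: closed_segment_subset)
    then show ?thesis using midpoint_in_closed_segment by blast
  qed
  have ne: "midpoint c d \<noteq> (real x, real y)" "midpoint c d \<noteq> (real (Suc x), real y)"
    using quadrilateral_midpoint[OF cd Q(3)] by auto
  have opposite: "cx + dx = 2 * x + 1" if s: "cy + dy = 2 * y" "cy \<noteq> y" "dy \<noteq> y"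
  proof -
    have mid: "midpoint c d = ((real cx + real dx) / 2, real y)"
      using s(1) unfolding c d by (simp add: midpoint_def field_simps flip: of_nat_add)
    have "real x \<le> fst (midpoint c d) \<and> fst (midpoint c d) \<le> real (Suc x)"
      using \<open>midpoint c d \<in> Q\<close> unfolding Q(1)
    proof
      assume "midpoint c d \<in> convex hull {(real x, real y), (real (Suc x), real y), c}"
      then show ?thesis unfolding c by (rule triangle_base_row) (use s mid c in auto)
    next
      assume "midpoint c d \<in> convex hull {(real x, real y), (real (Suc x), real y), d}"
      then show ?thesis unfolding d by (rule triangle_base_row) (use s mid d in auto)
    qed
    then have "2 * real x \<le> real cx + real dx" "real cx + real dx \<le> 2 * real x + 2" unfolding mid by auto
    moreover have "real cx + real dx \<noteq> 2 * real x" "real cx + real dx \<noteq> 2 * real x + 2"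
      using ne unfolding mid by auto
    ultimately show ?thesis by linarith
  qed
  show False
  proof (cases "cy = Suc y")
    case cU: True
    show False
    proof (cases "dy = Suc y")
      case True
      have C': "y < n" "Suc (x + cx) \<le> 2 * m" "a y (x + cx) = x" "a y (Suc (x + cx)) = Suc x" using C cU by auto
      have D': "Suc (x + dx) \<le> 2 * m" "a y (x + dx) = x" "a y (Suc (x + dx)) = Suc x" using D True by auto
      have "cx = dx" by (rule up[OF C' D'])
      then show False using cd cU True unfolding c d by simp
    next
      case False
      then have y: "y = Suc dy" and D': "Suc (dx + x) \<le> 2 * m" "a dy (dx + x) = dx" "a dy (Suc (dx + x)) = dx"
        using D by auto
      have C': "y < n" "Suc (x + cx) \<le> 2 * m" "a y (x + cx) = x" "a y (Suc (x + cx)) = Suc x" using C cU by auto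
      have "cx + dx \<noteq> 2 * x + 1"
        using nz C' D' xm unfolding rows_rigid_def y by blast
      then show False using opposite cU y by simp
    qed
  next
    case False
    then have cD: "y = Suc cy" using C by auto
    show False
    proof (cases "dy = Suc y")
      case True
      then have D': "y < n" "Suc (x + dx) \<le> 2 * m" "a y (x + dx) = x" "a y (Suc (x + dx)) = Suc x" using D by auto
      have C': "Suc (cx + x) \<le> 2 * m" "a cy (cx + x) = cx" "a cy (Suc (cx + x)) = cx" using C cD by auto
      have "dx + cx \<noteq> 2 * x + 1"
        using nz C' D' xm unfolding rows_rigid_def cD by blast
      then show False using opposite cD True by simp
    next
      case False
      then have dD: "dy = cy" using D cD by auto
      have C': "cy < n" "Suc (cx + x) \<le> 2 * m" "a cy (cx + x) = cx" "a cy (Suc (cx + x)) = cx" using C cD by auto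
      have D': "Suc (dx + x) \<le> 2 * m" "a cy (dx + x) = dx" "a cy (Suc (dx + x)) = dx" using D False dD by auto
      have "cx = dx" by (rule down[OF C' D'])
      then show False using cd dD unfolding c d by simp
    qed
  qed
qed

text \<open>
  The apexes of the two triangles are the new endpoints of the preceding and of the following edge of
  the path. If the same endpoint moved at both steps, it would be the midpoint of the apexes;
  so the two steps are of different kinds and the other diagonal exchanges them.
\<close>

lemma slanted_flip:
  assumes path: "strip_paths m n a"
    and e: "y < n" "x + x' \<le> 2 * m" "a y (x + x') = x"
    and t: "triangle_in (strips m n a) (real x, real y) (real x', real (Suc y)) c"
      "triangle_in (strips m n a) (real x, real y) (real x', real (Suc y)) d"
    and cd: "c \<noteq> d"
    and Q: "{p. p extreme_point_of Q} = {(real x, real y), (real x', real (Suc y)), c, d}"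
  shows "\<exists>k. Suc k < 2 * m \<and> a y (Suc (Suc k)) = Suc (a y k) \<and> x + x' = Suc k \<and>
    closed_segment c d = slanted_edge y (2 * a y k + 1 - a y (Suc k)) (Suc k - (2 * a y k + 1 - a y (Suc k)))"
proof -
  have cdS: "closed_segment (real x, real y) c \<in> strips m n a" "closed_segment (real x', real (Suc y)) c \<in> strips m n a"
    "closed_segment (real x, real y) d \<in> strips m n a" "closed_segment (real x', real (Suc y)) d \<in> strips m n a"
    using t unfolding triangle_in_def by blast+
  then obtain cx cy dx dy where c: "c = (real cx, real cy)" and d: "d = (real dx, real dy)"
    by (metis strips_vertex)
  have ne: "midpoint c d \<noteq> (real x, real y)" "midpoint c d \<noteq> (real x', real (Suc y))"
    using quadrilateral_midpoint[OF cd Q] by auto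
  have key: "\<exists>k. Suc k < 2 * m \<and> a y (Suc (Suc k)) = Suc (a y k) \<and> x + x' = Suc k \<and>
    closed_segment c d = slanted_edge y (2 * a y k + 1 - a y (Suc k)) (Suc k - (2 * a y k + 1 - a y (Suc k)))"
    if p: "c = (real px, real py)" "d = (real qx, real qy)"
      "midpoint c d \<noteq> (real x, real y)" "midpoint c d \<noteq> (real x', real (Suc y))"
      and up: "(px = Suc x' \<and> py = Suc y \<and> Suc (x + x') \<le> 2 * m \<and> a y (Suc (x + x')) = x) \<or>
         (px = Suc x \<and> py = y \<and> Suc (x + x') \<le> 2 * m \<and> a y (Suc (x + x')) = Suc x)"
      and down: "(x' = Suc qx \<and> qy = Suc y \<and> a y (x + qx) = x) \<or>
         (x = Suc qx \<and> qy = y \<and> a y (qx + x') = qx)" for c d px py qx qy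
    using up down
  proof (elim disjE conjE)
    assume "px = Suc x'" "py = Suc y" "x' = Suc qx" "qy = Suc y"
    then show ?thesis using p by (simp add: midpoint_def)
  next
    assume "px = Suc x" "py = y" "x = Suc qx" "qy = y"
    then show ?thesis using p by (simp add: midpoint_def)
  next
    assume h: "px = Suc x'" "py = Suc y" "Suc (x + x') \<le> 2 * m" "a y (Suc (x + x')) = x" "x = Suc qx" "qy = y" "a y (qx + x') = qx"
    show ?thesis using h e
      by (intro exI[of _ "qx + x'"]) (auto simp: p(1,2) slanted_edge_def closed_segment_commute)
  next
    assume h: "px = Suc x" "py = y" "Suc (x + x') \<le> 2 * m" "a y (Suc (x + x')) = Suc x" "x' = Suc qx" "qy = Suc y" "a y (x + qx) = x"
    show ?thesis using h e
      by (intro exI[of _ "x + qx"]) (auto simp: p(1,2) slanted_edge_def)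
  qed
  note C = strip_edge_neighbours[OF path cdS(1,2)[unfolded c]] and D = strip_edge_neighbours[OF path cdS(3,4)[unfolded d]]
  consider "cx = dx" "cy = dy"
    | "(cx = Suc x' \<and> cy = Suc y \<and> Suc (x + x') \<le> 2 * m \<and> a y (Suc (x + x')) = x) \<or>
         (cx = Suc x \<and> cy = y \<and> Suc (x + x') \<le> 2 * m \<and> a y (Suc (x + x')) = Suc x)"
      "(x' = Suc dx \<and> dy = Suc y \<and> a y (x + dx) = x) \<or> (x = Suc dx \<and> dy = y \<and> a y (dx + x') = dx)"
    | "(dx = Suc x' \<and> dy = Suc y \<and> Suc (x + x') \<le> 2 * m \<and> a y (Suc (x + x')) = x) \<or>
         (dx = Suc x \<and> dy = y \<and> Suc (x + x') \<le> 2 * m \<and> a y (Suc (x + x')) = Suc x)"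
      "(x' = Suc cx \<and> cy = Suc y \<and> a y (x + cx) = x) \<or> (x = Suc cx \<and> cy = y \<and> a y (cx + x') = cx)"
    using C D by (elim disjE conjE) auto
  then show ?thesis
  proof cases
    case 1
    then show ?thesis using cd c d by simp
  next
    case 2
    show ?thesis by (rule key[OF c d ne 2])
  next
    case 3
    show ?thesis unfolding closed_segment_commute[of c d]
      by (rule key[OF d c _ _ 3]) (use ne in \<open>auto simp: midpoint_sym\<close>)
  qed
qed


text \<open>
  In a strip triangulation with rigid rows the possible flips are the exchanges of two adjacent distinct steps
  of a path; the exchange replaces \<open>a j (Suc k)\<close> by its mirror image between \<open>a j k\<close> and \<open>Suc (a j k)\<close>.
\<close>

lemma strips_flip_iff:
  assumes path: "strip_paths m n a" and nz: "rows_rigid m n a"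
  shows "is_flip (strips m n a) e e' \<longleftrightarrow> (\<exists>j k. j < n \<and> Suc k < 2 * m \<and> a j (Suc (Suc k)) = Suc (a j k) \<and>
     e = slanted_edge j (a j (Suc k)) (Suc k - a j (Suc k)) \<and>
     e' = slanted_edge j (2 * a j k + 1 - a j (Suc k)) (Suc k - (2 * a j k + 1 - a j (Suc k))))"
    (is "_ \<longleftrightarrow> ?R")
proof
  assume "is_flip (strips m n a) e e'"
  then obtain p q c d where f: "c \<noteq> d" "e = closed_segment p q" "e' = closed_segment c d"
    "triangle_in (strips m n a) p q c" "triangle_in (strips m n a) p q d"
    and Q: "convex (convex hull {p, q, c} \<union> convex hull {p, q, d})"
      "{r. r extreme_point_of convex hull {p, q, c} \<union> convex hull {p, q, d}} = {p, q, c, d}"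
    unfolding is_flip_def Let_def by blast
  have pq: "closed_segment p q \<in> strips m n a" using f(4) unfolding triangle_in_def by blast
  then obtain x y x' y' where xy: "p = (real x, real y)" "q = (real x', real y')" by (rule strips_vertex)
  have f': "triangle_in (strips m n a) q p c" "triangle_in (strips m n a) q p d"
    using f(4,5) triangle_in_commute by blast+
  have Q': "convex (convex hull {q, p, c} \<union> convex hull {q, p, d})"
      "{r. r extreme_point_of convex hull {q, p, c} \<union> convex hull {q, p, d}} = {q, p, c, d}"
    using Q by (simp_all only: insert_commute[of p q])
  have sl: ?R if e: "i < n" "u + v \<le> 2 * m" "a i (u + v) = u" "e = slanted_edge i u v"
    and ex: "\<exists>k. Suc k < 2 * m \<and> a i (Suc (Suc k)) = Suc (a i k) \<and> u + v = Suc k \<and>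
      closed_segment c d = slanted_edge i (2 * a i k + 1 - a i (Suc k)) (Suc k - (2 * a i k + 1 - a i (Suc k)))" for i u v
  proof -
    obtain k where k: "Suc k < 2 * m" "a i (Suc (Suc k)) = Suc (a i k)" "u + v = Suc k"
      "closed_segment c d = slanted_edge i (2 * a i k + 1 - a i (Suc k)) (Suc k - (2 * a i k + 1 - a i (Suc k)))"
      using ex by blast
    have "a i (Suc k) = u" "Suc k - u = v" using e(3) k(3) by auto
    then have "e = slanted_edge i (a i (Suc k)) (Suc k - a i (Suc k))" using e(4) by simp
    then show ?R using k e(1) f(3) by blast
  qed
  from pq[unfolded xy strips_adjacent_iff[OF path]] consider
    "y' = y" "x' = Suc x" | "y' = y" "x = Suc x'"
    | "y' = Suc y" "y < n" "x + x' \<le> 2 * m" "a y (x + x') = x"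
    | "y = Suc y'" "y' < n" "x' + x \<le> 2 * m" "a y' (x' + x) = x'"
    by (metis add.commute)
  then show ?R
  proof cases
    case 1
    have False by (rule horizontal_not_flippable[OF path nz _ _ f(1) refl, of x y])
      (use f(4,5) Q 1 xy in simp_all)
    then show ?R ..
  next
    case 2
    have False by (rule horizontal_not_flippable[OF path nz _ _ f(1) refl, of x' y])
      (use f' Q' 2 xy in simp_all)
    then show ?R ..
  next
    case 3
    show ?R
    proof (rule sl[OF 3(2,3,4)])
      show "e = slanted_edge y x x'" using f(2) xy 3 by (simp add: slanted_edge_def)
    qed (rule slanted_flip[OF path 3(2,3,4) _ _ f(1)], use f(4,5) Q(2) 3 xy in simp_all)
  next
    case 4
    show ?R
    proof (rule sl[OF 4(2,3,4)])
      show "e = slanted_edge y' x' x" using f(2) xy 4 by (simp add: slanted_edge_def closed_segment_commute)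
    qed (rule slanted_flip[OF path 4(2,3,4) _ _ f(1)], use f' Q'(2) 4 xy in simp_all)
  qed
next
  assume ?R
  then show "is_flip (strips m n a) e e'" using strip_corner_flip[OF path] by blast
qed

lemma strips_corner_update:
  assumes path: "strip_paths m n a"
    and jk: "j < n" "Suc k < 2 * m" and corner: "a j (Suc (Suc k)) = Suc (a j k)"
    and v: "v = 2 * a j k + 1 - a j (Suc k)" and a': "a' = a(j := (a j)(Suc k := v))"
  shows "insert (slanted_edge j v (Suc k - v)) (strips m n a - {slanted_edge j (a j (Suc k)) (Suc k - a j (Suc k))}) = strips m n a'"
    and "strip_paths m n a'"
proof -
  have step: "a j (Suc k) = a j k \<or> a j (Suc k) = Suc (a j k)"
    using strip_pathsD[OF path jk(1)] jk by (auto simp: strip_path_def)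
  have vv: "v = a j k \<or> v = Suc (a j k)" using step v by auto
  show "strip_paths m n a'"
    unfolding strip_paths_def
  proof (intro allI impI)
    fix i assume i: "i < n"
    show "strip_path m (a' i)"
    proof (cases "i = j")
      case False
      then show ?thesis using strip_pathsD[OF path i] a' by simp
    next
      case True
      have p: "a j 0 = 0" "a j (2 * m) = m" "\<And>l. l < 2 * m \<Longrightarrow> a j (Suc l) = a j l \<or> a j (Suc l) = Suc (a j l)"
        using strip_pathsD[OF path jk(1)] by (auto simp: strip_path_def)
      show ?thesis unfolding strip_path_def True a'
        using p jk corner vv by auto
    qed
  qed
  have ak: "a j k \<le> k" using strip_path_bounds(1)[OF strip_pathsD[OF path jk(1)]] jk by auto
  have al: "a j (Suc k) \<le> Suc k" using strip_path_bounds(1)[OF strip_pathsD[OF path jk(1)]] jk by auto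
  have bound: "a i l \<le> l" if "i < n" "l \<le> 2 * m" for i l
    using strip_path_bounds(1)[OF strip_pathsD[OF path that(1)] that(2)] .
  have inj: "i = j \<and> l = Suc k"
    if "slanted_edge i (a i l) (l - a i l) = slanted_edge j (a j (Suc k)) (Suc k - a j (Suc k))" "i < n" "l \<le> 2 * m" for i l
  proof -
    have "i = j \<and> a i l = a j (Suc k) \<and> l - a i l = Suc k - a j (Suc k)"
      using that(1) unfolding slanted_edge_def closed_segment_eq doubleton_eq_iff by auto
    then show ?thesis using bound[OF that(2,3)] al by auto
  qed
  have hs: "horizontal_edge i l \<noteq> slanted_edge i' u w" for i l i' u w
    by (auto simp: horizontal_edge_def slanted_edge_def doubleton_eq_iff)
  have old: "slanted_edge i (a' i l) (l - a' i l) = slanted_edge i (a i l) (l - a i l)" if "\<not> (i = j \<and> l = Suc k)" for i l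
    using that by (auto simp: a')
  have new: "slanted_edge j (a' j (Suc k)) (Suc k - a' j (Suc k)) = slanted_edge j v (Suc k - v)"
    by (simp add: a')
  show "insert (slanted_edge j v (Suc k - v)) (strips m n a - {slanted_edge j (a j (Suc k)) (Suc k - a j (Suc k))}) = strips m n a'"
    (is "?L = _")
  proof (intro equalityI subsetI)
    fix g assume "g \<in> ?L"
    then consider "g = slanted_edge j v (Suc k - v)"
      | i l where "i < m" "l \<le> n" "g = horizontal_edge i l"
      | i l where "i < n" "l \<le> 2 * m" "g = slanted_edge i (a i l) (l - a i l)" "g \<noteq> slanted_edge j (a j (Suc k)) (Suc k - a j (Suc k))"
      unfolding strips_def by blast
    then show "g \<in> strips m n a'"
    proof cases
      case 1
      then show ?thesis using slanted_edge_in_strips[of j n "Suc k" m a'] new jk by simp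
    next
      case 2
      then show ?thesis using horizontal_edge_in_strips by simp
    next
      case 3
      then have "\<not> (i = j \<and> l = Suc k)" by auto
      then show ?thesis using old 3 slanted_edge_in_strips[of i n l m a'] by simp
    qed
  next
    fix g assume "g \<in> strips m n a'"
    then consider i l where "i < m" "l \<le> n" "g = horizontal_edge i l"
      | i l where "i < n" "l \<le> 2 * m" "g = slanted_edge i (a' i l) (l - a' i l)"
      unfolding strips_def by blast
    then show "g \<in> ?L"
    proof cases
      case 1
      then show ?thesis using horizontal_edge_in_strips[of i m l n a] hs by auto
    next
      case 2
      show ?thesis
      proof (cases "i = j \<and> l = Suc k")
        case True
        then show ?thesis using 2 new by simp
      next
        case False
        then have g: "g = slanted_edge i (a i l) (l - a i l)" using old 2 by simp
        then have "g \<noteq> slanted_edge j (a j (Suc k)) (Suc k - a j (Suc k))" using inj 2 False by metis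
        then show ?thesis using g 2 slanted_edge_in_strips[of i n l m a] by simp
      qed
    qed
  qed
qed

section \<open>Exchanging the coordinates\<close>

text \<open>
  Traps are built from horizontal strips of length \<open>m\<close>. Exchanging the coordinates provides the
  vertical ones, which are better when \<open>n > m\<close>.
\<close>

definition swap_segment :: "segment \<Rightarrow> segment" where
  "swap_segment e = prod.swap ` e"

definition swap_edges :: "segment set \<Rightarrow> segment set" where
  "swap_edges \<sigma> = swap_segment ` \<sigma>"

lemma linear_swap: "linear (prod.swap :: point \<Rightarrow> point)"
  by (rule linearI) auto

lemma inj_swap: "inj (prod.swap :: point \<Rightarrow> point)"
  by (metis injI swap_swap)

lemma swap_segment_segment [simp]:
  "swap_segment (closed_segment a b) = closed_segment (prod.swap a) (prod.swap b)"
  by (simp add: swap_segment_def closed_segment_linear_image[OF linear_swap])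

lemma swap_segment_swap [simp]: "swap_segment (swap_segment e) = e"
  by (simp add: swap_segment_def image_image)

lemma inj_swap_segment: "inj swap_segment"
  by (metis injI swap_segment_swap)

lemma swap_edges_swap [simp]: "swap_edges (swap_edges \<sigma>) = \<sigma>"
  by (simp add: swap_edges_def image_image)

lemma swap_segment_mem [simp]: "swap_segment e \<in> swap_edges \<sigma> \<longleftrightarrow> e \<in> \<sigma>"
  using inj_image_mem_iff[OF inj_swap_segment] by (simp add: swap_edges_def)

lemma Union_swap_edges: "\<Union>(swap_edges \<sigma>) = prod.swap ` \<Union>\<sigma>"
  by (auto simp: swap_edges_def swap_segment_def)

lemma swap_mem_lattice_rect [simp]: "prod.swap p \<in> lattice_rect n m \<longleftrightarrow> p \<in> lattice_rect m n"
  by (cases p) (auto simp: lattice_rect_def)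

lemma swap_mem_lattice_edges:
  assumes "e \<in> lattice_edges m n" shows "swap_segment e \<in> lattice_edges n m"
proof -
  obtain a b where ab: "e = closed_segment a b" "a \<in> lattice_rect m n" "b \<in> lattice_rect m n" "a \<noteq> b"
    "closed_segment a b \<inter> (\<int> \<times> \<int>) = {a, b}"
    using assms by (auto simp: lattice_edges_def)
  have "prod.swap ` (closed_segment a b \<inter> (\<int> \<times> \<int>)) = prod.swap ` closed_segment a b \<inter> prod.swap ` (\<int> \<times> \<int>)"
    by (rule image_Int[OF inj_swap])
  moreover have "prod.swap ` (\<int> \<times> \<int>) = (\<int> \<times> \<int> :: point set)" by (rule product_swap)
  ultimately have "closed_segment (prod.swap a) (prod.swap b) \<inter> (\<int> \<times> \<int>) = {prod.swap a, prod.swap b}"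
    unfolding ab(5) closed_segment_linear_image[OF linear_swap] by simp
  moreover have "prod.swap a \<noteq> prod.swap b" using ab(4) by (metis swap_swap)
  ultimately have "closed_segment (prod.swap a) (prod.swap b) \<in> lattice_edges n m"
    using ab by (intro lattice_edgesI) auto
  then show ?thesis unfolding ab(1) by simp
qed

lemma swap_extreme_point:
  "prod.swap p extreme_point_of (prod.swap ` S) \<longleftrightarrow> p extreme_point_of (S :: point set)"
  unfolding extreme_point_of_def
  by (simp add: open_segment_linear_image[OF linear_swap inj_swap] inj_image_mem_iff[OF inj_swap])

lemma swap_extreme_points:
  "{p. p extreme_point_of (prod.swap ` S)} = prod.swap ` {p. p extreme_point_of (S :: point set)}"
proof -
  have "p extreme_point_of (prod.swap ` S) \<longleftrightarrow> prod.swap p extreme_point_of S" for p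
    using swap_extreme_point[of "prod.swap p" S] by simp
  then have "{p. p extreme_point_of (prod.swap ` S)} = {p. prod.swap p extreme_point_of S}" by simp
  also have "\<dots> = prod.swap ` {p. p extreme_point_of S}" by (auto intro: rev_image_eqI[of "prod.swap _"])
  finally show ?thesis .
qed

lemma swap_edges_cross [simp]: "edges_cross (swap_segment e) (swap_segment f) \<longleftrightarrow> edges_cross e f"
proof -
  have ep: "endpoints (swap_segment g) = prod.swap ` endpoints g" for g
    unfolding endpoints_def swap_segment_def by (rule swap_extreme_points)
  have "(\<exists>p \<in> prod.swap ` (e \<inter> f). p \<notin> prod.swap ` (endpoints e \<inter> endpoints f)) \<longleftrightarrow>
    (\<exists>p \<in> e \<inter> f. p \<notin> endpoints e \<inter> endpoints f)"
    using inj_image_mem_iff[OF inj_swap] by auto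
  moreover have "swap_segment e \<noteq> swap_segment f \<longleftrightarrow> e \<noteq> f" by (metis swap_segment_swap)
  ultimately show ?thesis unfolding edges_cross_def ep
    by (simp add: image_Int[OF inj_swap] swap_segment_def)
qed

lemma swap_noncrossing: "noncrossing \<sigma> \<Longrightarrow> noncrossing (swap_edges \<sigma>)"
  by (auto simp: noncrossing_def swap_edges_def)

lemma swap_triangulation:
  assumes "\<sigma> \<in> triangulations m n" shows "swap_edges \<sigma> \<in> triangulations n m"
  unfolding triangulations_def
proof (intro CollectI conjI allI impI)
  have \<sigma>: "\<sigma> \<subseteq> lattice_edges m n" "noncrossing \<sigma>"
    "\<And>\<tau>. \<tau> \<subseteq> lattice_edges m n \<Longrightarrow> noncrossing \<tau> \<Longrightarrow> \<sigma> \<subseteq> \<tau> \<Longrightarrow> \<tau> = \<sigma>"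
    using assms by (auto simp: triangulations_def)
  show "swap_edges \<sigma> \<subseteq> lattice_edges n m"
    using \<sigma>(1) swap_mem_lattice_edges by (auto simp: swap_edges_def)
  show "noncrossing (swap_edges \<sigma>)" using \<sigma>(2) by (rule swap_noncrossing)
  fix \<tau> assume \<tau>: "\<tau> \<subseteq> lattice_edges n m \<and> noncrossing \<tau> \<and> swap_edges \<sigma> \<subseteq> \<tau>"
  have "swap_edges \<tau> = \<sigma>"
  proof (rule \<sigma>(3))
    show "swap_edges \<tau> \<subseteq> lattice_edges m n" using \<tau> swap_mem_lattice_edges by (auto simp: swap_edges_def)
    show "noncrossing (swap_edges \<tau>)" using \<tau> swap_noncrossing by blast
    have "swap_edges (swap_edges \<sigma>) \<subseteq> swap_edges \<tau>" using \<tau> unfolding swap_edges_def by blast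
    then show "\<sigma> \<subseteq> swap_edges \<tau>" by simp
  qed
  then show "\<tau> = swap_edges \<sigma>" by (metis swap_edges_swap)
qed

lemma swap_collinear:
  assumes "collinear {a, b, c :: point}" shows "collinear {prod.swap a, prod.swap b, prod.swap c}"
proof -
  have "prod.swap (u *\<^sub>R a + (1 - u) *\<^sub>R c) = u *\<^sub>R prod.swap a + (1 - u) *\<^sub>R prod.swap c" for u
    by (simp add: prod_eq_iff)
  then show ?thesis using assms unfolding collinear_3_expand by metis
qed

lemma swap_hull: "convex hull {prod.swap a, prod.swap b, prod.swap c} = prod.swap ` (convex hull {a, b, c :: point})"
  by (simp add: convex_hull_linear_image[OF linear_swap])

lemma swap_triangle_in:
  assumes "triangle_in \<sigma> a b c"
  shows "triangle_in (swap_edges \<sigma>) (prod.swap a) (prod.swap b) (prod.swap c)"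
proof -
  have "interior (prod.swap ` (convex hull {a, b, c})) \<inter> prod.swap ` \<Union>\<sigma> = {}"
    using assms unfolding interior_injective_linear_image[OF linear_swap inj_swap] triangle_in_def
    by (simp flip: image_Int[OF inj_swap])
  moreover have "\<not> collinear {prod.swap a, prod.swap b, prod.swap c}"
    using assms swap_collinear[of "prod.swap a" "prod.swap b" "prod.swap c"] by (auto simp: triangle_in_def)
  moreover have "closed_segment (prod.swap p) (prod.swap q) \<in> swap_edges \<sigma>" if "closed_segment p q \<in> \<sigma>" for p q
    using that swap_segment_mem[of "closed_segment p q" \<sigma>] by simp
  ultimately show ?thesis using assms unfolding triangle_in_def swap_hull Union_swap_edges by blast
qed

lemma swap_is_flip_imp:
  assumes "is_flip \<sigma> e e'" shows "is_flip (swap_edges \<sigma>) (swap_segment e) (swap_segment e')"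
proof -
  obtain a b c d where f: "c \<noteq> d" "e = closed_segment a b" "e' = closed_segment c d"
    "triangle_in \<sigma> a b c" "triangle_in \<sigma> a b d"
    and Q: "convex (convex hull {a, b, c} \<union> convex hull {a, b, d})"
      "{r. r extreme_point_of convex hull {a, b, c} \<union> convex hull {a, b, d}} = {a, b, c, d}"
    using assms unfolding is_flip_def Let_def by blast
  define Q where "Q = convex hull {a, b, c} \<union> convex hull {a, b, d}"
  have hull: "convex hull {prod.swap a, prod.swap b, prod.swap c} \<union> convex hull {prod.swap a, prod.swap b, prod.swap d} = prod.swap ` Q"
    unfolding swap_hull Q_def by (simp add: image_Un)
  have "convex (prod.swap ` Q)" unfolding Q_def by (rule convex_linear_image[OF linear_swap Q(1)])
  moreover have "{r. r extreme_point_of prod.swap ` Q} = {prod.swap a, prod.swap b, prod.swap c, prod.swap d}"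
    unfolding swap_extreme_points Q_def Q(2) by simp
  moreover have "prod.swap c \<noteq> prod.swap d" using f(1) by (metis swap_swap)
  moreover have "swap_segment e = closed_segment (prod.swap a) (prod.swap b)"
    "swap_segment e' = closed_segment (prod.swap c) (prod.swap d)" using f by simp_all
  ultimately show ?thesis
    unfolding is_flip_def Let_def using swap_triangle_in[OF f(4)] swap_triangle_in[OF f(5)] hull by metis
qed

lemma swap_is_flip: "is_flip (swap_edges \<sigma>) e e' \<longleftrightarrow> is_flip \<sigma> (swap_segment e) (swap_segment e')"
  using swap_is_flip_imp[of "swap_edges \<sigma>" e e'] swap_is_flip_imp[of \<sigma> "swap_segment e" "swap_segment e'"] by auto

lemma swap_midpoint_set: "midpoint_set n m = prod.swap ` midpoint_set m n"
proof -
  have "p \<in> midpoint_set n m \<longleftrightarrow> prod.swap p \<in> midpoint_set m n" for n m p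
    using swap_mem_lattice_rect[of p m n] by (cases p) (auto simp: midpoint_set_def)
  then have *: "p \<in> midpoint_set n m \<longleftrightarrow> prod.swap p \<in> midpoint_set m n" for p .
  show ?thesis
  proof (intro equalityI subsetI)
    fix p assume "p \<in> midpoint_set n m"
    then have "prod.swap (prod.swap p) \<in> prod.swap ` midpoint_set m n" unfolding * by (rule imageI)
    then show "p \<in> prod.swap ` midpoint_set m n" by simp
  next
    fix p assume "p \<in> prod.swap ` midpoint_set m n"
    then obtain q where "q \<in> midpoint_set m n" "p = prod.swap q" by blast
    then show "p \<in> midpoint_set n m" by (simp add: *)
  qed
qed

section \<open>Trapped lattice paths\<close>

definition half :: "nat \<Rightarrow> nat" where "half m = (m + 1) div 2"

text \<open>
  Here \<open>c k\<close> measures, for a strip leaning to the right, the lower endpoint of edge \<open>k\<close>. The extreme path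
  has \<open>c k = k - m\<close> (truncated): first the upper endpoint travels all the way, then the lower one.
  A trapped path agrees with it on the first and the last \<open>half m\<close> steps. Since \<open>2 * half m \<ge> m\<close>, the
  values in between are at most \<open>m div 2 \<le> half m\<close>, so that no edge leans to the left
  (\<open>trapped_below_diagonal\<close>).
\<close>

definition trapped :: "nat \<Rightarrow> (nat \<Rightarrow> nat) \<Rightarrow> bool" where
  "trapped m c \<longleftrightarrow> strip_path m c \<and> (\<forall>k \<le> half m. c k = 0) \<and>
     (\<forall>k \<le> 2 * m. 2 * m \<le> k + half m \<longrightarrow> c k + m = k)"

text \<open>
  The sum of the horizontal extents of the edges of a strip; the vertical extents are all one, so
  this is the part of the length that depends on the path.
\<close>

definition path_excess :: "nat \<Rightarrow> (nat \<Rightarrow> nat) \<Rightarrow> real" where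
  "path_excess m c = (\<Sum>k\<le>2 * m. \<bar>real k - 2 * real (c k)\<bar>)"

lemma half_bounds: "half m + m div 2 = m" "m div 2 \<le> half m" "half m \<le> m" "1 \<le> m \<Longrightarrow> 1 \<le> half m"
  by (auto simp: half_def)

lemma trappedD:
  assumes "trapped m c"
  shows "strip_path m c" "k \<le> half m \<Longrightarrow> c k = 0"
    "k \<le> 2 * m \<Longrightarrow> 2 * m \<le> k + half m \<Longrightarrow> c k + m = k"
  using assms by (auto simp: trapped_def)

lemma trapped_ends:
  assumes "trapped m c"
  shows "c (half m) = 0" "c (2 * m - half m) = m div 2"
  using trappedD(2,3)[OF assms, of "half m"] trappedD(3)[OF assms, of "2 * m - half m"] half_bounds[of m] by auto

lemma trapped_upper:
  assumes "trapped m c" "half m \<le> k" "k \<le> 2 * m" shows "c k + half m \<le> k"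
  using strip_path_step[OF trappedD(1)[OF assms(1)] assms(2,3)] trapped_ends(1)[OF assms(1)] by simp

lemma trapped_middle:
  assumes "trapped m c" "k + half m \<le> 2 * m" shows "c k \<le> m div 2"
  using strip_path_step[OF trappedD(1)[OF assms(1)], of k "2 * m - half m"] trapped_ends(2)[OF assms(1)] assms by simp

lemma trapped_below_diagonal:
  assumes "trapped m c" "k \<le> 2 * m" shows "2 * c k \<le> k"
proof -
  consider "k \<le> half m" | "half m \<le> k" "k + half m \<le> 2 * m" | "2 * m \<le> k + half m" by linarith
  then show ?thesis
  proof cases
    case 1 then show ?thesis using trappedD(2)[OF assms(1)] by simp
  next
    case 2 then show ?thesis
      using trapped_upper[OF assms(1)] trapped_middle[OF assms(1)] half_bounds[of m] assms(2) by fastforce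
  next
    case 3 then show ?thesis using trappedD(3)[OF assms] assms(2) by simp
  qed
qed

text \<open>
  In a strip leaning to the right, \<open>v\<close> is the apex below the horizontal edge from \<open>i\<close> to \<open>i + 1\<close>. It lies
  at the left end of the strip for \<open>i\<close> in the left half, and never beyond the middle.
\<close>

lemma trapped_flat_step:
  assumes t: "trapped m c" and c: "c (v + i) = v" "c (Suc (v + i)) = v" "Suc (v + i) \<le> 2 * m"
  shows "v \<le> m div 2" "i < half m \<Longrightarrow> v = 0"
proof -
  have "\<not> 2 * m \<le> v + i + half m"
    using trappedD(3)[OF t, of "v + i"] trappedD(3)[OF t, of "Suc (v + i)"] c by auto
  then show "v \<le> m div 2" using trapped_middle[OF t, of "Suc (v + i)"] c by simp
  assume "i < half m"
  then have "v + i < half m" using trapped_upper[OF t, of "v + i"] c by force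
  then show "v = 0" using trappedD(2)[OF t, of "v + i"] c by simp
qed

text \<open>
  The counterpart for horizontal edges on the other side of the strip, whose apex \<open>v\<close> lies in the right half.
\<close>

lemma trapped_rising_step:
  assumes t: "trapped m c" and c: "c (v + i) = i" "c (Suc (v + i)) = Suc i" "Suc (v + i) \<le> 2 * m"
  shows "half m \<le> v" "m div 2 \<le> i \<Longrightarrow> v = m"
proof -
  have "half m \<le> v + i" using trappedD(2)[OF t, of "Suc (v + i)"] c by force
  then show "half m \<le> v" using trapped_upper[OF t, of "v + i"] c by simp
  assume "m div 2 \<le> i"
  then have "\<not> Suc (v + i) + half m \<le> 2 * m" using trapped_middle[OF t, of "Suc (v + i)"] c by auto
  then show "v = m" using trappedD(3)[OF t, of "v + i"] c by simp
qed

text \<open>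
  The lower endpoints in a zigzag: strips with \<open>even j = b\<close> lean to the right, and the others are their
  reflections, in which \<open>c j k\<close> is the upper endpoint.
\<close>

definition turn :: "bool \<Rightarrow> (nat \<Rightarrow> nat \<Rightarrow> nat) \<Rightarrow> nat \<Rightarrow> nat \<Rightarrow> nat" where
  "turn b c j k = (if even j = b then c j k else k - c j k)"

lemma strip_path_reflect:
  assumes "strip_path m c" shows "strip_path m (\<lambda>k. k - c k)"
  unfolding strip_path_def
proof (intro conjI allI impI)
  fix k assume k: "k < 2 * m"
  have "c k \<le> k" "c (Suc k) \<le> Suc k" "c (Suc k) = c k \<or> c (Suc k) = Suc (c k)"
    using strip_path_bounds(1)[OF assms] assms k by (auto simp: strip_path_def)
  then show "Suc k - c (Suc k) = k - c k \<or> Suc k - c (Suc k) = Suc (k - c k)" by auto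
qed (use assms in \<open>auto simp: strip_path_def\<close>)

lemma turn_strip_paths: "strip_paths m n c \<Longrightarrow> strip_paths m n (turn b c)"
proof -
  assume p: "strip_paths m n c"
  have "turn b c j = (if even j = b then c j else (\<lambda>k. k - c j k))" for j by (auto simp: turn_def)
  then show ?thesis using p strip_path_reflect[of m] by (simp add: strip_paths_def)
qed

text \<open>
  Two strips leaning in opposite directions form a wedge around their common row. If the wedge opens to
  the left, both apexes of the edge from \<open>i\<close> to \<open>i + 1\<close> are \<open>0\<close> for \<open>i < half m\<close>, and at most
  \<open>m div 2 \<le> half m\<close> otherwise; in either case \<open>u + v\<close> is not \<open>2 * i + 1\<close>. A wedge opening to the right is
  symmetric.
\<close>

lemma turn_rows_rigid:
  assumes t: "\<And>j. j < n \<Longrightarrow> trapped m (c j)"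
  shows "rows_rigid m n (turn b c)"
  unfolding rows_rigid_def
proof (intro allI impI)
  fix j i u v
  assume j: "Suc j < n" and i: "i < m" and bd: "Suc (v + i) \<le> 2 * m" "Suc (i + u) \<le> 2 * m"
    and a: "turn b c j (v + i) = v" "turn b c j (Suc (v + i)) = v"
      "turn b c (Suc j) (i + u) = i" "turn b c (Suc j) (Suc (i + u)) = Suc i"
  have t1: "trapped m (c j)" and t2: "trapped m (c (Suc j))" using t j by auto
  have le: "c j k \<le> k" "c (Suc j) k \<le> k" if "k \<le> 2 * m" for k
    using strip_path_bounds(1)[OF trappedD(1)[OF t1] that] strip_path_bounds(1)[OF trappedD(1)[OF t2] that] by auto
  note b = le[of "v + i"] le[of "Suc (v + i)"] le[of "i + u"] le[of "Suc (i + u)"]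
  show "u + v \<noteq> 2 * i + 1"
  proof (cases "even j = b")
    case True
    then have "c j (v + i) = v" "c j (Suc (v + i)) = v" "c (Suc j) (u + i) = u" "c (Suc j) (Suc (u + i)) = u"
      using a b bd by (auto simp: turn_def add.commute)
    then show ?thesis
      using trapped_flat_step[OF t1, of v i] trapped_flat_step[OF t2, of u i] bd half_bounds(2)[of m]
      by (cases "i < half m") (auto simp: add.commute)
  next
    case False
    then have "c j (v + i) = i" "c j (Suc (v + i)) = Suc i" "c (Suc j) (u + i) = i" "c (Suc j) (Suc (u + i)) = Suc i"
      using a b bd by (auto simp: turn_def add.commute)
    then have "half m \<le> v" "half m \<le> u" "m div 2 \<le> i \<Longrightarrow> u = m \<and> v = m"
      using trapped_rising_step[OF t1, of v i] trapped_rising_step[OF t2, of u i] bd by (auto simp: add.commute)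
    then show ?thesis using i half_bounds(2)[of m] by (cases "m div 2 \<le> i") auto
  qed
qed

definition trap_paths :: "nat \<Rightarrow> (nat \<Rightarrow> nat) set" where
  "trap_paths m = {c \<in> extensional {..2 * m}. trapped m c}"

lemma finite_trap_paths: "finite (trap_paths m)"
proof -
  have "trap_paths m \<subseteq> {..2 * m} \<rightarrow>\<^sub>E {..m}"
    using strip_path_bounds(2)[OF trappedD(1)] by (auto simp: trap_paths_def PiE_def)
  then show ?thesis by (rule finite_subset) (simp add: finite_PiE)
qed

text \<open>
  The two surgeries on paths about to leave the trap. The free part of a trapped path extends over the
  steps from \<open>half m\<close> to \<open>2 * m - half m\<close>. If its first step is a rise, \<open>delay_rise\<close> moves this step to
  the end of the free part; if its last step is flat, \<open>advance_flat\<close> moves this step to the beginning.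
\<close>

definition delay_rise :: "nat \<Rightarrow> (nat \<Rightarrow> nat) \<Rightarrow> nat \<Rightarrow> nat" where
  "delay_rise m c k = (if half m \<le> k \<and> k + half m < 2 * m then c (Suc k) - 1 else c k)"

definition advance_flat :: "nat \<Rightarrow> (nat \<Rightarrow> nat) \<Rightarrow> nat \<Rightarrow> nat" where
  "advance_flat m c k = (if half m < k \<and> k + half m \<le> 2 * m then c (k - 1) else c k)"

lemma path_excess_trapped:
  assumes "trapped m c" shows "path_excess m c = (\<Sum>k\<le>2 * m. real k - 2 * real (c k))"
  unfolding path_excess_def
proof (rule sum.cong[OF refl])
  fix k assume "k \<in> {..2 * m}"
  then have "2 * c k \<le> k" using trapped_below_diagonal[OF assms] by simp
  then show "\<bar>real k - 2 * real (c k)\<bar> = real k - 2 * real (c k)" by linarith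
qed

lemma path_excess_diff:
  assumes "trapped m c" "trapped m d"
  shows "path_excess m d = path_excess m c + 2 * (\<Sum>k\<le>2 * m. real (c k) - real (d k))"
  unfolding path_excess_trapped[OF assms(1)] path_excess_trapped[OF assms(2)]
  by (simp add: sum_subtractf sum_distrib_left)

lemma delay_rise_trapped:
  assumes t: "trapped m c" and r: "c (Suc (half m)) = 1" and m: "1 \<le> m"
  shows "trapped m (delay_rise m c)"
proof -
  note hb = half_bounds[of m]
  have sp: "c 0 = 0" "c (2 * m) = m" "\<And>k. k < 2 * m \<Longrightarrow> c (Suc k) = c k \<or> c (Suc k) = Suc (c k)"
    using trappedD(1)[OF t] by (auto simp: strip_path_def)
  have pos: "1 \<le> c (Suc k)" if "half m \<le> k" "Suc k \<le> 2 * m" for k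
    using strip_path_step[OF trappedD(1)[OF t], of "Suc (half m)" "Suc k"] that r by simp
  have z: "delay_rise m c k = 0" if "k \<le> half m" for k
    using that trappedD(2)[OF t] r by (auto simp: delay_rise_def)
  have e: "delay_rise m c k + m = k" if "k \<le> 2 * m" "2 * m \<le> k + half m" for k
    using that trappedD(3)[OF t] by (simp add: delay_rise_def)
  have st: "delay_rise m c (Suc k) = delay_rise m c k \<or> delay_rise m c (Suc k) = Suc (delay_rise m c k)"
    if k: "k < 2 * m" for k
  proof -
    consider "k < half m" | "half m \<le> k" "Suc k + half m < 2 * m" | "half m \<le> k" "Suc k + half m = 2 * m"
      | "2 * m \<le> k + half m" by linarith
    then show ?thesis
    proof cases
      case 1
      then show ?thesis using z[of k] z[of "Suc k"] by simp
    next
      case 2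
      then have "delay_rise m c (Suc k) = c (Suc (Suc k)) - 1" "delay_rise m c k = c (Suc k) - 1" by (auto simp: delay_rise_def)
      then show ?thesis using sp(3)[of "Suc k"] pos[of k] 2 by auto
    next
      case 3
      then have "delay_rise m c (Suc k) = c (Suc k)" "delay_rise m c k = c (Suc k) - 1" by (auto simp: delay_rise_def)
      then show ?thesis using pos[of k] 3 by auto
    next
      case 4
      then show ?thesis using sp(3)[OF k] by (simp add: delay_rise_def)
    qed
  qed
  have "delay_rise m c (2 * m) = m" using e[of "2 * m"] by simp
  then show ?thesis unfolding trapped_def strip_path_def using z e st by auto
qed

text \<open>
  The moved step passes the \<open>m div 2\<close> flat steps of the free part, and each passage lowers one value of \<open>c\<close> by
  one and so lengthens one edge by two.
\<close>

lemma delay_rise_excess: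
  assumes t: "trapped m c" and r: "c (Suc (half m)) = 1" and m: "1 \<le> m"
  shows "path_excess m (delay_rise m c) = path_excess m c + 2 * real (m div 2)"
proof -
  note hb = half_bounds[of m]
  have pos: "1 \<le> c (Suc k)" if "half m \<le> k" "Suc k \<le> 2 * m" for k
    using strip_path_step[OF trappedD(1)[OF t], of "Suc (half m)" "Suc k"] that r by simp
  have "(\<Sum>k\<le>2 * m. real (c k) - real (delay_rise m c k)) =
    (\<Sum>k\<in>{half m..<2 * m - half m}. real (c k) - real (delay_rise m c k))"
    by (rule sum.mono_neutral_right) (auto simp: delay_rise_def)
  also have "\<dots> = (\<Sum>k\<in>{half m..<2 * m - half m}. 1 - (real (c (Suc k)) - real (c k)))"
  proof (rule sum.cong[OF refl])
    fix k assume k: "k \<in> {half m..<2 * m - half m}"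
    then show "real (c k) - real (delay_rise m c k) = 1 - (real (c (Suc k)) - real (c k))"
      using pos[of k] by (auto simp: delay_rise_def of_nat_diff)
  qed
  also have "\<dots> = real (2 * m - half m - half m) - (real (c (2 * m - half m)) - real (c (half m)))"
    using sum_Suc_diff'[of "half m" "2 * m - half m" "\<lambda>k. real (c k)"] hb by (simp add: sum_subtractf)
  also have "\<dots> = real (m div 2)"
    using hb unfolding trapped_ends[OF t] by (simp add: of_nat_diff)
  finally show ?thesis using path_excess_diff[OF t delay_rise_trapped[OF assms]] by simp
qed

lemma advance_flat_trapped:
  assumes t: "trapped m c" and r: "c (2 * m - half m - 1) = m div 2" and m: "1 \<le> m"
  shows "trapped m (advance_flat m c)"
proof -
  note hb = half_bounds[of m]
  have sp: "c 0 = 0" "c (2 * m) = m" "\<And>k. k < 2 * m \<Longrightarrow> c (Suc k) = c k \<or> c (Suc k) = Suc (c k)"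
    using trappedD(1)[OF t] by (auto simp: strip_path_def)
  have z: "advance_flat m c k = 0" if "k \<le> half m" for k
    using that trappedD(2)[OF t] by (auto simp: advance_flat_def)
  have e: "advance_flat m c k + m = k" if "k \<le> 2 * m" "2 * m \<le> k + half m" for k
  proof (cases "half m < k \<and> k + half m \<le> 2 * m")
    case True
    then have "k = 2 * m - half m" using that by linarith
    then show ?thesis using True r hb by (simp add: advance_flat_def)
  qed (use that trappedD(3)[OF t] in \<open>auto simp: advance_flat_def\<close>)
  have st: "advance_flat m c (Suc k) = advance_flat m c k \<or> advance_flat m c (Suc k) = Suc (advance_flat m c k)"
    if k: "k < 2 * m" for k
  proof -
    consider "k < half m" | "k = half m" "Suc k + half m \<le> 2 * m" | "half m < k" "Suc k + half m \<le> 2 * m"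
      | "half m \<le> k" "2 * m \<le> k + half m" using hb by linarith
    then show ?thesis
    proof cases
      case 1
      then show ?thesis using z[of k] z[of "Suc k"] by simp
    next
      case 2
      then show ?thesis by (simp add: advance_flat_def)
    next
      case 3
      then have "advance_flat m c (Suc k) = c k" "advance_flat m c k = c (k - 1)" by (auto simp: advance_flat_def)
      then show ?thesis using sp(3)[of "k - 1"] 3 k by auto
    next
      case 4
      then show ?thesis using e[of k] e[of "Suc k"] k by auto
    qed
  qed
  have "advance_flat m c (2 * m) = m" using e[of "2 * m"] by simp
  then show ?thesis unfolding trapped_def strip_path_def using z e st by auto
qed

lemma advance_flat_excess:
  assumes t: "trapped m c" and r: "c (2 * m - half m - 1) = m div 2" and m: "1 \<le> m"
  shows "path_excess m (advance_flat m c) = path_excess m c + 2 * real (m div 2)"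
proof -
  note hb = half_bounds[of m]
  have "(\<Sum>k\<le>2 * m. real (c k) - real (advance_flat m c k)) =
    (\<Sum>k\<in>Suc ` {half m..<2 * m - half m}. real (c k) - real (advance_flat m c k))"
  proof (rule sum.mono_neutral_right)
    show "Suc ` {half m..<2 * m - half m} \<subseteq> {..2 * m}" by auto
    show "\<forall>k\<in>{..2 * m} - Suc ` {half m..<2 * m - half m}. real (c k) - real (advance_flat m c k) = 0"
      by (auto simp: advance_flat_def image_Suc_atLeastLessThan)
  qed simp
  also have "\<dots> = (\<Sum>k\<in>{half m..<2 * m - half m}. real (c (Suc k)) - real (c k))"
    by (subst sum.reindex) (auto intro!: sum.cong simp: advance_flat_def)
  also have "\<dots> = real (c (2 * m - half m)) - real (c (half m))"
    using sum_Suc_diff'[of "half m" "2 * m - half m" "\<lambda>k. real (c k)"] hb by simp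
  also have "\<dots> = real (m div 2)" unfolding trapped_ends[OF t] by simp
  finally show ?thesis using path_excess_diff[OF t advance_flat_trapped[OF assms]] by simp
qed

lemma delay_rise_inj:
  "inj_on (delay_rise m) {c \<in> trap_paths m. c (Suc (half m)) = 1}"
proof (rule inj_onI)
  fix c d assume c: "c \<in> {c \<in> trap_paths m. c (Suc (half m)) = 1}" and d: "d \<in> {c \<in> trap_paths m. c (Suc (half m)) = 1}"
    and eq: "delay_rise m c = delay_rise m d"
  have t: "trapped m c" "trapped m d" using c d by (auto simp: trap_paths_def)
  show "c = d"
  proof
    fix k
    consider "k \<le> half m" | l where "k = Suc l" "half m \<le> l" "l + half m < 2 * m" | "2 * m < k + half m"
      by (metis add_Suc less_eq_Suc_le not_less old.nat.exhaust not_less_eq_eq zero_le)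
    then show "c k = d k"
    proof cases
      case 1
      then show ?thesis using t trappedD(2) by metis
    next
      case 2
      have "1 \<le> c (Suc l)" "1 \<le> d (Suc l)"
        using strip_path_step[OF trappedD(1)[OF t(1)], of "Suc (half m)" "Suc l"]
          strip_path_step[OF trappedD(1)[OF t(2)], of "Suc (half m)" "Suc l"] 2 c d by auto
      moreover have "c (Suc l) - 1 = d (Suc l) - 1" using fun_cong[OF eq, of l] 2 by (simp add: delay_rise_def)
      ultimately show ?thesis using 2 by simp
    next
      case 3
      then show ?thesis using fun_cong[OF eq, of k] by (simp add: delay_rise_def)
    qed
  qed
qed

lemma advance_flat_inj:
  "inj_on (advance_flat m) {c \<in> trap_paths m. c (2 * m - half m - 1) = m div 2}"
proof (rule inj_onI)
  fix c d assume c: "c \<in> {c \<in> trap_paths m. c (2 * m - half m - 1) = m div 2}"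
    and d: "d \<in> {c \<in> trap_paths m. c (2 * m - half m - 1) = m div 2}"
    and eq: "advance_flat m c = advance_flat m d"
  have t: "trapped m c" "trapped m d" using c d by (auto simp: trap_paths_def)
  show "c = d"
  proof
    fix k
    consider "k \<le> half m" | "half m < k" "k + half m < 2 * m" | "k + half m = 2 * m" | "2 * m < k + half m"
      by linarith
    then show "c k = d k"
    proof cases
      case 1
      then show ?thesis using t trappedD(2) by metis
    next
      case 2
      then show ?thesis using fun_cong[OF eq, of "Suc k"] by (simp add: advance_flat_def)
    next
      case 3
      then have "k = 2 * m - half m" by simp
      then show ?thesis using trapped_ends(2) t by metis
    next
      case 4
      then show ?thesis using fun_cong[OF eq, of k] by (simp add: advance_flat_def)
    qed
  qed
qed

lemma delay_rise_trap_paths: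
  assumes "c \<in> trap_paths m" "c (Suc (half m)) = 1" "1 \<le> m"
  shows "delay_rise m c \<in> trap_paths m"
  using assms delay_rise_trapped[of m c] by (auto simp: trap_paths_def extensional_def delay_rise_def)

lemma advance_flat_trap_paths:
  assumes "c \<in> trap_paths m" "c (2 * m - half m - 1) = m div 2" "1 \<le> m"
  shows "advance_flat m c \<in> trap_paths m"
  using assms advance_flat_trapped[of m c] by (auto simp: trap_paths_def extensional_def advance_flat_def)

lemma trap_paths_nonempty: "trap_paths m \<noteq> {}"
proof -
  let ?c = "\<lambda>k. if k \<le> 2 * m then k - m else undefined"
  have "?c \<in> trap_paths m"
    using half_bounds[of m] by (auto simp: trap_paths_def trapped_def strip_path_def extensional_def)
  then show ?thesis by blast
qed

section \<open>Zigzag triangulations\<close>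

lemma midpoint_set_strips:
  "midpoint_set m n = (\<lambda>(j, k). (real k / 2, real j + 1 / 2)) ` ({..<n} \<times> {..2 * m}) \<union>
     (\<lambda>(i, j). (real i + 1 / 2, real j)) ` ({..<m} \<times> {..n})" (is "_ = ?S \<union> ?H")
proof (intro equalityI subsetI)
  fix p assume "p \<in> midpoint_set m n"
  then obtain i j where p: "p = (real i / 2, real j / 2)" "i \<le> 2 * m" "j \<le> 2 * n" "p \<notin> lattice_rect m n"
    by (auto simp: midpoint_set_def)
  show "p \<in> ?S \<union> ?H"
  proof (cases "odd j")
    case True
    then obtain j' where "j = 2 * j' + 1" by (rule oddE)
    then have "p = (real i / 2, real j' + 1 / 2)" "j' < n" using p by auto
    then have "p \<in> ?S" using p(2) by (auto intro!: image_eqI[where x = "(j', i)"])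
    then show ?thesis ..
  next
    case False
    then obtain j' where j': "j = 2 * j'" by (auto elim: evenE)
    have "odd i"
    proof
      assume "even i"
      then obtain i' where "i = 2 * i'" by (auto elim: evenE)
      then have "p = (real i', real j')" "i' \<le> m" "j' \<le> n" using p j' by auto
      then show False using p(4) by (auto simp: lattice_rect_def)
    qed
    then obtain i' where "i = 2 * i' + 1" by (rule oddE)
    then have "p = (real i' + 1 / 2, real j')" "i' < m" "j' \<le> n" using p j' by auto
    then have "p \<in> ?H" by (auto intro!: image_eqI[where x = "(i', j')"])
    then show ?thesis ..
  qed
next
  have half_int: "real j + 1 / 2 \<noteq> real l" for j l
  proof
    assume "real j + 1 / 2 = real l"
    then have "real (2 * j + 1) = real (2 * l)" by simp
    then have "2 * j + 1 = 2 * l" by (simp only: of_nat_eq_iff)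
    then show False by presburger
  qed
  fix p assume "p \<in> ?S \<union> ?H"
  then show "p \<in> midpoint_set m n"
  proof
    assume "p \<in> ?S"
    then obtain j k where p: "j < n" "k \<le> 2 * m" "p = (real k / 2, real j + 1 / 2)" by auto
    then have "p = (real k / 2, real (2 * j + 1) / 2)" "2 * j + 1 \<le> 2 * n" by auto
    moreover have "p \<notin> lattice_rect m n" using p(3) half_int by (auto simp: lattice_rect_def)
    ultimately show ?thesis using p(2) unfolding midpoint_set_def by blast
  next
    assume "p \<in> ?H"
    then obtain i j where p: "i < m" "j \<le> n" "p = (real i + 1 / 2, real j)" by auto
    then have "p = (real (2 * i + 1) / 2, real (2 * j) / 2)" "2 * i + 1 \<le> 2 * m" "2 * j \<le> 2 * n" by auto
    moreover have "p \<notin> lattice_rect m n" using p(3) half_int by (auto simp: lattice_rect_def)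
    ultimately show ?thesis unfolding midpoint_set_def by blast
  qed
qed

text \<open>
  The parameter \<open>b\<close> selects one of the two opposite zigzags, and \<open>r\<close> says whether the strips of length \<open>m\<close>
  are vertical, in which case the rectangle is \<open>n\<close> wide and \<open>m\<close> high.
\<close>

locale zigzag =
  fixes lam :: real and m n :: nat and b r :: bool
  assumes lam: "1 < lam" and m: "1 \<le> m" and n: "1 \<le> n"
begin

definition width :: nat where "width = (if r then n else m)"
definition height :: nat where "height = (if r then m else n)"

definition place :: "point \<Rightarrow> point" where "place p = (if r then prod.swap p else p)"

definition tri :: "(nat \<Rightarrow> nat \<Rightarrow> nat) \<Rightarrow> segment set" where
  "tri c = (if r then swap_edges (strips m n (turn b c)) else strips m n (turn b c))"

text \<open>
  In strips of both kinds the long edges at the beginning of the extreme path have \<open>v = 0\<close>, so that the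
  single condition \<^const>\<open>trapped\<close> serves both.
\<close>

definition edge :: "nat \<Rightarrow> nat \<Rightarrow> nat \<Rightarrow> segment" where
  "edge j k v = (let e = (if even j = b then slanted_edge j v (k - v) else slanted_edge j (k - v) v)
     in if r then swap_segment e else e)"

definition row_edge :: "nat \<Rightarrow> nat \<Rightarrow> segment" where
  "row_edge i j = (if r then swap_segment (horizontal_edge i j) else horizontal_edge i j)"

definition mid :: "nat \<Rightarrow> nat \<Rightarrow> point" where "mid j k = place (real k / 2, real j + 1 / 2)"
definition row_mid :: "nat \<Rightarrow> nat \<Rightarrow> point" where "row_mid i j = place (real i + 1 / 2, real j)"

text \<open>
  Paths are extensional functions, so that a triangulation determines its family of paths
  (\<open>tri_inj\<close>). A flip may lead out of \<open>traps\<close>, but it does not leave \<open>families\<close>.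
\<close>

definition families :: "(nat \<Rightarrow> nat \<Rightarrow> nat) set" where
  "families = (\<Pi>\<^sub>E j\<in>{..<n}. {c \<in> extensional {..2 * m}. strip_path m c})"

definition traps :: "(nat \<Rightarrow> nat \<Rightarrow> nat) set" where
  "traps = (\<Pi>\<^sub>E j\<in>{..<n}. trap_paths m)"

text \<open>
  The steps before and after edge \<open>k\<close> differ, so that it can be flipped; \<open>other_value\<close> is the value of \<open>c j k\<close>
  after the flip.
\<close>

definition corner :: "(nat \<Rightarrow> nat \<Rightarrow> nat) \<Rightarrow> nat \<Rightarrow> nat \<Rightarrow> bool" where
  "corner c j k \<longleftrightarrow> j < n \<and> 0 < k \<and> k < 2 * m \<and> c j (Suc k) = Suc (c j (k - 1))"

definition other_value :: "(nat \<Rightarrow> nat \<Rightarrow> nat) \<Rightarrow> nat \<Rightarrow> nat \<Rightarrow> nat" where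
  "other_value c j k = 2 * c j (k - 1) + 1 - c j k"

definition flip_at :: "(nat \<Rightarrow> nat \<Rightarrow> nat) \<Rightarrow> nat \<Rightarrow> nat \<Rightarrow> nat \<Rightarrow> nat \<Rightarrow> nat" where
  "flip_at c j k = c(j := (c j)(k := other_value c j k))"

lemma traps_families: "c \<in> traps \<Longrightarrow> c \<in> families"
  by (auto simp: traps_def families_def trap_paths_def PiE_iff trapped_def)

lemma finite_traps: "finite traps"
  unfolding traps_def by (intro finite_PiE finite_trap_paths) auto

lemma traps_trapped: "c \<in> traps \<Longrightarrow> j < n \<Longrightarrow> trapped m (c j)"
  by (auto simp: traps_def trap_paths_def PiE_iff)

lemma families_paths: "c \<in> families \<Longrightarrow> strip_paths m n c"
  by (auto simp: families_def strip_paths_def PiE_iff)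

lemma families_bound: "c \<in> families \<Longrightarrow> j < n \<Longrightarrow> k \<le> 2 * m \<Longrightarrow> c j k \<le> k"
  using strip_path_bounds(1)[OF strip_pathsD[OF families_paths]] by blast

lemma turn_paths: "c \<in> families \<Longrightarrow> strip_paths m n (turn b c)"
  by (intro turn_strip_paths families_paths)

lemma tri_triangulation: "c \<in> families \<Longrightarrow> tri c \<in> triangulations width height"
  using strips_triangulation[OF turn_paths, of c] swap_triangulation[of _ m n]
  by (auto simp: tri_def width_def height_def)

lemma tri_edges:
  assumes "c \<in> families"
  shows "noncrossing (tri c)" "tri c \<subseteq> lattice_edges width height"
  using tri_triangulation[OF assms] by (auto simp: triangulations_def)

lemma edge_turn:
  assumes "v \<le> k" "w = (if even j = b then v else k - v)"
  shows "(if r then swap_segment (slanted_edge j w (k - w)) else slanted_edge j w (k - w)) = edge j k v"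
  using assms by (auto simp: edge_def)

lemma edge_in_tri:
  assumes "c \<in> families" "j < n" "k \<le> 2 * m" shows "edge j k (c j k) \<in> tri c"
proof -
  have "slanted_edge j (turn b c j k) (k - turn b c j k) \<in> strips m n (turn b c)"
    using assms by (intro slanted_edge_in_strips)
  then have "(if r then swap_segment (slanted_edge j (turn b c j k) (k - turn b c j k)) else slanted_edge j (turn b c j k) (k - turn b c j k)) \<in> tri c"
    by (auto simp: tri_def)
  then show ?thesis using edge_turn[OF families_bound[OF assms], of "turn b c j k" j] by (simp add: turn_def)
qed

lemma row_edge_in_tri: "i < m \<Longrightarrow> j \<le> n \<Longrightarrow> row_edge i j \<in> tri c"
  using horizontal_edge_in_strips[of i m j n "turn b c"] by (auto simp: row_edge_def tri_def)

lemma edge_mid: "v \<le> k \<Longrightarrow> edge_midpoint (edge j k v) = mid j k"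
  by (auto simp: edge_def slanted_edge_def mid_def place_def midpoint_def field_simps)

lemma row_edge_mid: "edge_midpoint (row_edge i j) = row_mid i j"
  by (auto simp: row_edge_def horizontal_edge_def row_mid_def place_def midpoint_def field_simps)

lemma edge_len: "v \<le> k \<Longrightarrow> edge_length (edge j k v) = 1 + \<bar>real k - 2 * real v\<bar>"
  by (auto simp: edge_def slanted_edge_def of_nat_diff Let_def)

lemma edge_inj: "v \<le> k \<Longrightarrow> w \<le> k \<Longrightarrow> edge j k v = edge j k w \<Longrightarrow> v = w"
proof -
  assume vw: "v \<le> k" "w \<le> k" "edge j k v = edge j k w"
  have "(if even j = b then slanted_edge j v (k - v) else slanted_edge j (k - v) v) = (if even j = b then slanted_edge j w (k - w) else slanted_edge j (k - w) w)"
    using vw(3) unfolding edge_def Let_def by (cases r) (simp_all only: if_True if_False inj_eq[OF inj_swap_segment])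
  then show "v = w" using vw(1,2) by (auto simp: slanted_edge_def doubleton_eq_iff split: if_splits)
qed

lemma mid_inj: "mid j k = mid j' k' \<longleftrightarrow> j = j' \<and> k = k'"
  by (auto simp: mid_def place_def)

lemma row_mid_inj: "row_mid i j = row_mid i' j' \<longleftrightarrow> i = i' \<and> j = j'"
  by (auto simp: row_mid_def place_def)

lemma mid_row_mid: "mid j k \<noteq> row_mid i l"
proof
  assume "mid j k = row_mid i l"
  then have "real j + 1 / 2 = real l" by (auto simp: mid_def row_mid_def place_def split: if_splits)
  then have "real (2 * j + 1) = real (2 * l)" by simp
  then have "2 * j + 1 = 2 * l" by (simp only: of_nat_eq_iff)
  then show False by presburger
qed

lemma midpoints:
  "midpoint_set width height = (\<lambda>(j, k). mid j k) ` ({..<n} \<times> {..2 * m}) \<union> (\<lambda>(i, j). row_mid i j) ` ({..<m} \<times> {..n})"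
proof -
  have "midpoint_set width height = place ` midpoint_set m n"
    using swap_midpoint_set[of m n] by (auto simp: width_def height_def place_def)
  then show ?thesis unfolding midpoint_set_strips image_Un image_image mid_def row_mid_def by (simp add: case_prod_beta')
qed

lemma midpoints_finite: "finite (midpoint_set width height)" unfolding midpoints by simp

lemma sum_midpoints:
  "(\<Sum>x\<in>midpoint_set width height. g x) =
     (\<Sum>j<n. \<Sum>k\<le>2 * m. g (mid j k)) + (\<Sum>i<m. \<Sum>j\<le>n. g (row_mid i j) :: real)"
proof -
  have inj1: "inj_on (\<lambda>(j, k). mid j k) ({..<n} \<times> {..2 * m})" by (auto simp: inj_on_def mid_inj)
  have inj2: "inj_on (\<lambda>(i, j). row_mid i j) ({..<m} \<times> {..n})" by (auto simp: inj_on_def row_mid_inj)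
  have "(\<Sum>x\<in>midpoint_set width height. g x) =
    (\<Sum>x\<in>(\<lambda>(j, k). mid j k) ` ({..<n} \<times> {..2 * m}). g x) + (\<Sum>x\<in>(\<lambda>(i, j). row_mid i j) ` ({..<m} \<times> {..n}). g x)"
    unfolding midpoints by (intro sum.union_disjoint) (auto simp: mid_row_mid mid_row_mid[symmetric])
  then show ?thesis unfolding sum.reindex[OF inj1] sum.reindex[OF inj2]
    by (simp add: sum.cartesian_product case_prod_beta')
qed

text \<open>
  There are \<open>m + n + 3 * m * n\<close> midpoints, but only two per strip are places of exit. This is where the
  constant \<open>1/4\<close> in the bound for the outflow comes from.
\<close>

lemma card_midpoints: "4 * n + 1 \<le> card (midpoint_set width height)"
proof -
  have "real (card (midpoint_set width height)) = (\<Sum>x\<in>midpoint_set width height. 1)" by simp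
  also have "\<dots> = real (n * (2 * m + 1) + m * (n + 1))" unfolding sum_midpoints by (simp add: algebra_simps)
  finally have "card (midpoint_set width height) = n * (2 * m + 1) + m * (n + 1)" by (simp only: of_nat_eq_iff)
  then have "card (midpoint_set width height) = m + n + 3 * (m * n)" by (simp add: algebra_simps)
  moreover have "n \<le> m * n" using m by simp
  ultimately show ?thesis using m by linarith
qed

lemma edge_at_mid:
  assumes "c \<in> families" "j < n" "k \<le> 2 * m"
  shows "edge_at (tri c) (mid j k) = edge j k (c j k)"
  by (rule edge_at_eq[OF tri_edges[OF assms(1)] edge_in_tri[OF assms] edge_mid[OF families_bound[OF assms]]])

lemma edge_at_row_mid:
  assumes "c \<in> families" "i < m" "j \<le> n"
  shows "edge_at (tri c) (row_mid i j) = row_edge i j"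
  by (rule edge_at_eq[OF tri_edges[OF assms(1)] row_edge_in_tri[OF assms(2,3)] row_edge_mid])

lemma families_eqI:
  assumes "c \<in> families" "d \<in> families" "\<And>j k. j < n \<Longrightarrow> k \<le> 2 * m \<Longrightarrow> c j k = d j k"
  shows "c = d"
proof (rule ext)
  fix j
  show "c j = d j"
  proof (cases "j < n")
    case True
    have "c j \<in> extensional {..2 * m}" "d j \<in> extensional {..2 * m}"
      using assms True by (auto simp: families_def PiE_iff)
    then show ?thesis by (rule extensionalityI) (use assms(3) True in auto)
  next
    case False
    then show ?thesis using assms(1,2) by (auto simp: families_def PiE_iff extensional_def)
  qed
qed

lemma tri_inj: "inj_on tri families"
proof (rule inj_onI)
  fix c d assume cd: "c \<in> families" "d \<in> families" "tri c = tri d"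
  show "c = d"
  proof (rule families_eqI[OF cd(1,2)])
    fix j k assume jk: "j < n" "k \<le> 2 * m"
    have "edge j k (c j k) = edge j k (d j k)"
      using edge_at_mid[OF cd(1) jk] edge_at_mid[OF cd(2) jk] cd(3) by simp
    then show "c j k = d j k" using families_bound[OF cd(1) jk] families_bound[OF cd(2) jk] by (rule edge_inj[rotated 2])
  qed
qed

lemma total_length_tri:
  assumes "c \<in> families"
  shows "total_length width height (tri c) =
    (\<Sum>j<n. \<Sum>k\<le>2 * m. edge_length (edge j k (c j k))) + (\<Sum>i<m. \<Sum>j\<le>n. edge_length (row_edge i j))"
  unfolding total_length_def sum_midpoints
  by (intro arg_cong2[where f = "(+)"] sum.cong refl) (auto simp: edge_at_mid edge_at_row_mid assms)

lemma corner_steps: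
  assumes "c \<in> families" "corner c j k"
  shows "c j k = c j (k - 1) \<or> c j k = Suc (c j (k - 1))" "other_value c j k \<le> k" "c j k \<le> k" "j < n" "k \<le> 2 * m"
    "other_value c j k = c j (k - 1) \<and> c j k = Suc (c j (k - 1)) \<or> other_value c j k = Suc (c j (k - 1)) \<and> c j k = c j (k - 1)"
proof -
  have k: "j < n" "0 < k" "k < 2 * m" using assms(2) by (auto simp: corner_def)
  obtain l where l: "k = Suc l" using k(2) by (auto simp: gr0_conv_Suc)
  show s: "c j k = c j (k - 1) \<or> c j k = Suc (c j (k - 1))"
    using strip_pathsD[OF families_paths[OF assms(1)] k(1)] k(3) unfolding strip_path_def l by simp
  have "c j (k - 1) \<le> k - 1" "c j k \<le> k" using families_bound[OF assms(1) k(1)] k by auto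
  then show "other_value c j k \<le> k" "c j k \<le> k" using s k by (auto simp: other_value_def)
  show "j < n" "k \<le> 2 * m" using k by auto
  show "other_value c j k = c j (k - 1) \<and> c j k = Suc (c j (k - 1)) \<or> other_value c j k = Suc (c j (k - 1)) \<and> c j k = c j (k - 1)"
    using s by (auto simp: other_value_def)
qed

lemma turn_corner:
  assumes "c \<in> families" "j < n" "0 < k" "k < 2 * m"
  shows "turn b c j (Suc k) = Suc (turn b c j (k - 1)) \<longleftrightarrow> corner c j k"
    and "corner c j k \<Longrightarrow> 2 * turn b c j (k - 1) + 1 - turn b c j k = (if even j = b then other_value c j k else k - other_value c j k)"
proof -
  have bd: "c j (k - 1) \<le> k - 1" "c j (Suc k) \<le> Suc k" using families_bound[OF assms(1,2)] assms by auto
  show "turn b c j (Suc k) = Suc (turn b c j (k - 1)) \<longleftrightarrow> corner c j k"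
    using bd assms by (auto simp: turn_def corner_def)
  assume c: "corner c j k"
  have "2 * (k - 1 - c j (k - 1)) + 1 - (k - c j k) = k - other_value c j k"
  proof -
    obtain d where d: "k = Suc (c j (k - 1) + d)"
      using bd(1) assms(3) by (metis Suc_pred' le_Suc_ex)
    from corner_steps(6)[OF assms(1) c] show ?thesis
    proof (elim disjE conjE)
      assume "other_value c j k = c j (k - 1)" "c j k = Suc (c j (k - 1))"
      then show ?thesis using d by linarith
    next
      assume "other_value c j k = Suc (c j (k - 1))" "c j k = c j (k - 1)"
      then show ?thesis using d by linarith
    qed
  qed
  then show "2 * turn b c j (k - 1) + 1 - turn b c j k = (if even j = b then other_value c j k else k - other_value c j k)"
    by (auto simp: turn_def other_value_def)
qed

lemma tri_flip_iff:
  assumes c: "c \<in> traps"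
  shows "is_flip (tri c) e e' \<longleftrightarrow> (\<exists>j k. corner c j k \<and> e = edge j k (c j k) \<and> e' = edge j k (other_value c j k))"
proof -
  let ?a = "turn b c" and ?T = "\<lambda>g. if r then swap_segment g else g"
  note cf = traps_families[OF c]
  have "is_flip (tri c) e e' \<longleftrightarrow> is_flip (strips m n ?a) (?T e) (?T e')"
    by (simp add: tri_def swap_is_flip)
  also have "\<dots> \<longleftrightarrow> (\<exists>j k. j < n \<and> Suc k < 2 * m \<and> ?a j (Suc (Suc k)) = Suc (?a j k) \<and>
     ?T e = slanted_edge j (?a j (Suc k)) (Suc k - ?a j (Suc k)) \<and>
     ?T e' = slanted_edge j (2 * ?a j k + 1 - ?a j (Suc k)) (Suc k - (2 * ?a j k + 1 - ?a j (Suc k))))"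
    by (rule strips_flip_iff[OF turn_paths[OF cf] turn_rows_rigid]) (rule traps_trapped[OF c])
  also have "\<dots> \<longleftrightarrow> (\<exists>j k. corner c j (Suc k) \<and> e = edge j (Suc k) (c j (Suc k)) \<and> e' = edge j (Suc k) (other_value c j (Suc k)))"
  proof (intro ex_cong1)
    fix j k
    show "(j < n \<and> Suc k < 2 * m \<and> ?a j (Suc (Suc k)) = Suc (?a j k) \<and>
     ?T e = slanted_edge j (?a j (Suc k)) (Suc k - ?a j (Suc k)) \<and>
     ?T e' = slanted_edge j (2 * ?a j k + 1 - ?a j (Suc k)) (Suc k - (2 * ?a j k + 1 - ?a j (Suc k)))) \<longleftrightarrow>
     (corner c j (Suc k) \<and> e = edge j (Suc k) (c j (Suc k)) \<and> e' = edge j (Suc k) (other_value c j (Suc k)))" (is "?L \<longleftrightarrow> ?R")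
    proof (cases "j < n \<and> Suc k < 2 * m \<and> corner c j (Suc k)")
      case False
      then show ?thesis using turn_corner(1)[OF cf, of j "Suc k"] by (auto simp: corner_def)
    next
      case True
      have TT: "?T g = h \<longleftrightarrow> g = ?T h" for g h by (metis swap_segment_swap)
      have 1: "?T (slanted_edge j (?a j (Suc k)) (Suc k - ?a j (Suc k))) = edge j (Suc k) (c j (Suc k))"
        using corner_steps(3)[OF cf, of j "Suc k"] True by (intro edge_turn) (auto simp: turn_def)
      have 2: "?T (slanted_edge j (2 * ?a j k + 1 - ?a j (Suc k)) (Suc k - (2 * ?a j k + 1 - ?a j (Suc k)))) = edge j (Suc k) (other_value c j (Suc k))"
        using corner_steps(2)[OF cf, of j "Suc k"] True turn_corner(2)[OF cf, of j "Suc k"] by (intro edge_turn) auto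
      show ?thesis unfolding TT 1 2 using True turn_corner(1)[OF cf, of j "Suc k"] by auto
    qed
  qed
  also have "\<dots> \<longleftrightarrow> (\<exists>j k. corner c j k \<and> e = edge j k (c j k) \<and> e' = edge j k (other_value c j k))"
    by (metis corner_def gr0_implies_Suc)
  finally show ?thesis .
qed

lemma flip_at_tri:
  assumes c: "c \<in> families" and k: "corner c j k"
  shows "insert (edge j k (other_value c j k)) (tri c - {edge j k (c j k)}) = tri (flip_at c j k)"
    and "flip_at c j k \<in> families"
proof -
  let ?a = "turn b c" and ?T = "\<lambda>g. if r then swap_segment g else g"
  obtain l where l: "k = Suc l" "j < n" "Suc l < 2 * m" using k by (auto simp: corner_def gr0_conv_Suc)
  have cor: "?a j (Suc (Suc l)) = Suc (?a j l)" using turn_corner(1)[OF c l(2), of k] k l by simp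
  define v where "v = 2 * ?a j l + 1 - ?a j (Suc l)"
  have v: "v = (if even j = b then other_value c j k else k - other_value c j k)"
    using turn_corner(2)[OF c l(2), of k] k l by (simp add: v_def)
  have a': "turn b (flip_at c j k) = ?a(j := (?a j)(Suc l := v))"
    unfolding v l(1) by (auto simp: turn_def flip_at_def fun_eq_iff)
  note up = strips_corner_update[OF turn_paths[OF c] l(2,3) cor v_def a']
  have 1: "?T (slanted_edge j (?a j (Suc l)) (Suc l - ?a j (Suc l))) = edge j k (c j k)"
    unfolding l(1) using corner_steps(3)[OF c k] l by (intro edge_turn) (auto simp: turn_def)
  have 2: "?T (slanted_edge j v (Suc l - v)) = edge j k (other_value c j k)"
    unfolding l(1) using corner_steps(2)[OF c k] v l by (intro edge_turn) auto
  have "tri (flip_at c j k) = (if r then swap_edges (strips m n (turn b (flip_at c j k))) else strips m n (turn b (flip_at c j k)))"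
    by (simp add: tri_def)
  also have "\<dots> = insert (?T (slanted_edge j v (Suc l - v))) (tri c - {?T (slanted_edge j (?a j (Suc l)) (Suc l - ?a j (Suc l)))})"
    unfolding up(1)[symmetric] tri_def swap_edges_def
    by (cases r) (simp_all only: if_True if_False image_insert image_set_diff[OF inj_swap_segment] image_empty)
  finally show "insert (edge j k (other_value c j k)) (tri c - {edge j k (c j k)}) = tri (flip_at c j k)" unfolding 1 2 by simp
  have step: "strip_path m ((c j)(k := other_value c j k))"
  proof -
    have p: "c j 0 = 0" "c j (2 * m) = m" "\<And>i. i < 2 * m \<Longrightarrow> c j (Suc i) = c j i \<or> c j (Suc i) = Suc (c j i)"
      using strip_pathsD[OF families_paths[OF c] l(2)] by (auto simp: strip_path_def)
    have "other_value c j k = c j l \<or> other_value c j k = Suc (c j l)" "c j (Suc k) = Suc (c j l)"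
      using corner_steps(6)[OF c k] k l by (auto simp: corner_def)
    then show ?thesis unfolding strip_path_def using p l by auto
  qed
  then show "flip_at c j k \<in> families"
    using c l by (auto simp: families_def flip_at_def PiE_iff extensional_def)
qed

lemma flip_at_flip_at:
  assumes "c \<in> families" "corner c j k"
  shows "corner (flip_at c j k) j k" "flip_at (flip_at c j k) j k = c" "other_value (flip_at c j k) j k = c j k"
    "flip_at c j k j k = other_value c j k"
proof -
  have k: "0 < k" using assms(2) by (simp add: corner_def)
  show "corner (flip_at c j k) j k" using assms(2) by (auto simp: corner_def flip_at_def)
  show o: "other_value (flip_at c j k) j k = c j k"
  proof -
    have "other_value (flip_at c j k) j k = 2 * c j (k - 1) + 1 - other_value c j k"
      unfolding other_value_def[of "flip_at c j k"] using k by (simp add: flip_at_def)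
    then show ?thesis using corner_steps(6)[OF assms] by linarith
  qed
  have "flip_at (flip_at c j k) j k = (flip_at c j k)(j := (flip_at c j k j)(k := c j k))"
    using o by (simp add: flip_at_def[of "flip_at c j k"])
  also have "\<dots> = c" by (simp add: flip_at_def)
  finally show "flip_at (flip_at c j k) j k = c" .
  show "flip_at c j k j k = other_value c j k" by (simp add: flip_at_def)
qed

lemma total_length_flip_at:
  assumes "c \<in> families" "corner c j k"
  shows "total_length width height (tri (flip_at c j k)) =
    total_length width height (tri c) - edge_length (edge j k (c j k)) + edge_length (edge j k (other_value c j k))"
proof -
  let ?g = "\<lambda>c i l. edge_length (edge i l (c i l))"
  have jk: "j < n" "k \<le> 2 * m" using corner_steps[OF assms] by auto
  have outer: "(\<Sum>i<n. \<Sum>l\<le>2 * m. ?g d i l) = (\<Sum>i\<in>{..<n} - {j}. \<Sum>l\<le>2 * m. ?g d i l) +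
      (?g d j k + (\<Sum>l\<in>{..2 * m} - {k}. ?g d j l))" for d
    using sum.remove[of "{..<n}" j "\<lambda>i. \<Sum>l\<le>2 * m. ?g d i l"] sum.remove[of "{..2 * m}" k "?g d j"] jk by simp
  have "(\<Sum>i\<in>{..<n} - {j}. \<Sum>l\<le>2 * m. ?g (flip_at c j k) i l) = (\<Sum>i\<in>{..<n} - {j}. \<Sum>l\<le>2 * m. ?g c i l)"
    by (intro sum.cong refl) (auto simp: flip_at_def)
  moreover have "(\<Sum>l\<in>{..2 * m} - {k}. ?g (flip_at c j k) j l) = (\<Sum>l\<in>{..2 * m} - {k}. ?g c j l)"
    by (intro sum.cong refl) (auto simp: flip_at_def)
  moreover have "?g (flip_at c j k) j k = edge_length (edge j k (other_value c j k))" by (simp add: flip_at_def)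
  ultimately show ?thesis
    unfolding total_length_tri[OF assms(1)] total_length_tri[OF flip_at_tri(2)[OF assms]] outer by simp
qed

end

section \<open>The dynamics near a trap\<close>

text \<open>
  A step of the dynamics once the midpoint \<open>x\<close> has been chosen.
\<close>

definition resample :: "real \<Rightarrow> segment set \<Rightarrow> point \<Rightarrow> segment set pmf" where
  "resample lam \<sigma> x =
     (let e = edge_at \<sigma> x; e' = flipped_edge \<sigma> e in
       if flippable \<sigma> e
       then map_pmf (\<lambda>accept. if accept then insert e' (\<sigma> - {e}) else \<sigma>)
              (bernoulli_pmf (lam powr edge_length e' /
                 (lam powr edge_length e' + lam powr edge_length e)))
       else return_pmf \<sigma>)"

lemma glauber_step_resample:
  "glauber_step lam m n \<sigma> = bind_pmf (pmf_of_set (midpoint_set m n)) (resample lam \<sigma>)"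
  unfolding glauber_step_def resample_def ..

lemma prob_coin:
  assumes "0 \<le> p" "p \<le> 1" "s \<notin> X"
  shows "measure_pmf.prob (map_pmf (\<lambda>a. if a then u else s) (bernoulli_pmf p)) X = (if u \<in> X then p else 0)"
proof -
  have "(\<lambda>a. if a then u else s) -` X = (if u \<in> X then {True} else {})" using assms(3) by (auto split: if_splits)
  then show ?thesis using assms(1,2) by (simp add: measure_pmf_single)
qed

context zigzag
begin

definition weight :: "segment set \<Rightarrow> real" where
  "weight \<sigma> = lam powr total_length width height \<sigma>"

definition accept :: "(nat \<Rightarrow> nat \<Rightarrow> nat) \<Rightarrow> nat \<Rightarrow> nat \<Rightarrow> real" where
  "accept c j k = lam powr edge_length (edge j k (other_value c j k)) /
     (lam powr edge_length (edge j k (other_value c j k)) + lam powr edge_length (edge j k (c j k)))"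

lemma weight_pos: "0 < weight \<sigma>" using lam by (simp add: weight_def)

lemma accept_bounds: "0 \<le> accept c j k" "accept c j k \<le> 1"
  using lam by (auto simp: accept_def divide_le_eq not_less intro: add_pos_pos)

lemma flippable_iff:
  assumes "c \<in> traps"
  shows "flippable (tri c) e \<longleftrightarrow> (\<exists>j k. corner c j k \<and> e = edge j k (c j k))"
  unfolding flippable_def tri_flip_iff[OF assms] by blast

lemma flipped_edge_corner:
  assumes "c \<in> traps" "corner c j k"
  shows "flipped_edge (tri c) (edge j k (c j k)) = edge j k (other_value c j k)"
  unfolding flipped_edge_def tri_flip_iff[OF assms(1)]
proof (rule the_equality)
  fix e' assume "\<exists>j' k'. corner c j' k' \<and> edge j k (c j k) = edge j' k' (c j' k') \<and> e' = edge j' k' (other_value c j' k')"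
  then obtain j' k' where e: "corner c j' k'" "edge j k (c j k) = edge j' k' (c j' k')" "e' = edge j' k' (other_value c j' k')" by blast
  have "mid j k = mid j' k'"
    using e(2) edge_mid[of "c j k" k j] edge_mid[of "c j' k'" k' j']
      corner_steps(3)[OF traps_families[OF assms(1)]] assms(2) e(1) by metis
  then show "e' = edge j k (other_value c j k)" using e(3) by (simp add: mid_inj)
qed (use assms in blast)

lemma resample_corner:
  assumes "c \<in> traps" "corner c j k"
  shows "resample lam (tri c) (mid j k) =
    map_pmf (\<lambda>a. if a then tri (flip_at c j k) else tri c) (bernoulli_pmf (accept c j k))"
proof -
  note cf = traps_families[OF assms(1)]
  have e: "edge_at (tri c) (mid j k) = edge j k (c j k)"
    using edge_at_mid[OF cf] corner_steps(4,5)[OF cf assms(2)] by simp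
  have "flippable (tri c) (edge j k (c j k))" using flippable_iff[OF assms(1)] assms(2) by blast
  then show ?thesis
    unfolding resample_def Let_def e flipped_edge_corner[OF assms] flip_at_tri(1)[OF cf assms(2)] accept_def by simp
qed

lemma resample_idle:
  assumes c: "c \<in> traps" and x: "x \<in> midpoint_set width height" and nc: "\<And>j k. x = mid j k \<Longrightarrow> \<not> corner c j k"
  shows "resample lam (tri c) x = return_pmf (tri c)"
proof -
  note cf = traps_families[OF c]
  from x consider j k where "j < n" "k \<le> 2 * m" "x = mid j k" | i j where "i < m" "j \<le> n" "x = row_mid i j"
    unfolding midpoints by auto
  then have em: "edge_midpoint (edge_at (tri c) x) = x"
  proof cases
    case 1
    then show ?thesis using edge_at_mid[OF cf 1(1,2)] edge_mid families_bound[OF cf 1(1,2)] by simp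
  next
    case 2
    then show ?thesis using edge_at_row_mid[OF cf 2(1,2)] row_edge_mid by simp
  qed
  have "\<not> flippable (tri c) (edge_at (tri c) x)"
  proof
    assume "flippable (tri c) (edge_at (tri c) x)"
    then obtain j k where jk: "corner c j k" "edge_at (tri c) x = edge j k (c j k)"
      unfolding flippable_iff[OF c] by blast
    then have "x = mid j k" using em edge_mid corner_steps(3)[OF cf jk(1)] by metis
    then show False using nc jk(1) by blast
  qed
  then show ?thesis by (simp add: resample_def Let_def)
qed

lemma resample_move:
  assumes c: "c \<in> traps" and d: "d \<in> traps" "d \<noteq> c" and x: "x \<in> midpoint_set width height"
    and nm: "\<And>j k. x = mid j k \<Longrightarrow> corner c j k \<Longrightarrow> d \<noteq> flip_at c j k"
  shows "pmf (resample lam (tri c) x) (tri d) = 0"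
proof -
  have ne: "tri d \<noteq> tri c" using tri_inj d c traps_families by (auto dest: inj_onD)
  show ?thesis
  proof (cases "\<exists>j k. x = mid j k \<and> corner c j k")
    case True
    then obtain j k where jk: "x = mid j k" "corner c j k" by blast
    have "tri d \<noteq> tri (flip_at c j k)"
      using tri_inj d(1) nm[OF jk] flip_at_tri(2)[OF traps_families[OF c] jk(2)] traps_families by (auto dest: inj_onD)
    then show ?thesis unfolding jk(1) resample_corner[OF c jk(2)]
      using prob_coin[OF accept_bounds, of "tri c" "{tri d}" "tri (flip_at c j k)"] ne
      by (simp add: measure_pmf_single)
  next
    case False
    then show ?thesis using resample_idle[OF c x] ne by auto
  qed
qed

text \<open>
  If the flip at \<open>x\<close> leads from \<open>c\<close> to \<open>d\<close>, then the flip at \<open>x\<close> leads back, the weights differ only by the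
  lengths of the two diagonals, and both acceptance probabilities have the same denominator. Otherwise
  neither transition is possible.
\<close>

lemma resample_reversible:
  assumes c: "c \<in> traps" and d: "d \<in> traps" and x: "x \<in> midpoint_set width height"
  shows "weight (tri c) * pmf (resample lam (tri c) x) (tri d) = weight (tri d) * pmf (resample lam (tri d) x) (tri c)"
proof (cases "d = c")
  case False
  show ?thesis
  proof (cases "\<exists>j k. x = mid j k \<and> corner c j k \<and> d = flip_at c j k")
    case True
    then obtain j k where jk: "x = mid j k" "corner c j k" "d = flip_at c j k" by blast
    note cf = traps_families[OF c]
    note ff = flip_at_flip_at[OF cf jk(2), folded jk(3)]
    have ne: "tri d \<noteq> tri c" using tri_inj d c False traps_families by (auto dest: inj_onD)
    let ?u = "edge_length (edge j k (other_value c j k))" and ?v = "edge_length (edge j k (c j k))"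
    have 1: "pmf (resample lam (tri c) x) (tri d) = lam powr ?u / (lam powr ?u + lam powr ?v)"
      unfolding jk(1) resample_corner[OF c jk(2), folded jk(3)]
      using prob_coin[OF accept_bounds, of "tri c" "{tri d}" "tri d" c j k] ne
      by (simp add: measure_pmf_single accept_def)
    have 2: "pmf (resample lam (tri d) x) (tri c) = lam powr ?v / (lam powr ?v + lam powr ?u)"
      unfolding jk(1) resample_corner[OF d ff(1)] ff(2)
      using prob_coin[OF accept_bounds, of "tri d" "{tri c}" "tri c" d j k] ne
      by (simp add: measure_pmf_single accept_def ff(3,4))
    have "total_length width height (tri c) + ?u = total_length width height (tri d) + ?v"
      using total_length_flip_at[OF cf jk(2)] jk(3) by simp
    then have "weight (tri c) * lam powr ?u = weight (tri d) * lam powr ?v"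
      unfolding weight_def by (metis powr_add)
    then show ?thesis unfolding 1 2 by (simp add: add.commute)
  next
    case no: False
    have "\<not> (x = mid j k \<and> corner d j k \<and> c = flip_at d j k)" for j k
      using no flip_at_flip_at[OF traps_families[OF d], of j k] by metis
    then have "pmf (resample lam (tri d) x) (tri c) = 0" using False by (intro resample_move[OF d c _ x]) auto
    moreover have "pmf (resample lam (tri c) x) (tri d) = 0" using no False by (intro resample_move[OF c d _ x]) auto
    ultimately show ?thesis by simp
  qed
qed simp

lemma midpoints_nonempty: "midpoint_set width height \<noteq> {}"
  using card_midpoints by auto

lemma step_reversible:
  assumes c: "c \<in> traps" and d: "d \<in> traps"
  shows "weight (tri c) * pmf (glauber_step lam width height (tri c)) (tri d) =
    weight (tri d) * pmf (glauber_step lam width height (tri d)) (tri c)"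
  unfolding glauber_step_resample pmf_bind integral_pmf_of_set[OF midpoints_nonempty midpoints_finite] times_divide_eq_right
    sum_distrib_left
  by (intro arg_cong2[where f = "(/)"] sum.cong refl resample_reversible[OF c d])

text \<open>
  Strictly inside the frozen parts there are no corners, because all steps there are of the same kind, and
  corners in the free part do not affect the frozen values.
\<close>

lemma flip_at_traps:
  assumes c: "c \<in> traps" and jk: "corner c j k" and k: "k \<noteq> half m" "k \<noteq> 2 * m - half m"
  shows "flip_at c j k \<in> traps"
proof -
  have j: "j < n" "0 < k" "k < 2 * m" "c j (Suc k) = Suc (c j (k - 1))" using jk by (auto simp: corner_def)
  note t = traps_trapped[OF c j(1)]
  have "\<not> k \<le> half m" using trappedD(2)[OF t, of "Suc k"] j(4) k(1) by auto
  moreover have "\<not> 2 * m \<le> k + half m"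
  proof
    assume "2 * m \<le> k + half m"
    then have h: "2 * m \<le> (k - 1) + half m" "2 * m \<le> Suc k + half m" using k(2) by linarith+
    have "c j (k - 1) + m = k - 1" by (rule trappedD(3)[OF t _ h(1)]) (use j(3) in linarith)
    moreover have "c j (Suc k) + m = Suc k" by (rule trappedD(3)[OF t _ h(2)]) (use j(3) in linarith)
    ultimately show False using j(2,4) by linarith
  qed
  moreover have "strip_path m (flip_at c j k j)"
    using strip_pathsD[OF families_paths[OF flip_at_tri(2)[OF traps_families[OF c] jk]] j(1)] .
  ultimately have "trapped m (flip_at c j k j)" using t by (auto simp: trapped_def flip_at_def)
  then show ?thesis using c j by (auto simp: traps_def flip_at_def PiE_iff trap_paths_def extensional_def)
qed

text \<open>
  An exit at the beginning requires the free part to start with a rise. It shortens the edge (or keeps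
  its length if \<open>m \<le> 2\<close>), so that it is accepted with probability at most \<open>1/2\<close>.
\<close>

lemma corner_first:
  assumes c: "c \<in> traps" and jk: "corner c j (half m)"
  shows "c j (Suc (half m)) = 1" "accept c j (half m) \<le> 1 / 2"
proof -
  have j: "j < n" using jk by (auto simp: corner_def)
  have z: "c j (half m) = 0" "c j (half m - 1) = 0" using trappedD(2)[OF traps_trapped[OF c j]] by auto
  then show "c j (Suc (half m)) = 1" using jk by (simp add: corner_def)
  have o: "other_value c j (half m) = 1" using z by (simp add: other_value_def)
  have h: "1 \<le> half m" using half_bounds(4)[OF m] .
  have "edge_length (edge j (half m) 1) \<le> edge_length (edge j (half m) 0)" using h by (simp add: edge_len)
  then have "lam powr edge_length (edge j (half m) 1) \<le> lam powr edge_length (edge j (half m) 0)"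
    using lam by (intro powr_mono) auto
  then show "accept c j (half m) \<le> 1 / 2" unfolding accept_def o z
    using lam by (simp add: divide_le_eq add_pos_pos)
qed

lemma corner_last:
  assumes c: "c \<in> traps" and jk: "corner c j (2 * m - half m)"
  shows "c j (2 * m - half m - 1) = m div 2" "accept c j (2 * m - half m) \<le> 1 / 2"
proof -
  let ?k = "2 * m - half m"
  have j: "j < n" "0 < ?k" "?k < 2 * m" "c j (Suc ?k) = Suc (c j (?k - 1))" using jk by (auto simp: corner_def)
  note t = traps_trapped[OF c j(1)]
  have z: "c j ?k = m div 2" using trapped_ends(2)[OF t] .
  have "c j (Suc ?k) + m = Suc ?k" using trappedD(3)[OF t, of "Suc ?k"] j by auto
  then show p: "c j (?k - 1) = m div 2" using j(4) half_bounds[of m] by linarith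
  have o: "other_value c j ?k = m div 2 + 1" using z p by (simp add: other_value_def)
  have h: "1 \<le> half m" "half m + m div 2 = m" using half_bounds[of m] m by auto
  have le: "m div 2 \<le> ?k" "m div 2 + 1 \<le> ?k" using h by linarith+
  have k: "real ?k - 2 * real (m div 2) = real (half m)" using h by linarith
  have "edge_length (edge j ?k (m div 2 + 1)) = 1 + \<bar>(real ?k - 2 * real (m div 2)) - 2\<bar>"
    unfolding edge_len[OF le(2)] by (simp add: algebra_simps)
  moreover have "edge_length (edge j ?k (m div 2)) = 1 + \<bar>real ?k - 2 * real (m div 2)\<bar>" by (rule edge_len[OF le(1)])
  ultimately have "edge_length (edge j ?k (m div 2 + 1)) \<le> edge_length (edge j ?k (m div 2))"
    unfolding k using h(1) by simp
  then have "lam powr edge_length (edge j ?k (m div 2 + 1)) \<le> lam powr edge_length (edge j ?k (m div 2))"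
    using lam by (intro powr_mono) auto
  then show "accept c j ?k \<le> 1 / 2" unfolding accept_def o z
    using lam by (simp add: divide_le_eq add_pos_pos)
qed

lemma resample_exit:
  assumes c: "c \<in> traps" and x: "x \<in> midpoint_set width height"
  shows "measure_pmf.prob (resample lam (tri c) x) (- tri ` traps) \<le>
    (1 / 2) * (\<Sum>j<n. of_bool (x = mid j (half m) \<and> corner c j (half m)) +
       of_bool (x = mid j (2 * m - half m) \<and> corner c j (2 * m - half m)))" (is "?P \<le> _ * ?S")
proof -
  have nn: "0 \<le> ?S" by (intro sum_nonneg) auto
  show ?thesis
  proof (cases "\<exists>j k. x = mid j k \<and> corner c j k")
    case False
    then have "?P = 0" using resample_idle[OF c x] c by auto
    then show ?thesis using nn by simp
  next
    case True
    then obtain j k where jk: "x = mid j k" "corner c j k" by blast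
    have P: "?P = (if tri (flip_at c j k) \<in> - tri ` traps then accept c j k else 0)"
      unfolding jk(1) resample_corner[OF c jk(2)] using c by (intro prob_coin accept_bounds) auto
    show ?thesis
    proof (cases "k = half m \<or> k = 2 * m - half m")
      case False
      then have "?P = 0" using P flip_at_traps[OF c jk(2)] by auto
      then show ?thesis using nn by simp
    next
      case k: True
      then have "?P \<le> 1 / 2"
        using P accept_bounds[of c j k] corner_first(2)[OF c, of j] corner_last(2)[OF c, of j] jk(2) by auto
      moreover have "1 \<le> ?S"
      proof -
        have "1 \<le> (of_bool (x = mid j (half m) \<and> corner c j (half m)) +
          of_bool (x = mid j (2 * m - half m) \<and> corner c j (2 * m - half m)) :: real)"
          using k jk by auto
        also have "\<dots> \<le> ?S" using jk(2) by (intro member_le_sum) (auto simp: corner_def)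
        finally show ?thesis .
      qed
      ultimately show ?thesis by simp
    qed
  qed
qed

lemma step_exit:
  assumes c: "c \<in> traps"
  shows "measure_pmf.prob (glauber_step lam width height (tri c)) (- tri ` traps) \<le>
    (\<Sum>j<n. of_bool (corner c j (half m)) + of_bool (corner c j (2 * m - half m))) /
      (2 * real (card (midpoint_set width height)))"
proof -
  let ?L = "midpoint_set width height"
  have pick: "(\<Sum>x\<in>?L. of_bool (x = y \<and> Q) :: real) \<le> of_bool Q" for y Q
  proof -
    have "(\<Sum>x\<in>?L. of_bool (x = y \<and> Q) :: real) = (\<Sum>x\<in>?L. if x = y then of_bool Q else 0)"
      by (intro sum.cong) auto
    then show ?thesis using midpoints_finite by (simp add: sum.delta)
  qed
  have "(\<Sum>x\<in>?L. measure_pmf.prob (resample lam (tri c) x) (- tri ` traps)) \<le>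
    (\<Sum>x\<in>?L. (1 / 2) * (\<Sum>j<n. of_bool (x = mid j (half m) \<and> corner c j (half m)) +
       of_bool (x = mid j (2 * m - half m) \<and> corner c j (2 * m - half m))))"
    by (intro sum_mono resample_exit[OF c])
  also have "\<dots> = (1 / 2) * (\<Sum>j<n. (\<Sum>x\<in>?L. of_bool (x = mid j (half m) \<and> corner c j (half m))) +
       (\<Sum>x\<in>?L. of_bool (x = mid j (2 * m - half m) \<and> corner c j (2 * m - half m))))"
    unfolding sum_distrib_left[symmetric] by (subst sum.swap) (simp add: sum.distrib)
  also have "\<dots> \<le> (1 / 2) * (\<Sum>j<n. of_bool (corner c j (half m)) + of_bool (corner c j (2 * m - half m)))"
    by (intro mult_left_mono sum_mono add_mono pick) auto
  finally have "(\<Sum>x\<in>?L. measure_pmf.prob (resample lam (tri c) x) (- tri ` traps)) / real (card ?L) \<le>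
    (1 / 2) * (\<Sum>j<n. of_bool (corner c j (half m)) + of_bool (corner c j (2 * m - half m))) / real (card ?L)"
    by (rule divide_right_mono) simp
  then show ?thesis
    unfolding glauber_step_resample prob_bind_pmf integral_pmf_of_set[OF midpoints_nonempty midpoints_finite]
    by simp
qed

lemma total_length_excess:
  assumes "c \<in> families"
  shows "total_length width height (tri c) =
    (\<Sum>j<n. real (2 * m + 1) + path_excess m (c j)) + (\<Sum>i<m. \<Sum>j\<le>n. edge_length (row_edge i j))"
proof -
  have "(\<Sum>k\<le>2 * m. edge_length (edge j k (c j k))) = real (2 * m + 1) + path_excess m (c j)" if "j < n" for j
  proof -
    have "(\<Sum>k\<le>2 * m. edge_length (edge j k (c j k))) = (\<Sum>k\<le>2 * m. 1 + \<bar>real k - 2 * real (c j k)\<bar>)"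
      using families_bound[OF assms that] by (intro sum.cong) (auto simp: edge_len)
    then show ?thesis by (simp add: sum.distrib path_excess_def)
  qed
  then show ?thesis unfolding total_length_tri[OF assms] by simp
qed

text \<open>
  Peierls' argument: an injective surgery that gains the length \<open>2 * (m div 2)\<close> shows that its
  domain has relative weight at most \<open>lam powr (- 2 * real (m div 2))\<close>.
\<close>

lemma surgery_weight:
  assumes j: "j < n" and BT: "B \<subseteq> traps"
    and S: "\<And>c. c \<in> B \<Longrightarrow> S (c j) \<in> trap_paths m"
      "\<And>c. c \<in> B \<Longrightarrow> path_excess m (S (c j)) = path_excess m (c j) + 2 * real (m div 2)"
      "inj_on S {c j | c. c \<in> B}"
  shows "(\<Sum>c\<in>B. weight (tri c)) \<le> lam powr (- 2 * real (m div 2)) * (\<Sum>c\<in>traps. weight (tri c))"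
proof -
  define R where "R c = c(j := S (c j))" for c :: "nat \<Rightarrow> nat \<Rightarrow> nat"
  have RT: "R c \<in> traps" if "c \<in> B" for c
    using BT that S(1)[OF that] j by (auto simp: R_def traps_def PiE_iff extensional_def)
  have w: "weight (tri c) = lam powr (- 2 * real (m div 2)) * weight (tri (R c))" if c: "c \<in> B" for c
  proof -
    have f: "c \<in> families" "R c \<in> families" using c RT BT traps_families by auto
    have "(\<Sum>i<n. real (2 * m + 1) + path_excess m (R c i)) = (\<Sum>i<n. real (2 * m + 1) + path_excess m (c i)) + 2 * real (m div 2)"
    proof -
      have "(\<Sum>i\<in>{..<n} - {j}. real (2 * m + 1) + path_excess m (R c i)) = (\<Sum>i\<in>{..<n} - {j}. real (2 * m + 1) + path_excess m (c i))"
        by (intro sum.cong) (auto simp: R_def)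
      moreover have "path_excess m (R c j) = path_excess m (c j) + 2 * real (m div 2)" using S(2)[OF c] by (simp add: R_def)
      ultimately show ?thesis
        using sum.remove[of "{..<n}" j "\<lambda>i. real (2 * m + 1) + path_excess m (R c i)"]
          sum.remove[of "{..<n}" j "\<lambda>i. real (2 * m + 1) + path_excess m (c i)"] j by simp
    qed
    then have "total_length width height (tri c) = - 2 * real (m div 2) + total_length width height (tri (R c))"
      unfolding total_length_excess[OF f(1)] total_length_excess[OF f(2)] by simp
    then show ?thesis unfolding weight_def by (simp only: powr_add)
  qed
  have "inj_on R B"
  proof (rule inj_onI)
    fix c d assume cd: "c \<in> B" "d \<in> B" "R c = R d"
    have "S (c j) = S (d j)" using fun_cong[OF cd(3), of j] by (simp add: R_def)
    then have "c j = d j" using S(3) cd by (auto dest: inj_onD)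
    moreover have "c i = d i" if "i \<noteq> j" for i using fun_cong[OF cd(3), of i] that by (simp add: R_def)
    ultimately show "c = d" by (metis ext)
  qed
  then have "(\<Sum>c\<in>B. weight (tri (R c))) = (\<Sum>c\<in>R ` B. weight (tri c))" by (simp add: sum.reindex)
  also have "\<dots> \<le> (\<Sum>c\<in>traps. weight (tri c))"
    using RT finite_traps weight_pos by (intro sum_mono2) (auto intro: less_imp_le)
  finally have "lam powr (- 2 * real (m div 2)) * (\<Sum>c\<in>B. weight (tri (R c))) \<le> lam powr (- 2 * real (m div 2)) * (\<Sum>c\<in>traps. weight (tri c))"
    by (intro mult_left_mono) auto
  then show ?thesis using w by (simp add: sum_distrib_left)
qed

lemma corner_first_weight:
  assumes "j < n"
  shows "(\<Sum>c\<in>traps. weight (tri c) * of_bool (corner c j (half m))) \<le>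
    lam powr (- 2 * real (m div 2)) * (\<Sum>c\<in>traps. weight (tri c))"
proof -
  let ?B = "{c \<in> traps. corner c j (half m)}"
  have B: "c j \<in> trap_paths m" "c j (Suc (half m)) = 1" "trapped m (c j)" if "c \<in> ?B" for c
    using that corner_first(1)[of c j] traps_trapped[of c j] assms by (auto simp: traps_def PiE_iff)
  have "(\<Sum>c\<in>traps. weight (tri c) * of_bool (corner c j (half m))) = (\<Sum>c\<in>?B. weight (tri c))"
    using finite_traps by (simp add: sum.inter_filter of_bool_def if_distrib cong: if_cong)
  also have "\<dots> \<le> lam powr (- 2 * real (m div 2)) * (\<Sum>c\<in>traps. weight (tri c))"
  proof (rule surgery_weight[OF assms, where S = "delay_rise m"])
    show "inj_on (delay_rise m) {c j | c. c \<in> ?B}"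
      by (rule inj_on_subset[OF delay_rise_inj]) (use B in auto)
  qed (use B delay_rise_trap_paths delay_rise_excess m in auto)
  finally show ?thesis .
qed

lemma corner_last_weight:
  assumes "j < n"
  shows "(\<Sum>c\<in>traps. weight (tri c) * of_bool (corner c j (2 * m - half m))) \<le>
    lam powr (- 2 * real (m div 2)) * (\<Sum>c\<in>traps. weight (tri c))"
proof -
  let ?B = "{c \<in> traps. corner c j (2 * m - half m)}"
  have B: "c j \<in> trap_paths m" "c j (2 * m - half m - 1) = m div 2" "trapped m (c j)" if "c \<in> ?B" for c
    using that corner_last(1)[of c j] traps_trapped[of c j] assms by (auto simp: traps_def PiE_iff)
  have "(\<Sum>c\<in>traps. weight (tri c) * of_bool (corner c j (2 * m - half m))) = (\<Sum>c\<in>?B. weight (tri c))"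
    using finite_traps by (simp add: sum.inter_filter of_bool_def if_distrib cong: if_cong)
  also have "\<dots> \<le> lam powr (- 2 * real (m div 2)) * (\<Sum>c\<in>traps. weight (tri c))"
  proof (rule surgery_weight[OF assms, where S = "advance_flat m"])
    show "inj_on (advance_flat m) {c j | c. c \<in> ?B}"
      by (rule inj_on_subset[OF advance_flat_inj]) (use B in auto)
  qed (use B advance_flat_trap_paths advance_flat_excess m in auto)
  finally show ?thesis .
qed

text \<open>
  The factor \<open>n / |\<Lambda>|\<close> counts two places of exit per strip, each chosen with probability \<open>1 / |\<Lambda>|\<close> and
  accepted with probability at most \<open>1/2\<close>.
\<close>

lemma exit_flow:
  "(\<Sum>c\<in>traps. weight (tri c) * measure_pmf.prob (glauber_step lam width height (tri c)) (- tri ` traps)) \<le>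
     (real n / real (card (midpoint_set width height))) * lam powr (- 2 * real (m div 2)) * (\<Sum>c\<in>traps. weight (tri c))"
proof -
  let ?N = "real (card (midpoint_set width height))" and ?Z = "\<Sum>c\<in>traps. weight (tri c)"
  have "(\<Sum>c\<in>traps. weight (tri c) * measure_pmf.prob (glauber_step lam width height (tri c)) (- tri ` traps)) \<le>
    (\<Sum>c\<in>traps. weight (tri c) * ((\<Sum>j<n. of_bool (corner c j (half m)) + of_bool (corner c j (2 * m - half m))) / (2 * ?N)))"
    by (intro sum_mono mult_left_mono step_exit) (auto intro: less_imp_le weight_pos)
  also have "\<dots> = (\<Sum>c\<in>traps. \<Sum>j<n. weight (tri c) * (of_bool (corner c j (half m)) + of_bool (corner c j (2 * m - half m)))) / (2 * ?N)"
    by (simp add: sum_divide_distrib sum_distrib_left)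
  also have "\<dots> = (\<Sum>j<n. (\<Sum>c\<in>traps. weight (tri c) * of_bool (corner c j (half m))) +
      (\<Sum>c\<in>traps. weight (tri c) * of_bool (corner c j (2 * m - half m)))) / (2 * ?N)"
    by (subst sum.swap) (simp only: distrib_left sum.distrib)
  also have "\<dots> \<le> (\<Sum>j<n. lam powr (- 2 * real (m div 2)) * ?Z + lam powr (- 2 * real (m div 2)) * ?Z) / (2 * ?N)"
    by (intro divide_right_mono sum_mono add_mono corner_first_weight corner_last_weight) auto
  also have "\<dots> = real n / ?N * lam powr (- 2 * real (m div 2)) * ?Z"
    by (simp add: field_simps)
  finally show ?thesis .
qed

text \<open>
  The bound \<open>n / |\<Lambda>| < 1/4\<close> makes the loss over \<open>t\<close> steps strictly less than a quarter of the weight of the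
  trap. For \<open>m = 1\<close> the admissible times are \<open>t \<le> 1\<close>, which is what the smallest rectangles require.
\<close>

lemma trap_survival:
  assumes t: "real t \<le> lam powr (2 * real (m div 2))"
  shows "\<exists>\<sigma>\<in>triangulations width height.
    3 / 4 < measure_pmf.prob (glauber_law lam width height t \<sigma>) (tri ` traps)"
proof -
  let ?N = "real (card (midpoint_set width height))" and ?Z = "\<Sum>c\<in>traps. weight (tri c)"
  let ?q = "real n / ?N" and ?H = "\<lambda>c. measure_pmf.prob (glauber_law lam width height t (tri c)) (tri ` traps)"
  have inj: "inj_on tri traps" by (rule inj_on_subset[OF tri_inj]) (use traps_families in auto)
  have "traps \<noteq> {}" unfolding traps_def using trap_paths_nonempty by (auto simp: PiE_eq_empty_iff)
  then have Z: "0 < ?Z" using finite_traps weight_pos by (intro sum_pos) auto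
  have "4 * real n + 1 \<le> ?N" using card_midpoints by linarith
  then have q: "0 \<le> ?q" "?q < 1 / 4" using n by (auto simp: divide_less_eq)
  have "(\<Sum>\<sigma>\<in>tri ` traps. weight \<sigma>) - real t *
      (\<Sum>\<sigma>\<in>tri ` traps. weight \<sigma> * measure_pmf.prob (glauber_step lam width height \<sigma>) (- tri ` traps))
    \<le> (\<Sum>\<sigma>\<in>tri ` traps. weight \<sigma> * measure_pmf.prob (glauber_law lam width height t \<sigma>) (tri ` traps))"
    by (rule reversible_trap) (auto simp: finite_traps step_reversible intro: less_imp_le weight_pos)
  then have surv: "?Z - real t * (\<Sum>c\<in>traps. weight (tri c) * measure_pmf.prob (glauber_step lam width height (tri c)) (- tri ` traps))
    \<le> (\<Sum>c\<in>traps. weight (tri c) * ?H c)"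
    by (simp add: sum.reindex[OF inj])
  have "real t * (\<Sum>c\<in>traps. weight (tri c) * measure_pmf.prob (glauber_step lam width height (tri c)) (- tri ` traps))
    \<le> real t * (?q * lam powr (- 2 * real (m div 2)) * ?Z)"
    by (intro mult_left_mono exit_flow) auto
  also have "\<dots> = (real t * lam powr (- 2 * real (m div 2))) * (?q * ?Z)" by simp
  also have "\<dots> \<le> 1 * (?q * ?Z)"
  proof (intro mult_right_mono)
    have "real t * lam powr (- 2 * real (m div 2)) \<le> lam powr (2 * real (m div 2)) * lam powr (- 2 * real (m div 2))"
      by (intro mult_right_mono t) auto
    also have "\<dots> = 1" using lam by (simp flip: powr_add)
    finally show "real t * lam powr (- 2 * real (m div 2)) \<le> 1" .
    show "0 \<le> ?q * ?Z" using q Z by simp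
  qed
  also have "\<dots> < 1 / 4 * ?Z" unfolding mult_1 by (intro mult_strict_right_mono q Z)
  finally have "3 / 4 * ?Z < (\<Sum>c\<in>traps. weight (tri c) * ?H c)" using surv by simp
  then have "\<exists>c\<in>traps. 3 / 4 < ?H c"
  proof (rule contrapos_pp)
    assume "\<not> (\<exists>c\<in>traps. 3 / 4 < ?H c)"
    then have "(\<Sum>c\<in>traps. weight (tri c) * ?H c) \<le> (\<Sum>c\<in>traps. weight (tri c) * (3 / 4))"
      by (intro sum_mono mult_left_mono) (auto intro: less_imp_le weight_pos)
    also have "\<dots> = 3 / 4 * ?Z" unfolding sum_distrib_right[symmetric] by simp
    finally show "\<not> 3 / 4 * ?Z < (\<Sum>c\<in>traps. weight (tri c) * ?H c)" by simp
  qed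
  then show ?thesis using tri_triangulation traps_families by blast
qed

end

section \<open>The mixing time\<close>

text \<open>
  At the end of the frozen beginning of the lowest strip, the edges of the two zigzags have the same
  midpoint but opposite slopes.
\<close>

lemma opposite_traps_disjoint:
  assumes z: "zigzag lam m n" and c: "c \<in> zigzag.traps m n" and d: "d \<in> zigzag.traps m n"
  shows "zigzag.tri m n True r c \<noteq> zigzag.tri m n False r d"
proof
  interpret T: zigzag lam m n True r by (rule z)
  interpret F: zigzag lam m n False r by (rule z)
  assume eq: "T.tri c = F.tri d"
  have c0: "c 0 (half m) = 0" "d 0 (half m) = 0"
    using trappedD(2)[OF T.traps_trapped[OF c]] trappedD(2)[OF T.traps_trapped[OF d]] T.n by simp_all
  have h: "1 \<le> half m" "half m \<le> 2 * m" using half_bounds[of m] T.m by auto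
  have "T.edge 0 (half m) 0 = F.edge 0 (half m) 0"
    using T.edge_at_mid[OF T.traps_families[OF c], of 0 "half m"] F.edge_at_mid[OF F.traps_families[OF d], of 0 "half m"]
      c0 h T.n eq by simp
  then have "slanted_edge 0 0 (half m) = slanted_edge 0 (half m) 0"
    unfolding T.edge_def F.edge_def by (cases r) (simp_all add: Let_def inj_eq[OF inj_swap_segment])
  then show False using h(1) by (auto simp: slanted_edge_def doubleton_eq_iff)
qed

lemma tv_dist_ge: "\<bar>measure_pmf.prob p A - measure_pmf.prob q A\<bar> \<le> tv_dist p q"
  unfolding tv_dist_def
proof (rule cSUP_upper)
  have "\<bar>measure_pmf.prob p B - measure_pmf.prob q B\<bar> \<le> 1" for B
    using measure_nonneg[of p B] measure_nonneg[of q B] measure_pmf.prob_le_1[of p B] measure_pmf.prob_le_1[of q B]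
    by linarith
  then show "bdd_above (range (\<lambda>A. \<bar>measure_pmf.prob p A - measure_pmf.prob q A\<bar>))"
    by (intro bdd_aboveI2)
qed simp

text \<open>
  Two disjoint traps cannot both have equilibrium probability above \<open>1/2\<close>. A chain that stays with
  probability above \<open>3/4\<close> in a trap of equilibrium probability at most \<open>1/2\<close> is not yet mixed.
\<close>

lemma far_from_equilibrium:
  assumes z: "zigzag lam m n" and t: "real t \<le> lam powr (2 * real (m div 2))"
    and MN: "M = (if r then n else m)" "N = (if r then m else n)"
  shows "1 / 4 < (MAX \<sigma> \<in> triangulations M N. tv_dist (glauber_law lam M N t \<sigma>) (gibbs lam M N))"
proof -
  interpret T: zigzag lam m n True r by (rule z)
  interpret F: zigzag lam m n False r by (rule z)
  have M: "M = T.width" "M = F.width" "N = T.height" "N = F.height"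
    using MN by (simp_all add: T.width_def F.width_def T.height_def F.height_def)
  let ?G = "gibbs lam M N" and ?A = "T.tri ` T.traps" and ?B = "F.tri ` F.traps"
  have "?A \<inter> ?B = {}" using opposite_traps_disjoint[OF z] by blast
  then have "measure_pmf.prob ?G ?A + measure_pmf.prob ?G ?B = measure_pmf.prob ?G (?A \<union> ?B)"
    by (intro measure_pmf.finite_measure_Union[symmetric]) auto
  also have "\<dots> \<le> 1" by (rule measure_pmf.prob_le_1)
  finally have "measure_pmf.prob ?G ?A \<le> 1 / 2 \<or> measure_pmf.prob ?G ?B \<le> 1 / 2" by linarith
  then obtain X \<sigma> where X: "measure_pmf.prob ?G X \<le> 1 / 2" "\<sigma> \<in> triangulations M N"
    "3 / 4 < measure_pmf.prob (glauber_law lam M N t \<sigma>) X"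
    using T.trap_survival[OF t, folded M] F.trap_survival[OF t, folded M] by blast
  have "1 / 4 < \<bar>measure_pmf.prob (glauber_law lam M N t \<sigma>) X - measure_pmf.prob ?G X\<bar>" using X by linarith
  also have "\<dots> \<le> tv_dist (glauber_law lam M N t \<sigma>) ?G" by (rule tv_dist_ge)
  also have "\<dots> \<le> (MAX \<sigma> \<in> triangulations M N. tv_dist (glauber_law lam M N t \<sigma>) ?G)"
    using X(2) finite_triangulations by (intro Max_ge) auto
  finally show ?thesis .
qed

lemma mixing_time_ge:
  assumes "\<And>t. (MAX \<sigma> \<in> triangulations m n. tv_dist (glauber_law lam m n t \<sigma>) (gibbs lam m n)) \<le> 1 / 4 \<Longrightarrow> x \<le> real t"
  shows "ereal x \<le> ereal_of_enat (mixing_time lam m n)"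
proof -
  define S where "S = {enat t | t. (MAX \<sigma> \<in> triangulations m n. tv_dist (glauber_law lam m n t \<sigma>) (gibbs lam m n)) \<le> 1 / 4}"
  have mt: "mixing_time lam m n = Inf S" unfolding mixing_time_def S_def ..
  show ?thesis
  proof (cases "S = {}")
    case True
    then show ?thesis by (simp add: mt Inf_enat_def)
  next
    case False
    then obtain k where "k \<in> S" by blast
    then have "(LEAST k. k \<in> S) \<in> S" by (rule LeastI)
    then have "Inf S \<in> S" using False by (simp add: Inf_enat_def)
    then obtain t where t: "Inf S = enat t"
      "(MAX \<sigma> \<in> triangulations m n. tv_dist (glauber_law lam m n t \<sigma>) (gibbs lam m n)) \<le> 1 / 4"
      unfolding S_def mem_Collect_eq by (elim exE conjE)
    show ?thesis unfolding mt t(1) using assms[OF t(2)] by simp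
  qed
qed

theorem theorem1p4:
  fixes lam :: real
  assumes "lam > 1"
  shows "\<exists>c > 0. \<forall>m \<ge> 1. \<forall>n \<ge> 1.
    ereal (exp (c * real (m + n))) \<le> ereal_of_enat (mixing_time lam m n)"
proof (intro exI conjI allI impI)
  \<comment> \<open>The first term serves the unit square, where the bound is just two steps; the second one uses max m n <= 3 * (max m n div 2), valid from side length two on.\<close>
  let ?c = "min (ln 2 / 2) (ln lam / 3)"
  show "0 < ?c" using assms by simp
  fix m n :: nat assume m: "1 \<le> m" and n: "1 \<le> n"
  show "ereal (exp (?c * real (m + n))) \<le> ereal_of_enat (mixing_time lam m n)"
  proof (rule mixing_time_ge)
    fix t
    assume mixed: "(MAX \<sigma> \<in> triangulations m n. tv_dist (glauber_law lam m n t \<sigma>) (gibbs lam m n)) \<le> 1 / 4"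
    have z: "zigzag lam m n" "zigzag lam n m" using assms m n by (simp_all add: zigzag_def)
    have "\<not> real t \<le> lam powr (2 * real (m div 2))"
      using far_from_equilibrium[OF z(1), of t m False n] mixed by (meson linorder_not_le)
    moreover have "\<not> real t \<le> lam powr (2 * real (n div 2))"
      using far_from_equilibrium[OF z(2), of t m True n] mixed by (meson linorder_not_le)
    ultimately have t: "lam powr (2 * real (max m n div 2)) < real t" by (simp add: max_def)
    show "exp (?c * real (m + n)) \<le> real t"
    proof (cases "max m n = 1")
      case True
      then have "m + n = 2" using m n by linarith
      then have "exp (?c * real (m + n)) \<le> exp (ln 2)" by (subst exp_le_cancel_iff) simp
      moreover have "1 < real t" using t True assms by simp
      ultimately show ?thesis by simp
    next
      case False
      have "2 \<le> max m n" using False m n by linarith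
      then have "max m n \<le> 3 * (max m n div 2)" by presburger
      then have "m + n \<le> 6 * (max m n div 2)" using max.cobounded1[of m n] max.cobounded2[of n m] by linarith
      then have "real (m + n) \<le> real (6 * (max m n div 2))" by (rule of_nat_mono)
      then have third: "real (m + n) / 3 \<le> 2 * real (max m n div 2)" by simp
      have "?c * real (m + n) \<le> ln lam / 3 * real (m + n)" by (intro mult_right_mono) auto
      also have "\<dots> = ln lam * (real (m + n) / 3)" by simp
      also have "\<dots> \<le> ln lam * (2 * real (max m n div 2))"
        using assms by (intro mult_left_mono third) auto
      finally have "exp (?c * real (m + n)) \<le> exp (ln lam * (2 * real (max m n div 2)))" by simp
      also have "\<dots> = lam powr (2 * real (max m n div 2))" using assms by (simp add: powr_def mult.commute)
      finally show ?thesis using t by simp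
    qed
  qed
qed

end
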